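(* Let $k\ge 12$ be an even integer, let $a_1,\dots,a_{m(k)}\in\mathbb{R}$, and let $f$ be the normalised modular form of weight $k$ for $\mathbf{SL}(2,\mathbb{Z})$ written as $$f=E_k+\sum_{j=1}^{m(k)}a_j\,E_{k-12j}\,\Delta^j .$$ Let $\epsilon:=\sup_{z\in A}|\Delta(z)|$. Suppose that $$(3+\delta_{12})\sum_{j=1}^{m(k)-1}|a_j|\,\epsilon^j+(3+\delta_s)\,|a_{m(k)}|\,\epsilon^{m(k)}\le 1-\delta_{12}.$$ Then $f$ has $m(k)$ zeros (other than possible zeros at $i$ and $\rho:=e^{2\pi i/3}$) in the fundamental domain $\mathbb{F}$, and they all lie on the arc $A$.
   Context: Every even integer $k\ge 4$ is written uniquely as $k=12\,m(k)+s$ with $m(k)\ge 0$ an integer and $s\in\{0,4,6,8,10,14\}$; this defines $m(k)$ and $s$. $\mathbb{H}$ is the complex upper half plane. The standard fundamental domain for $\mathbf{SL}(2,\mathbb{Z})$ acting on $\mathbb{H}$ is $$\mathbb{F}:=\{z\in\mathbb{H}: |z|\ge 1,\ -\tfrac12\le \Re(z)\le 0\}\cup\{z\in\mathbb{H}: |z|>1,\ 0<\Re(z)<\tfrac12\}.$$ The arc $A$ is $$A:=\{e^{i\theta}: \tfrac{\pi}{2}\le\theta\le\tfrac{2\pi}{3}\}.$$ For even $k\ge 4$ the Eisenstein series of weight $k$ is $E_k(z):=\frac12\sum_{c,d\in\mathbb{Z},\,(c,d)=1}\frac{1}{(cz+d)^k}$, and $E_0:=1$. The cusp form $\Delta$ is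 $\Delta:=\frac{E_4^3-E_6^2}{1728}$. The constants $\delta_t$ are: $\delta_0=-2$, $\delta_4=1.009$, $\delta_6=0.304$, $\delta_8=0.122$, $\delta_{10}=0.051$, and $\delta_t=0.022$ for $t\ge 12$. Convention: if $m(k)=0$ (i.e. $k=14$) there are no coefficients $a_j$, and the left-hand side of the hypothesis is read as $0$. *)

theory Defs
  imports "HOL-Complex_Analysis.Complex_Analysis"
begin

definition weight_residues :: "nat set" where
  "weight_residues = {0, 4, 6, 8, 10, 14}"

definition weight_m :: "nat \<Rightarrow> nat" where
  "weight_m k = (THE m. \<exists>s\<in>weight_residues. k = 12 * m + s)"

definition weight_s :: "nat \<Rightarrow> nat" where
  "weight_s k = (THE s. s \<in> weight_residues \<and> (\<exists>m. k = 12 * m + s))"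

lemma weight_decomp_unique:
  assumes "12 * m + s = 12 * m' + s'" "s \<in> weight_residues" "s' \<in> weight_residues"
  shows "m = m'" "s = s'"
proof -
  have "m = m' \<and> s = s'"
    using assms unfolding weight_residues_def by auto presburger+
  then show "m = m'" "s = s'" by auto
qed

lemma weight_decomp_exists:
  assumes "even k" "4 \<le> k"
  shows "\<exists>m. \<exists>s\<in>weight_residues. k = 12 * m + s"
  using assms unfolding weight_residues_def by simp presburger

lemma weight_decomp:
  assumes "even k" "4 \<le> k"
  shows "k = 12 * weight_m k + weight_s k" "weight_s k \<in> weight_residues"
proof -
  obtain m s where ms: "s \<in> weight_residues" "k = 12 * m + s"
    using weight_decomp_exists[OF assms] by blast
  have "weight_m k = m"
    unfolding weight_m_def by (rule the_equality) (use ms weight_decomp_unique in blast)+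
  moreover have "weight_s k = s"
    unfolding weight_s_def by (rule the_equality) (use ms weight_decomp_unique in blast)+
  ultimately show "k = 12 * weight_m k + weight_s k" "weight_s k \<in> weight_residues"
    using ms by auto
qed

definition upper_half_plane :: "complex set" where
  "upper_half_plane = {z. Im z > 0}"

definition fund_domain :: "complex set" where
  "fund_domain =
     {z \<in> upper_half_plane. cmod z \<ge> 1 \<and> - 1 / 2 \<le> Re z \<and> Re z \<le> 0} \<union>
     {z \<in> upper_half_plane. cmod z > 1 \<and> 0 < Re z \<and> Re z < 1 / 2}"

definition arc_A :: "complex set" where
  "arc_A = {exp (\<i> * complex_of_real \<theta>) | \<theta>. pi / 2 \<le> \<theta> \<and> \<theta> \<le> 2 * pi / 3}"

definition rho :: complex where
  "rho = exp (2 * complex_of_real pi * \<i> / 3)"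

(* Only k = 0 and even k \<ge> 4 are meaningful; the series converges absolutely on the
   upper half plane for k \<ge> 4. *)
definition eisenstein :: "nat \<Rightarrow> complex \<Rightarrow> complex" where
  "eisenstein k z =
     (if k = 0 then 1
      else 1 / 2 * (\<Sum>\<^sub>\<infinity>(c, d)\<in>{(c :: int, d :: int). coprime c d}.
                      1 / (of_int c * z + of_int d) ^ k))"

definition cusp_Delta :: "complex \<Rightarrow> complex" where
  "cusp_Delta z = (eisenstein 4 z ^ 3 - eisenstein 6 z ^ 2) / 1728"

definition sup_Delta :: real where
  "sup_Delta = (SUP z\<in>arc_A. cmod (cusp_Delta z))"

definition delta_const :: "nat \<Rightarrow> real" where
  "delta_const t =
     (if t = 0 then - 2
      else if t = 4 then 1.009
      else if t = 6 then 0.304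
      else if t = 8 then 0.122
      else if t = 10 then 0.051
      else if t \<ge> 12 then 0.022
      else undefined)"

(* For m = 0 there are no coefficients; without the case distinction the second summand would
   contribute the meaningless value a 0. *)
definition coeff_bound :: "nat \<Rightarrow> (nat \<Rightarrow> real) \<Rightarrow> real" where
  "coeff_bound k a =
     (let m = weight_m k; s = weight_s k in
      if m = 0 then 0
      else (3 + delta_const 12) * (\<Sum>j = 1..m - 1. \<bar>a j\<bar> * sup_Delta ^ j)
           + (3 + delta_const s) * \<bar>a m\<bar> * sup_Delta ^ m)"

definition nontrivial_zeros :: "(complex \<Rightarrow> complex) \<Rightarrow> complex set" where
  "nontrivial_zeros f = {z \<in> fund_domain. f z = 0 \<and> z \<noteq> \<i> \<and> z \<noteq> rho}"

end

theory Submission imports Defs begin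

text \<open>
Two facts about the form \<open>f\<close> of weight \<open>k\<close> combine: it has \<open>m(k)\<close> sign changes on the arc, and
  it cannot have more than \<open>m(k)\<close> zeros, counted with multiplicity, in the fundamental domain
  outside \<open>\<i>\<close> and \<open>\<rho>\<close>. So the zeros found on the arc are simple and are all of them.

  \<^emph>\<open>Sign changes.\<close> Since \<open>f\<close> has real coefficients, \<open>f(- cnj z) = cnj (f z)\<close>; on the unit circle
  \<open>- cnj z = - 1 / z\<close>, so modularity makes \<open>z^(k/2) f(z)\<close> real there. In the lattice sum for
  \<open>z^(k/2) E_k(z)\<close> at \<open>z = exp(\<i>\<theta>)\<close> the pairs \<open>(c,d) = (0,\<plusminus>1), (\<plusminus>1,0)\<close> contribute \<open>2 cos(k\<theta>/2)\<close>, and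
  all the others together less than 1.022 if \<open>k \<ge> 12\<close> (\<open>eisenstein_on_arc_large_weight\<close>). The
  same sums bound \<open>E_l\<close> by \<open>3 + \<delta>_l\<close> on the arc for every \<open>l\<close>, so the hypothesis says that
  \<open>f - E_k\<close> is at most \<open>1 - 0.022\<close> there. Hence \<open>z^(k/2) f(z)\<close> stays within distance less than 2
  of \<open>2 cos(k\<theta>/2)\<close>, and at \<open>\<theta> = 2\<pi>l/k\<close> it has the sign \<open>(-1)^l\<close>. The arc contains \<open>m(k) + 1\<close> such
  angles, and the intermediate value theorem gives \<open>m(k)\<close> zeros strictly between them
  (\<open>form_of_zeros_on_arc\<close>).

  \<^emph>\<open>Upper bound.\<close> Integrating \<open>f'/f\<close> around the fundamental domain is awkward because \<open>f\<close> has zeros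
  on the boundary. Instead of indenting the contour, \<open>f\<close> is perturbed. The form
  \<open>G = 10000 E_6^2 - E_4^3\<close> of weight 12 is positive on the vertical sides, and \<open>z^6 G(z)\<close> is
  positive on the circular side; \<open>f\<close>, respectively \<open>z^(k/2) f(z)\<close>, is real there. Therefore
  \<open>F = f^6 + \<i> \<epsilon> G^(k/2)\<close> with \<open>\<epsilon> > 0\<close>, multiplied on the circular side by \<open>z^(3k)\<close>, maps the sides
  into the open upper half plane. A single branch of the logarithm then evaluates the contour
  integral of \<open>F'/F\<close>: only the factor \<open>z^(3k)\<close> on an arc of angle \<open>\<pi>/3\<close> contributes, and \<open>F\<close> has
  exactly \<open>k/2\<close> zeros in the interior (\<open>zero_count_interior\<close>, \<open>perturbed_count\<close>). For small
  \<open>\<epsilon>\<close>, a zero of \<open>f\<close> of order \<open>p\<close> has \<open>6p\<close> zeros of \<open>F\<close> next to it, by Rouche's theorem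
  (\<open>zeros_of_perturbation\<close>). If the zero of \<open>f\<close> is on the boundary, some of these lie
  outside the fundamental domain, but \<open>z \<mapsto> - 1 / z\<close> or \<open>z \<mapsto> z + 1\<close> moves them into it. Comparing
  the counts gives \<open>6 \<Sum> p \<le> k/2\<close>, with an additional 3 on the left if \<open>f(\<i>) = 0\<close>
  (\<open>valence_inequality\<close>). As \<open>k/2 = 6 m(k) + s/2\<close>, this yields \<open>\<Sum> p \<le> m(k)\<close>: directly if
  \<open>s < 12\<close>, and for \<open>s = 14\<close> because modularity under \<open>z \<mapsto> - 1 / z\<close> then forces \<open>f(\<i>) = 0\<close>.
\<close>

section \<open>Coprime pairs ordered by height\<close>

definition coprime_pairs :: "(int \<times> int) set" where
  "coprime_pairs = {(c, d). coprime c d}"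

text \<open>The lattice sums are estimated shell by shell: on the pairs with \<open>max \<bar>c\<bar> \<bar>d\<bar> = N\<close> the summands
  have a common bound, and there are at most \<open>8N\<close> coprime pairs of this kind.\<close>
definition height :: "int \<times> int \<Rightarrow> nat" where
  "height p = nat (max \<bar>fst p\<bar> \<bar>snd p\<bar>)"

definition shell :: "nat \<Rightarrow> (int \<times> int) set" where
  "shell N = {p \<in> coprime_pairs. height p = N}"

lemma height_pos: "p \<in> coprime_pairs \<Longrightarrow> height p \<ge> 1"
proof (rule ccontr)
  assume "p \<in> coprime_pairs" "\<not> height p \<ge> 1"
  then have "coprime (fst p) (snd p)" "fst p = 0" "snd p = 0"
    by (auto simp: coprime_pairs_def height_def)
  then show False by simp
qed

lemma real_height: "real (height (c, d)) = max \<bar>real_of_int c\<bar> \<bar>real_of_int d\<bar>"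
  unfolding height_def by (simp del: of_int_abs add: of_int_max of_int_abs [symmetric])

lemma shell_1_eq: "shell 1 = {(1,0),(-1,0),(0,1),(0,-1),(1,1),(-1,-1),(1,-1),(-1,1)}"
proof -
  have "p \<in> shell 1 \<Longrightarrow> p \<in> {(1,0),(-1,0),(0,1),(0,-1),(1,1),(-1,-1),(1,-1),(-1,1)}" for p
  proof -
    assume "p \<in> shell 1"
    then obtain c d where p: "p = (c,d)" "coprime c d" "max \<bar>c\<bar> \<bar>d\<bar> = 1"
      by (cases p) (auto simp: shell_def coprime_pairs_def height_def)
    then have "c \<in> {-1,0,1}" "d \<in> {-1,0,1}" by (auto simp: max_def split: if_splits)
    with p show ?thesis by (auto)
  qed
  then show ?thesis by (auto simp: shell_def coprime_pairs_def height_def)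
qed

text \<open>For \<open>N \<ge> 2\<close> coprimality excludes the corners and the points on the axes, so each of the four
  sides of the square contributes \<open>2(N - 1)\<close> points. Excluding them matters: the constants
  \<open>\<delta>_l\<close> leave little room, and with \<open>8N\<close> the pairs of height 2 would be counted twice.\<close>
lemma finite_card_shell:
  assumes "N \<ge> 2"
  shows "finite (shell N)" "card (shell N) \<le> 8 * (N - 1)"
proof -
  define U V :: "int set" where "U = {int N, - int N}" and "V = {- int (N-1)..int (N-1)} - {0}"
  have sub: "shell N \<subseteq> U \<times> V \<union> V \<times> U"
  proof
    fix p assume "p \<in> shell N"
    then obtain c d where p: "p = (c,d)" "coprime c d" "max \<bar>c\<bar> \<bar>d\<bar> = int N"
      by (cases p) (auto simp: shell_def coprime_pairs_def height_def)
    have nz: "c \<noteq> 0" "d \<noteq> 0" using p assms by (auto simp: max_def split: if_splits)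
    have "\<bar>c\<bar> \<noteq> \<bar>d\<bar>"
    proof
      assume "\<bar>c\<bar> = \<bar>d\<bar>"
      then have "\<bar>c\<bar> dvd c" "\<bar>c\<bar> dvd d" by (auto simp: abs_if split: if_splits)
      then have "is_unit \<bar>c\<bar>" using p(2) coprime_common_divisor by blast
      then show False using p assms \<open>\<bar>c\<bar> = \<bar>d\<bar>\<close> by auto
    qed
    then show "p \<in> U \<times> V \<union> V \<times> U" using p nz assms
      by (auto simp: U_def V_def max_def split: if_splits)
  qed
  have fin: "finite U" "finite V" by (auto simp: U_def V_def)
  have cU: "card U \<le> 2" unfolding U_def by (simp add: card_insert_if)
  have cV: "card V = 2 * (N - 1)" unfolding V_def using assms by (simp add: card_Diff_singleton)
  have "card (shell N) \<le> card (U \<times> V \<union> V \<times> U)"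
    by (rule card_mono) (use fin sub in auto)
  also have "\<dots> \<le> card (U \<times> V) + card (V \<times> U)" by (rule card_Un_le)
  also have "\<dots> = 2 * (card U * card V)" by (simp add: card_cartesian_product)
  also have "\<dots> \<le> 2 * (2 * (2 * (N - 1)))" using cU cV by simp
  finally show "card (shell N) \<le> 8 * (N - 1)" by simp
  show "finite (shell N)" using finite_subset[OF sub] fin by auto
qed

lemma finite_card_shell':
  assumes "N \<ge> 1"
  shows "finite (shell N)" "card (shell N) \<le> 8 * N"
  using assms finite_card_shell[of N] shell_1_eq by (cases "N = 1"; auto)+

lemma sum_le_shells:
  fixes g :: "int \<times> int \<Rightarrow> real" and b :: "nat \<Rightarrow> real"
  assumes "finite X" "X \<subseteq> coprime_pairs" "n0 \<ge> 1"
    and X0: "\<And>p. p \<in> X \<Longrightarrow> height p \<ge> n0"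
    and g: "\<And>p. p \<in> X \<Longrightarrow> g p \<le> b (height p)" and b: "\<And>n. b n \<ge> 0"
  shows "\<exists>M. sum g X \<le> (\<Sum>N=n0..M. real (card (shell N)) * b N)"
proof -
  define M where "M = Max (insert 0 (height ` X))"
  have ht: "height ` X \<subseteq> {n0..M}" using assms X0 by (auto simp: M_def)
  have "sum g X \<le> (\<Sum>p\<in>X. b (height p))" by (rule sum_mono) (use g in auto)
  also have "\<dots> = (\<Sum>N=n0..M. \<Sum>p | p \<in> X \<and> height p = N. b (height p))"
    by (rule sum.group[symmetric]) (use assms ht in auto)
  also have "\<dots> \<le> (\<Sum>N=n0..M. real (card (shell N)) * b N)"
  proof (rule sum_mono)
    fix N assume N: "N \<in> {n0..M}"
    have N1: "N \<ge> 1" using N assms by auto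
    have "(\<Sum>p | p \<in> X \<and> height p = N. b (height p)) = real (card {p \<in> X. height p = N}) * b N"
      by simp
    also have "\<dots> \<le> real (card (shell N)) * b N"
    proof (rule mult_right_mono)
      have "card {p \<in> X. height p = N} \<le> card (shell N)"
        by (rule card_mono) (use finite_card_shell'[OF N1] assms in \<open>auto simp: shell_def\<close>)
      then show "real (card {p \<in> X. height p = N}) \<le> real (card (shell N))" by linarith
    qed (rule b)
    finally show "(\<Sum>p | p \<in> X \<and> height p = N. b (height p)) \<le> real (card (shell N)) * b N" .
  qed
  finally show ?thesis by blast
qed

text \<open>Telescoping with \<open>1/(2(N - 1/2)^2) - 1/(2(N + 1/2)^2) \<ge> 1/N^3\<close>; the value at \<open>N = 3\<close> is \<open>2/25\<close>.\<close>
lemma sum_inverse_cubes_from_3_le: "(\<Sum>N=3..M. 1 / real N ^ 3) \<le> 2 / 25"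
proof (cases "M \<ge> 2")
  case True
  have "(\<Sum>N=3..M. 1 / real N ^ 3) \<le> 2 / 25 - 1 / (2 * (real M + 1/2)\<^sup>2)"
    using True
  proof (induction M rule: nat_induct_at_least)
    case base
    then show ?case by (simp add: power2_eq_square)
  next
    case (Suc n)
    define x where "x = real n + 1"
    have x: "x \<ge> 3" using Suc by (simp add: x_def)
    have p: "(x - 1/2)\<^sup>2 > 0" "(x + 1/2)\<^sup>2 > 0" using x by auto
    have "1 / (2 * (x - 1/2)\<^sup>2) - 1 / (2 * (x + 1/2)\<^sup>2) = x / ((x - 1/2)\<^sup>2 * (x + 1/2)\<^sup>2)"
      using p by (simp add: divide_simps) (simp add: power2_eq_square algebra_simps)
    also have "\<dots> = x / ((x\<^sup>2 - 1/4)\<^sup>2)"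
      by (simp add: power_mult_distrib [symmetric]) (simp add: power2_eq_square algebra_simps)
    also have "\<dots> \<ge> x / ((x\<^sup>2)\<^sup>2)"
    proof (rule divide_left_mono)
      show "(x\<^sup>2 - 1/4)\<^sup>2 \<le> (x\<^sup>2)\<^sup>2"
      proof (rule power_mono)
        have "x\<^sup>2 \<ge> 3\<^sup>2" using x by (intro power_mono) auto
        then show "0 \<le> x\<^sup>2 - 1/4" by simp
      qed auto
      have "x\<^sup>2 \<ge> 3\<^sup>2" using x by (intro power_mono) auto
      then show "0 < (x\<^sup>2)\<^sup>2 * (x\<^sup>2 - 1/4)\<^sup>2" using x by (intro mult_pos_pos) auto
    qed (use x in auto)
    also have "x / ((x\<^sup>2)\<^sup>2) = 1 / x ^ 3" using x by (simp add: divide_simps) (simp add: eval_nat_numeral)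
    finally have "1 / x ^ 3 \<le> 1 / (2 * (x - 1/2)\<^sup>2) - 1 / (2 * (x + 1/2)\<^sup>2)" .
    moreover have e: "real (Suc n) = x" "real n + 1/2 = x - 1/2" by (simp_all add: x_def)
    moreover have "(\<Sum>N = 3..n. 1 / real N ^ 3) \<le> 2 / 25 - 1 / (2 * (x - 1/2)\<^sup>2)"
      using Suc.IH unfolding e .
    moreover have "(\<Sum>N = 3..Suc n. 1 / real N ^ 3) = (\<Sum>N = 3..n. 1 / real N ^ 3) + 1 / x ^ 3"
      unfolding e(1)[symmetric] using Suc.hyps by simp
    ultimately show ?case unfolding e(1) by linarith
  qed
  also have "\<dots> \<le> 2 / 25" by simp
  finally show ?thesis .
qed simp

lemma summable_inverse_height_cube:
  "(\<lambda>p. 1 / real (height p) ^ 3) summable_on coprime_pairs"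
proof (rule nonneg_bdd_above_summable_on)
  define B where "B = (\<Sum>n. inverse (real n ^ 2))"
  have sm: "summable (\<lambda>n. inverse (real n ^ 2))" by (rule inverse_power_summable) simp
  show "bdd_above (sum (\<lambda>p. 1 / real (height p) ^ 3) ` {F. F \<subseteq> coprime_pairs \<and> finite F})"
  proof (rule bdd_aboveI2)
    fix X assume X: "X \<in> {F. F \<subseteq> coprime_pairs \<and> finite F}"
    obtain M where M: "(\<Sum>p\<in>X. 1 / real (height p) ^ 3)
       \<le> (\<Sum>N=1..M. real (card (shell N)) * (1 / real N ^ 3))"
      using sum_le_shells[of X 1 "\<lambda>p. 1 / real (height p) ^ 3" "\<lambda>N. 1 / real N ^ 3"] X height_pos
      by auto
    also have "\<dots> \<le> (\<Sum>N=1..M. 8 * inverse (real N ^ 2))"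
    proof (rule sum_mono)
      fix N assume N: "N \<in> {1..M}"
      have "real (card (shell N)) * (1 / real N ^ 3) \<le> real (8 * N) * (1 / real N ^ 3)"
        by (rule mult_right_mono) (use finite_card_shell'[of N] N in \<open>auto simp del: of_nat_mult\<close>)
      also have "\<dots> = 8 * inverse (real N ^ 2)" using N by (simp add: divide_simps) (simp add: eval_nat_numeral)
      finally show "real (card (shell N)) * (1 / real N ^ 3) \<le> 8 * inverse (real N ^ 2)" .
    qed
    also have "\<dots> = 8 * (\<Sum>N=1..M. inverse (real N ^ 2))" by (simp add: sum_distrib_left)
    also have "\<dots> \<le> 8 * B" unfolding B_def
      by (intro mult_left_mono sum_le_suminf sm) auto
    finally show "(\<Sum>p\<in>X. 1 / real (height p) ^ 3) \<le> 8 * B" .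
  qed
qed auto

section \<open>Eisenstein series on the upper half plane\<close>

definition lin :: "complex \<Rightarrow> int \<times> int \<Rightarrow> complex" where
  "lin z p = of_int (fst p) * z + of_int (snd p)"

lemma eisenstein_eq:
  "k > 0 \<Longrightarrow> eisenstein k z = 1 / 2 * (\<Sum>\<^sub>\<infinity>p\<in>coprime_pairs. 1 / lin z p ^ k)"
  unfolding eisenstein_def coprime_pairs_def lin_def by (simp add: case_prod_unfold)

lemma cmod_lin_ge_Im: "cmod (lin z p) \<ge> \<bar>real_of_int (fst p)\<bar> * \<bar>Im z\<bar>"
  using abs_Im_le_cmod[of "lin z p"] by (simp add: lin_def abs_mult)

text \<open>If \<open>\<bar>d\<bar> \<ge> 2 \<bar>c\<bar> \<bar>z\<bar>\<close>, then \<open>\<bar>cz + d\<bar> \<ge> \<bar>d\<bar>/2\<close>; otherwise the imaginary part \<open>\<bar>c\<bar> Im z\<close> is already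
  comparable with the height. The factor is bounded below on compact sets, which gives locally
  uniform convergence of the Eisenstein series.\<close>
lemma cmod_lin_ge:
  assumes "Im z > 0"
  shows "Im z / (2 * (1 + cmod z)) * real (height p) \<le> cmod (lin z p)"
proof -
  define y where "y = Im z"
  define e where "e = y / (2 * (1 + cmod z))"
  obtain c d where p: "p = (c, d)" by (cases p)
  have y: "0 < y" "y \<le> cmod z" using assms abs_Im_le_cmod[of z] by (auto simp: y_def)
  have e: "e > 0" "e \<le> 1/2" "e \<le> y" using y by (auto simp: e_def divide_simps)
  have c: "\<bar>real_of_int c\<bar> * y \<le> cmod (lin z p)"
    using cmod_lin_ge_Im[of p z] y by (simp add: p y_def)
  have 1: "e * \<bar>real_of_int c\<bar> \<le> cmod (lin z p)"
    using c mult_right_mono[OF e(3), of "\<bar>real_of_int c\<bar>"] by (simp add: mult.commute)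
  have 2: "e * \<bar>real_of_int d\<bar> \<le> cmod (lin z p)"
  proof (cases "\<bar>real_of_int d\<bar> \<ge> 2 * \<bar>real_of_int c\<bar> * cmod z")
    case True
    have "cmod (of_int d) \<le> cmod (lin z p) + cmod (of_int c * z)"
      using norm_triangle_ineq4[of "lin z p" "of_int c * z"] by (simp add: lin_def p)
    then have "\<bar>real_of_int d\<bar> / 2 \<le> cmod (lin z p)" using True by (simp add: norm_mult)
    moreover have "e * \<bar>real_of_int d\<bar> \<le> (1/2) * \<bar>real_of_int d\<bar>"
      by (rule mult_right_mono) (use e in auto)
    ultimately show ?thesis by simp
  next
    case False
    have "e * \<bar>real_of_int d\<bar> \<le> e * (2 * \<bar>real_of_int c\<bar> * (1 + cmod z))"
      using False e by (intro mult_left_mono) (auto simp: algebra_simps)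
    also have "\<dots> = \<bar>real_of_int c\<bar> * y"
    proof -
      have "1 + cmod z \<noteq> 0" using norm_ge_zero[of z] by linarith
      then show ?thesis by (simp add: e_def field_simps)
    qed
    finally show ?thesis using c by simp
  qed
  show ?thesis using 1 2 unfolding p real_height e_def y_def by (auto simp: max_def)
qed

lemma lin_nonzero: "Im z > 0 \<Longrightarrow> p \<in> coprime_pairs \<Longrightarrow> lin z p \<noteq> 0"
proof
  assume a: "Im z > 0" "p \<in> coprime_pairs" "lin z p = 0"
  have "Im z / (2 * (1 + cmod z)) * real (height p) > 0"
    using a height_pos[of p] by (intro mult_pos_pos divide_pos_pos) (auto intro: add_pos_nonneg)
  then show False using cmod_lin_ge[of z p] a by simp
qed

lemma inverse_lin_power_le:
  assumes "Im z > 0" "0 < e" "e \<le> Im z / (2 * (1 + cmod z))" "k \<ge> 3" "p \<in> coprime_pairs"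
  shows "norm (1 / lin z p ^ k) \<le> (1 / e) ^ k * (1 / real (height p) ^ 3)"
proof -
  have h: "real (height p) \<ge> 1" using height_pos[OF assms(5)] by simp
  have "e * real (height p) \<le> cmod (lin z p)"
    using cmod_lin_ge[OF assms(1), of p] mult_right_mono[OF assms(3), of "real (height p)"] by simp
  then have "(e * real (height p)) ^ k \<le> cmod (lin z p) ^ k"
    using assms(2) by (intro power_mono) auto
  then have "1 / cmod (lin z p) ^ k \<le> 1 / (e * real (height p)) ^ k"
    using assms(2) h by (intro divide_left_mono mult_pos_pos zero_less_power) 
       (auto simp: lin_nonzero assms)
  also have "\<dots> = (1 / e) ^ k * (1 / real (height p) ^ k)" by (simp add: power_mult_distrib power_divide)
  also have "\<dots> \<le> (1 / e) ^ k * (1 / real (height p) ^ 3)"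
    using assms h by (intro mult_left_mono divide_left_mono power_increasing) auto
  finally show ?thesis by (simp add: norm_divide norm_power)
qed

lemma abs_summable_lin:
  assumes "Im z > 0" "k \<ge> 3"
  shows "(\<lambda>p. norm (1 / lin z p ^ k)) summable_on coprime_pairs"
proof -
  define e where "e = Im z / (2 * (1 + cmod z))"
  have "e > 0" unfolding e_def using assms by (auto intro!: divide_pos_pos add_pos_nonneg)
  show ?thesis
    by (rule Infinite_Sum.abs_summable_on_comparison_test'
        [OF summable_on_cmult_right[OF summable_inverse_height_cube, of "(1/e)^k"]])
       (rule inverse_lin_power_le, use assms \<open>e > 0\<close> in \<open>auto simp: e_def\<close>)
qed

lemma summable_lin:
  assumes "Im z > 0" "k \<ge> 3" "X \<subseteq> coprime_pairs"
  shows "(\<lambda>p. 1 / lin z p ^ k) summable_on X"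
  using abs_summable_summable[OF abs_summable_lin[OF assms(1,2)]] assms(3)
  by (rule summable_on_subset_banach)

lemma open_upper_half_plane: "open upper_half_plane"
  unfolding upper_half_plane_def by (rule open_halfspace_Im_gt)

lemma convex_upper_half_plane: "convex upper_half_plane"
  unfolding upper_half_plane_def by (rule convex_halfspace_Im_gt)

lemma eisenstein_holomorphic:
  assumes "k \<ge> 3"
  shows "eisenstein k holomorphic_on upper_half_plane"
proof -
  have "eisenstein k analytic_on upper_half_plane"
    unfolding analytic_on_def
  proof
    fix z0 assume z0: "z0 \<in> upper_half_plane"
    define y where "y = Im z0"
    have y: "y > 0" using z0 by (simp add: y_def upper_half_plane_def)
    define r where "r = y / 2"
    define e where "e = (y / 2) / (2 * (1 + (cmod z0 + y / 2)))"
    have e: "e > 0" unfolding e_def using y by (auto intro!: divide_pos_pos add_pos_nonneg)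
    have near: "Im z > 0 \<and> e \<le> Im z / (2 * (1 + cmod z))" if "z \<in> cball z0 r" for z
    proof -
      have d: "cmod (z - z0) \<le> y / 2" using that by (simp add: r_def dist_norm norm_minus_commute)
      have 1: "Im z \<ge> y / 2" using abs_Im_le_cmod[of "z - z0"] d by (simp add: y_def)
      have 2: "cmod z \<le> cmod z0 + y / 2" using norm_triangle_ineq2[of z z0] d by linarith
      have "e \<le> Im z / (2 * (1 + cmod z))" unfolding e_def
        by (rule frac_le) (use 1 2 y in \<open>auto intro: add_pos_nonneg\<close>)
      then show ?thesis using 1 y by linarith
    qed
    have ul: "uniform_limit (cball z0 r) (\<lambda>X z. \<Sum>p\<in>X. 1 / lin z p ^ k)
            (\<lambda>z. \<Sum>\<^sub>\<infinity>p\<in>coprime_pairs. 1 / lin z p ^ k) (finite_subsets_at_top coprime_pairs)"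
    proof (rule Weierstrass_m_test_general)
      show "(\<lambda>p. (1 / e) ^ k * (1 / real (height p) ^ 3)) summable_on coprime_pairs"
        by (rule summable_on_cmult_right[OF summable_inverse_height_cube])
    qed (use inverse_lin_power_le[OF _ e] near assms in auto)
    have ev: "\<forall>\<^sub>F X in finite_subsets_at_top coprime_pairs.
        continuous_on (cball z0 r) (\<lambda>z. \<Sum>p\<in>X. 1 / lin z p ^ k) \<and>
        (\<lambda>z. \<Sum>p\<in>X. 1 / lin z p ^ k) holomorphic_on ball z0 r"
    proof (rule eventually_finite_subsets_at_top_weakI)
      fix X :: "(int \<times> int) set" assume X: "finite X" "X \<subseteq> coprime_pairs"
      have h: "(\<lambda>z. \<Sum>p\<in>X. 1 / lin z p ^ k) holomorphic_on cball z0 r"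
      proof (intro holomorphic_intros)
        fix p z assume "p \<in> X" "z \<in> cball z0 r"
        then have "lin z p \<noteq> 0" using near[of z] lin_nonzero[of z p] X by blast
        then show "lin z p ^ k \<noteq> 0" by simp
      next
        fix p show "(\<lambda>z. lin z p) holomorphic_on cball z0 r"
          unfolding lin_def by (intro holomorphic_intros)
      qed
      show "continuous_on (cball z0 r) (\<lambda>z. \<Sum>p\<in>X. 1 / lin z p ^ k) \<and>
        (\<lambda>z. \<Sum>p\<in>X. 1 / lin z p ^ k) holomorphic_on ball z0 r"
        using h holomorphic_on_imp_continuous_on holomorphic_on_subset ball_subset_cball by blast
    qed
    have "(\<lambda>z. \<Sum>\<^sub>\<infinity>p\<in>coprime_pairs. 1 / lin z p ^ k) holomorphic_on ball z0 r"
      using holomorphic_uniform_limit[OF ev ul finite_subsets_at_top_neq_bot] by blast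
    then have "(\<lambda>z. 1 / 2 * (\<Sum>\<^sub>\<infinity>p\<in>coprime_pairs. 1 / lin z p ^ k)) holomorphic_on ball z0 r"
      by (intro holomorphic_intros)
    moreover have "eisenstein k = (\<lambda>z. 1 / 2 * (\<Sum>\<^sub>\<infinity>p\<in>coprime_pairs. 1 / lin z p ^ k))"
      using eisenstein_eq assms by auto
    ultimately show "\<exists>e>0. eisenstein k holomorphic_on ball z0 e"
      using y by (intro exI[of _ r]) (auto simp: r_def)
  qed
  then show ?thesis by (rule analytic_imp_holomorphic)
qed

lemma eisenstein_periodic:
  assumes "k > 0"
  shows "eisenstein k (z + 1) = eisenstein k z"
proof -
  have "bij_betw (\<lambda>(c, d). (c, d + c)) coprime_pairs coprime_pairs"
    by (rule bij_betw_byWitness[where f' = "\<lambda>(c, d). (c, d - c)"])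
       (auto simp: coprime_pairs_def coprime_def dvd_add_left_iff dvd_diff_left_iff)
  then have "(\<Sum>\<^sub>\<infinity>p\<in>coprime_pairs. 1 / lin z ((\<lambda>(c, d). (c, d + c)) p) ^ k)
      = (\<Sum>\<^sub>\<infinity>p\<in>coprime_pairs. 1 / lin z p ^ k)"
    by (rule infsum_reindex_bij_betw)
  moreover have "lin z ((\<lambda>(c, d). (c, d + c)) p) = lin (z + 1) p" for p
    by (cases p) (simp add: lin_def algebra_simps)
  ultimately show ?thesis using assms by (simp only: eisenstein_eq)
qed

lemma eisenstein_inversion:
  assumes "k > 0" "z \<noteq> 0"
  shows "eisenstein k (- 1 / z) = z ^ k * eisenstein k z"
proof -
  have "bij_betw (\<lambda>(c, d). (d, - c)) coprime_pairs coprime_pairs"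
    by (rule bij_betw_byWitness[where f' = "\<lambda>(c, d). (- d, c)"])
       (auto simp: coprime_pairs_def coprime_commute)
  then have "(\<Sum>\<^sub>\<infinity>p\<in>coprime_pairs. 1 / lin z ((\<lambda>(c, d). (d, - c)) p) ^ k)
      = (\<Sum>\<^sub>\<infinity>p\<in>coprime_pairs. 1 / lin z p ^ k)"
    by (rule infsum_reindex_bij_betw)
  moreover have "1 / lin (- 1 / z) p ^ k = z ^ k * (1 / lin z ((\<lambda>(c, d). (d, - c)) p) ^ k)" for p
  proof -
    have "lin (- 1 / z) p = lin z ((\<lambda>(c, d). (d, - c)) p) / z"
      using assms by (cases p) (simp add: lin_def field_simps)
    then show ?thesis by (simp add: power_divide)
  qed
  ultimately have "(\<Sum>\<^sub>\<infinity>p\<in>coprime_pairs. 1 / lin (- 1 / z) p ^ k)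
      = z ^ k * (\<Sum>\<^sub>\<infinity>p\<in>coprime_pairs. 1 / lin z p ^ k)"
    by (simp only: infsum_cmult_right')
  then show ?thesis using assms by (simp only: eisenstein_eq mult.left_commute)
qed

lemma eisenstein_cnj:
  assumes "k > 0"
  shows "cnj (eisenstein k z) = eisenstein k (- cnj z)"
proof -
  have "bij_betw (\<lambda>(c, d). (- c, d)) coprime_pairs coprime_pairs"
    by (rule bij_betw_byWitness[where f' = "\<lambda>(c, d). (- c, d)"])
       (auto simp: coprime_pairs_def)
  then have "(\<Sum>\<^sub>\<infinity>p\<in>coprime_pairs. 1 / lin (- cnj z) ((\<lambda>(c, d). (- c, d)) p) ^ k)
      = (\<Sum>\<^sub>\<infinity>p\<in>coprime_pairs. 1 / lin (- cnj z) p ^ k)"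
    by (rule infsum_reindex_bij_betw)
  moreover have "lin (- cnj z) ((\<lambda>(c, d). (- c, d)) p) = cnj (lin z p)" for p
    by (simp add: lin_def split_beta)
  moreover have "cnj (\<Sum>\<^sub>\<infinity>p\<in>coprime_pairs. 1 / lin z p ^ k)
      = (\<Sum>\<^sub>\<infinity>p\<in>coprime_pairs. 1 / cnj (lin z p) ^ k)"
    using infsum_cnj[of "\<lambda>p. 1 / lin z p ^ k" coprime_pairs, symmetric]
    by (simp only: complex_cnj_divide complex_cnj_power complex_cnj_one)
  ultimately show ?thesis using assms
    by (simp only: eisenstein_eq complex_cnj_mult complex_cnj_divide complex_cnj_one complex_cnj_numeral)
qed

section \<open>Main terms and remainder of Eisenstein series\<close>

lemma cmod_lin_power2:
  "(cmod (lin z (c, d)))\<^sup>2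
     = (real_of_int c)\<^sup>2 * (cmod z)\<^sup>2 + 2 * real_of_int c * real_of_int d * Re z + (real_of_int d)\<^sup>2"
  by (simp add: lin_def cmod_power2) (simp add: power2_eq_square algebra_simps)

text \<open>In the closed fundamental domain \<open>\<bar>cz + d\<bar>^2 \<ge> c^2 - \<bar>cd\<bar> + d^2\<close>, and completing the square in
  either variable leaves three quarters of the square of the other one.\<close>
lemma cmod_lin_power2_ge:
  assumes "cmod z \<ge> 1" "\<bar>Re z\<bar> \<le> 1/2"
  shows "(cmod (lin z p))\<^sup>2 \<ge> 3 / 4 * (real (height p))\<^sup>2"
proof -
  obtain c d where p: "p = (c, d)" by (cases p)
  define C D where "C = \<bar>real_of_int c\<bar>" and "D = \<bar>real_of_int d\<bar>"
  have "C\<^sup>2 * 1 \<le> C\<^sup>2 * (cmod z)\<^sup>2" using assms by (intro mult_left_mono) auto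
  moreover have "- (C * D) \<le> 2 * real_of_int c * real_of_int d * Re z"
  proof -
    have "\<bar>2 * real_of_int c * real_of_int d * Re z\<bar> = 2 * (C * D) * \<bar>Re z\<bar>"
      by (simp add: C_def D_def abs_mult)
    also have "\<dots> \<le> 2 * (C * D) * (1/2)" using assms by (intro mult_left_mono) (auto simp: C_def D_def)
    finally show ?thesis by simp
  qed
  ultimately have 1: "C\<^sup>2 - C * D + D\<^sup>2 \<le> (cmod (lin z p))\<^sup>2"
    unfolding p cmod_lin_power2 by (simp add: C_def D_def)
  have "C\<^sup>2 - C * D + D\<^sup>2 = 3 / 4 * C\<^sup>2 + (D - C / 2)\<^sup>2"
       "C\<^sup>2 - C * D + D\<^sup>2 = 3 / 4 * D\<^sup>2 + (C - D / 2)\<^sup>2"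
    by (simp_all add: power2_eq_square algebra_simps)
  then have "3 / 4 * C\<^sup>2 \<le> C\<^sup>2 - C * D + D\<^sup>2" "3 / 4 * D\<^sup>2 \<le> C\<^sup>2 - C * D + D\<^sup>2"
    using zero_le_power2[of "D - C / 2"] zero_le_power2[of "C - D / 2"] by linarith+
  moreover have "real (height p) = C \<or> real (height p) = D"
    unfolding p real_height C_def D_def by (auto simp: max_def)
  ultimately show ?thesis using 1 by auto
qed

text \<open>Bound for half the sum of \<open>\<bar>cz + d\<bar>^(-2h)\<close> over the coprime pairs of height at least 2: the
  first term accounts for the eight pairs of height 2, the second one for all larger heights.\<close>
definition lattice_error :: "nat \<Rightarrow> real" where
  "lattice_error h = 4 / 3 ^ h + 128 / 225 * (4 / 27) ^ (h - 2)"

lemma sum_outer_terms_le: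
  assumes "h \<ge> 2" "Im z > 0" "cmod z \<ge> 1" "\<bar>Re z\<bar> \<le> 1/2"
    and X: "finite X" "X \<subseteq> coprime_pairs - shell 1"
  shows "(\<Sum>p\<in>X. norm (1 / lin z p ^ (2 * h))) \<le> 2 * lattice_error h"
proof -
  define b where "b = (\<lambda>N. (4 / (3 * (real N)\<^sup>2)) ^ h)"
  have hge: "height p \<ge> 2" if "p \<in> X" for p
    using that X height_pos[of p] by (force simp: shell_def)
  have "\<exists>M. (\<Sum>p\<in>X. norm (1 / lin z p ^ (2 * h))) \<le> (\<Sum>N=2..M. real (card (shell N)) * b N)"
  proof (rule sum_le_shells)
    fix p assume p: "p \<in> X"
    have pos: "3 / 4 * (real (height p))\<^sup>2 > 0" using hge[OF p] by auto
    have "norm (1 / lin z p ^ (2 * h)) = (1 / (cmod (lin z p))\<^sup>2) ^ h"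
      by (simp add: norm_divide norm_power power_mult power_divide)
    also have "\<dots> \<le> (1 / (3 / 4 * (real (height p))\<^sup>2)) ^ h"
      using cmod_lin_power2_ge[OF assms(3,4), of p] pos
      by (intro power_mono divide_left_mono mult_pos_pos) auto
    also have "\<dots> = b (height p)" by (simp add: b_def)
    finally show "norm (1 / lin z p ^ (2 * h)) \<le> b (height p)" .
  qed (use X hge in \<open>auto simp: b_def\<close>)
  then obtain M where M: "(\<Sum>p\<in>X. norm (1 / lin z p ^ (2 * h))) \<le> (\<Sum>N=2..M. real (card (shell N)) * b N)"
    by blast
  have bnn: "b N \<ge> 0" for N by (simp add: b_def)
  have c: "real (card (shell N)) * b N \<le> 8 * (real N - 1) * b N" if "N \<ge> 2" for N
  proof (rule mult_right_mono[OF _ bnn])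
    have "real (card (shell N)) \<le> real (8 * (N - 1))"
      using finite_card_shell[OF that] by linarith
    then show "real (card (shell N)) \<le> 8 * (real N - 1)" using that by (simp add: of_nat_diff)
  qed
  \<comment> \<open>The exponent 2 is kept for the summation over \<open>N\<close>; the remaining \<open>h - 2\<close> factors are at most \<open>4/27\<close> each.\<close>
  have b3: "8 * (real N - 1) * b N \<le> 128 / 9 * (4 / 27) ^ (h - 2) * (1 / real N ^ 3)" if "N \<ge> 3" for N
  proof -
    define x where "x = real N"
    have x: "x \<ge> 3" using that by (simp add: x_def)
    have "x\<^sup>2 \<ge> 3\<^sup>2" using x by (intro power_mono) auto
    then have "4 / (3 * x\<^sup>2) \<le> 4 / 27" by (intro divide_left_mono) auto
    then have pw: "(4 / (3 * x\<^sup>2)) ^ (h - 2) \<le> (4 / 27) ^ (h - 2)" by (intro power_mono) auto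
    have "8 * (x - 1) * (4 / (3 * x\<^sup>2)) ^ h
        = (8 * (x - 1) * (4 / (3 * x\<^sup>2))\<^sup>2) * (4 / (3 * x\<^sup>2)) ^ (h - 2)"
    proof -
      have "(4 / (3 * x\<^sup>2)) ^ h = (4 / (3 * x\<^sup>2))\<^sup>2 * (4 / (3 * x\<^sup>2)) ^ (h - 2)"
        using power_add[of "4 / (3 * x\<^sup>2)" 2 "h - 2"] assms(1)
        by (simp only: le_add_diff_inverse)
      then show ?thesis by (simp only: mult.assoc)
    qed
    also have "\<dots> \<le> (8 * x * (4 / (3 * x\<^sup>2))\<^sup>2) * (4 / 27) ^ (h - 2)"
      using x pw by (intro mult_mono mult_right_mono) auto
    also have "8 * x * (4 / (3 * x\<^sup>2))\<^sup>2 = 128 / 9 * (1 / x ^ 3)"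
      using x by (simp add: power2_eq_square power3_eq_cube divide_simps)
    finally show ?thesis by (simp add: b_def x_def mult_ac)
  qed
  have "(\<Sum>N=2..M. real (card (shell N)) * b N) \<le> (\<Sum>N=2..M. 8 * (real N - 1) * b N)"
    by (rule sum_mono) (use c in auto)
  also have "\<dots> \<le> (\<Sum>N\<in>insert 2 {3..M}. 8 * (real N - 1) * b N)"
    by (rule sum_mono2) (use bnn in \<open>auto\<close>)
  also have "\<dots> = 8 * b 2 + (\<Sum>N=3..M. 8 * (real N - 1) * b N)" by simp
  also have "\<dots> \<le> 8 * b 2 + (\<Sum>N=3..M. 128 / 9 * (4 / 27) ^ (h - 2) * (1 / real N ^ 3))"
    by (intro add_left_mono sum_mono) (use b3 in auto)
  also have "\<dots> = 8 * b 2 + 128 / 9 * (4 / 27) ^ (h - 2) * (\<Sum>N=3..M. 1 / real N ^ 3)"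
    by (simp add: sum_distrib_left)
  also have "\<dots> \<le> 8 * b 2 + 128 / 9 * (4 / 27) ^ (h - 2) * (2 / 25)"
    by (intro add_left_mono mult_left_mono sum_inverse_cubes_from_3_le) auto
  also have "\<dots> = 2 * lattice_error h" by (simp add: b_def lattice_error_def power_divide)
  finally show ?thesis using M by simp
qed

text \<open>The four explicit terms are half the sum over the eight pairs of height 1.\<close>
lemma eisenstein_main_terms:
  assumes "h \<ge> 2" "Im z > 0" "cmod z \<ge> 1" "\<bar>Re z\<bar> \<le> 1/2"
  shows "cmod (eisenstein (2 * h) z
            - (1 + 1 / z ^ (2 * h) + 1 / (z + 1) ^ (2 * h) + 1 / (z - 1) ^ (2 * h)))
         \<le> lattice_error h"
proof -
  define g where "g = (\<lambda>p. 1 / lin z p ^ (2 * h))"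
  define R where "R = coprime_pairs - shell 1"
  have RU: "coprime_pairs = shell 1 \<union> R" "shell 1 \<inter> R = {}" "R \<subseteq> coprime_pairs"
    by (auto simp: R_def shell_def)
  have fin: "finite (shell 1)" using finite_card_shell'[of 1] by simp
  have sR: "g summable_on R" unfolding g_def
    by (rule summable_lin) (use assms RU in auto)
  have aR: "(\<lambda>p. norm (g p)) summable_on R" unfolding g_def
    by (rule summable_on_subset_banach[OF abs_summable_lin]) (use assms RU in auto)
  have "infsum g coprime_pairs = infsum g (shell 1) + infsum g R"
    unfolding RU(1) by (rule infsum_Un_disjoint) (use sR fin RU in auto)
  also have "infsum g (shell 1) = sum g (shell 1)" using fin by simp
  also have "sum g (shell 1)
     = 2 * (1 + 1 / z ^ (2 * h) + 1 / (z + 1) ^ (2 * h) + 1 / (z - 1) ^ (2 * h))"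
  proof -
    have ev: "(- w) ^ (2 * h) = w ^ (2 * h)" for w :: complex by simp
    have e: "(- z - 1) ^ (2 * h) = (z + 1) ^ (2 * h)" "(1 - z) ^ (2 * h) = (z - 1) ^ (2 * h)"
      using ev[of "z + 1"] ev[of "z - 1"] by simp_all
    show ?thesis unfolding shell_1_eq g_def lin_def by (simp add: e)
  qed
  finally have s: "infsum g coprime_pairs
     = 2 * (1 + 1 / z ^ (2 * h) + 1 / (z + 1) ^ (2 * h) + 1 / (z - 1) ^ (2 * h)) + infsum g R" .
  have "2 * h > 0" using assms by simp
  then have "eisenstein (2 * h) z = 1 / 2 * infsum g coprime_pairs"
    unfolding g_def by (rule eisenstein_eq)
  then have "eisenstein (2 * h) z
     - (1 + 1 / z ^ (2 * h) + 1 / (z + 1) ^ (2 * h) + 1 / (z - 1) ^ (2 * h)) = infsum g R / 2"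
    unfolding s by (simp only: distrib_left) simp
  moreover have "norm (infsum g R) \<le> 2 * lattice_error h"
  proof -
    have "norm (infsum g R) \<le> (\<Sum>\<^sub>\<infinity>p\<in>R. norm (g p))"
      by (rule norm_infsum_bound) (rule aR)
    also have "\<dots> \<le> 2 * lattice_error h"
      by (rule infsum_le_finite_sums[OF aR])
         (use sum_outer_terms_le[OF assms] in \<open>auto simp: g_def R_def\<close>)
    finally show ?thesis .
  qed
  ultimately show ?thesis by (simp only: norm_divide) simp
qed

section \<open>Behaviour at the cusp\<close>

text \<open>The filter of \<open>Im z \<rightarrow> \<infinity>\<close> inside the strip \<open>\<bar>Re z\<bar> \<le> 1/2\<close>. Periodicity makes the restriction to
  the strip harmless, and in the strip the lower bounds for \<open>\<bar>cz + d\<bar>\<close> apply.\<close>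
definition at_cusp :: "complex filter" where
  "at_cusp = inf (filtercomap Im at_top) (principal {z. \<bar>Re z\<bar> \<le> 1/2})"

lemma eventually_at_cusp:
  "eventually P at_cusp \<longleftrightarrow> (\<exists>T. \<forall>z. Im z \<ge> T \<longrightarrow> \<bar>Re z\<bar> \<le> 1/2 \<longrightarrow> P z)"
  unfolding at_cusp_def eventually_inf_principal eventually_filtercomap eventually_at_top_linorder
  by (auto; metis)

text \<open>For \<open>c \<noteq> 0\<close> one factor \<open>\<bar>cz + d\<bar> \<ge> Im z\<close> of the denominator gives decay, while three
  of the others suffice for convergence; the pairs \<open>(0,\<plusminus>1)\<close> contribute the limit 1.\<close>
lemma eisenstein_tendsto_cusp:
  assumes "k \<ge> 4" "even k"
  shows "(eisenstein k \<longlongrightarrow> 1) at_cusp"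
proof -
  define B where "B = (\<Sum>\<^sub>\<infinity>p\<in>coprime_pairs. 1 / real (height p) ^ 3)"
  have main: "cmod (eisenstein k z - 1) \<le> 4 * B * (1 / Im z)" if z: "Im z \<ge> 1" "\<bar>Re z\<bar> \<le> 1/2" for z
  proof -
    define g where "g = (\<lambda>p. 1 / lin z p ^ k)"
    define P :: "(int \<times> int) set" where "P = {(0, 1), (0, - 1)}"
    define R where "R = coprime_pairs - P"
    have RU: "coprime_pairs = P \<union> R" "P \<inter> R = {}" "R \<subseteq> coprime_pairs"
      by (auto simp: R_def P_def coprime_pairs_def)
    have cz: "cmod z \<ge> 1" using abs_Im_le_cmod[of z] z by simp
    have sR: "g summable_on R" unfolding g_def
      by (rule summable_lin) (use assms RU z in auto)
    have aR: "(\<lambda>p. norm (g p)) summable_on R" unfolding g_def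
      by (rule summable_on_subset_banach[OF abs_summable_lin]) (use assms RU z in auto)
    have "infsum g coprime_pairs = infsum g P + infsum g R"
      unfolding RU(1) by (rule infsum_Un_disjoint) (use sR RU in \<open>auto simp: P_def\<close>)
    also have "infsum g P = 2" using assms by (simp add: P_def g_def lin_def)
    finally have s: "infsum g coprime_pairs = 2 + infsum g R" .
    have "eisenstein k z = 1 / 2 * infsum g coprime_pairs"
      unfolding g_def by (rule eisenstein_eq) (use assms in auto)
    then have e: "eisenstein k z - 1 = infsum g R / 2" unfolding s by simp
    have b: "norm (g p) \<le> 8 * (1 / Im z) * (1 / real (height p) ^ 3)" if p: "p \<in> R" for p
    proof -
      define L where "L = cmod (lin z p)"
      have "fst p \<noteq> 0" using p by (auto simp: R_def P_def coprime_pairs_def)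
      then have "1 * Im z \<le> \<bar>real_of_int (fst p)\<bar> * \<bar>Im z\<bar>"
        using z by (intro mult_mono) auto
      then have L: "L \<ge> Im z" using cmod_lin_ge_Im[of p z] by (simp add: L_def)
      have "p \<in> coprime_pairs" using p RU(3) by blast
      then have h: "real (height p) \<ge> 1" using height_pos[of p] by simp
      have "(real (height p) / 2)\<^sup>2 \<le> L\<^sup>2"
      proof -
        have "0 \<le> (real (height p))\<^sup>2" by simp
        moreover have "3 / 4 * (real (height p))\<^sup>2 \<le> L\<^sup>2"
          unfolding L_def by (rule cmod_lin_power2_ge[OF cz z(2)])
        ultimately show ?thesis unfolding power_divide power2_eq_square[of 2] by linarith
      qed
      then have hL: "real (height p) / 2 \<le> L"
        by (rule power2_le_imp_le) (simp add: L_def)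
      have "Im z * (real (height p) / 2) ^ 3 \<le> L ^ (k - 3) * L ^ 3"
      proof (rule mult_mono)
        have "L ^ 1 \<le> L ^ (k - 3)" using L z assms by (intro power_increasing) auto
        then show "Im z \<le> L ^ (k - 3)" using L by simp
        show "(real (height p) / 2) ^ 3 \<le> L ^ 3" using hL by (intro power_mono) auto
      qed (use L z in auto)
      also have "\<dots> = L ^ k" using assms by (simp flip: power_add)
      finally have "1 / L ^ k \<le> 1 / (Im z * (real (height p) / 2) ^ 3)"
        using L z h by (intro divide_left_mono mult_pos_pos) auto
      also have "\<dots> = 8 * (1 / Im z) * (1 / real (height p) ^ 3)"
        by (simp add: power_divide)
      finally show ?thesis by (simp add: g_def L_def norm_divide norm_power)
    qed
    have sB: "(\<lambda>p. 8 * (1 / Im z) * (1 / real (height p) ^ 3)) summable_on coprime_pairs"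
      by (rule summable_on_cmult_right[OF summable_inverse_height_cube])
    have "norm (infsum g R) \<le> (\<Sum>\<^sub>\<infinity>p\<in>R. norm (g p))"
      by (rule norm_infsum_bound) (rule aR)
    also have "\<dots> \<le> (\<Sum>\<^sub>\<infinity>p\<in>coprime_pairs. 8 * (1 / Im z) * (1 / real (height p) ^ 3))"
      by (rule infsum_mono_neutral[OF aR sB]) (use b RU(3) z in auto)
    also have "\<dots> = 8 * (1 / Im z) * B" unfolding B_def by (rule infsum_cmult_right')
    finally show ?thesis unfolding e by (simp add: norm_divide)
  qed
  have "((\<lambda>z. 4 * B * (1 / Im z)) \<longlongrightarrow> 0) at_cusp"
  proof -
    have "filterlim Im at_top at_cusp"
      unfolding filterlim_iff_le_filtercomap at_cusp_def by (rule inf_le1)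
    then have "((\<lambda>z. inverse (Im z)) \<longlongrightarrow> 0) at_cusp"
      by (rule tendsto_inverse_0_at_top)
    from tendsto_mult_left[OF this, of "4 * B"] show ?thesis by (simp add: divide_inverse)
  qed
  moreover have "\<forall>\<^sub>F z in at_cusp. norm (eisenstein k z - 1) \<le> 4 * B * (1 / Im z)"
    unfolding eventually_at_cusp using main by (intro exI[of _ 1]) simp
  ultimately have "((\<lambda>z. eisenstein k z - 1) \<longlongrightarrow> 0) at_cusp"
    by (rule Lim_null_comparison [rotated])
  then show ?thesis by (rule LIM_zero_cancel)
qed

section \<open>Modular forms with real coefficients\<close>

lemma Im_neg_inverse_pos: "z \<in> upper_half_plane \<Longrightarrow> - 1 / z \<in> upper_half_plane"
  by (auto simp: upper_half_plane_def Im_divide intro!: divide_pos_pos add_nonneg_pos)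

text \<open>The reflection law \<open>cnj (f z) = f (- cnj z)\<close> expresses that the Fourier coefficients are real.
  The behaviour at the cusp is stated separately, as a limit along \<open>at_cusp\<close>.\<close>
definition real_form :: "nat \<Rightarrow> (complex \<Rightarrow> complex) \<Rightarrow> bool" where
  "real_form k f \<longleftrightarrow> f holomorphic_on upper_half_plane \<and>
     (\<forall>z\<in>upper_half_plane. f (z + 1) = f z \<and> f (- 1 / z) = z ^ k * f z \<and> cnj (f z) = f (- cnj z))"

lemma real_formD:
  assumes "real_form k f"
  shows "f holomorphic_on upper_half_plane"
    and "z \<in> upper_half_plane \<Longrightarrow> f (z + 1) = f z"
    and "z \<in> upper_half_plane \<Longrightarrow> f (- 1 / z) = z ^ k * f z"
    and "z \<in> upper_half_plane \<Longrightarrow> f (- cnj z) = cnj (f z)"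
  using assms by (auto simp: real_form_def)

lemma real_form_const: "real_form 0 (\<lambda>z. of_real c)"
  by (auto simp: real_form_def)

lemma real_form_add: "real_form k f \<Longrightarrow> real_form k g \<Longrightarrow> real_form k (\<lambda>z. f z + g z)"
  by (auto simp: real_form_def ring_distribs intro!: holomorphic_intros)

lemma real_form_mult: "real_form k f \<Longrightarrow> real_form l g \<Longrightarrow> real_form (k + l) (\<lambda>z. f z * g z)"
  by (auto simp: real_form_def power_add intro!: holomorphic_intros)

lemma real_form_scale: "real_form k f \<Longrightarrow> real_form k (\<lambda>z. of_real c * f z)"
  using real_form_mult[OF real_form_const] by fastforce

lemma real_form_power: "real_form k f \<Longrightarrow> real_form (k * n) (\<lambda>z. f z ^ n)"
  by (auto simp: real_form_def power_mult_distrib power_mult complex_cnj_power intro!: holomorphic_intros)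

lemma real_form_sum:
  assumes "\<And>j. j \<in> A \<Longrightarrow> real_form k (f j)"
  shows "real_form k (\<lambda>z. \<Sum>j\<in>A. f j z)"
  using assms
proof (induction A rule: infinite_finite_induct)
  case (insert j A)
  then show ?case by (simp add: real_form_add)
qed (simp_all add: real_form_def)

lemma real_form_eisenstein:
  assumes "even k" "k = 0 \<or> k \<ge> 4"
  shows "real_form k (eisenstein k)"
proof (cases "k = 0")
  case True
  then have "eisenstein k = (\<lambda>z. of_real 1)" by (auto simp: eisenstein_def)
  then show ?thesis using real_form_const[of 1] True by simp
next
  case False
  with assms have k: "k \<ge> 4" by auto
  show ?thesis unfolding real_form_def
  proof (intro conjI ballI)
    fix z assume z: "z \<in> upper_half_plane"
    show "eisenstein k (- 1 / z) = z ^ k * eisenstein k z"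
      by (rule eisenstein_inversion) (use k z in \<open>auto simp: upper_half_plane_def\<close>)
  qed (use k eisenstein_holomorphic eisenstein_periodic eisenstein_cnj in auto)
qed

lemma real_form_Delta: "real_form 12 cusp_Delta"
proof -
  have 1: "real_form 12 (\<lambda>z. eisenstein 4 z ^ 3)" "real_form 12 (\<lambda>z. eisenstein 6 z ^ 2)"
    using real_form_power[OF real_form_eisenstein[of 4], of 3]
      real_form_power[OF real_form_eisenstein[of 6], of 2] by simp_all
  have "real_form 12 (\<lambda>z. of_real (1 / 1728) * (eisenstein 4 z ^ 3 + of_real (- 1) * eisenstein 6 z ^ 2))"
    by (intro real_form_scale real_form_add 1)
  also have "(\<lambda>z. of_real (1 / 1728) * (eisenstein 4 z ^ 3 + of_real (- 1) * eisenstein 6 z ^ 2)) = cusp_Delta"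
    by (auto simp: cusp_Delta_def fun_eq_iff)
  finally show ?thesis .
qed

lemma cusp_Delta_tendsto: "(cusp_Delta \<longlongrightarrow> 0) at_cusp"
proof -
  have "((\<lambda>z. (eisenstein 4 z ^ 3 - eisenstein 6 z ^ 2) / 1728) \<longlongrightarrow> (1 ^ 3 - 1 ^ 2) / 1728) at_cusp"
    by (intro tendsto_intros eisenstein_tendsto_cusp) auto
  then show ?thesis by (simp add: cusp_Delta_def [abs_def])
qed

lemma cnj_unit: "cmod z = 1 \<Longrightarrow> cnj z = 1 / z"
  using complex_mult_cnj[of z] by (cases "z = 0") (auto simp: field_simps cmod_def simp flip: of_real_add)

text \<open>On the unit circle the reflection \<open>z \<mapsto> - cnj z\<close> agrees with \<open>z \<mapsto> - 1 / z\<close>.\<close>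
lemma real_form_circle:
  assumes "real_form (2 * h) f" "z \<in> upper_half_plane" "cmod z = 1"
  shows "z ^ h * f z \<in> \<real>"
proof -
  have z0: "z \<noteq> 0" using assms by auto
  have "cnj (z ^ h * f z) = (1 / z) ^ h * f (- 1 / z)"
    using cnj_unit[OF assms(3)] real_formD(4)[OF assms(1,2)] by simp
  also have "\<dots> = (1 / z) ^ h * (z ^ h * z ^ h * f z)"
    using real_formD(3)[OF assms(1,2)] by (simp add: mult_2 power_add)
  also have "\<dots> = z ^ h * f z" using z0 by (simp add: power_divide)
  finally show ?thesis by (simp add: Reals_cnj_iff)
qed

text \<open>On the lines \<open>Re z = \<plusminus>1/2\<close> the reflection \<open>z \<mapsto> - cnj z\<close> agrees with \<open>z \<mapsto> z \<mp> 1\<close>.\<close>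
lemma real_form_line:
  assumes "real_form k f" "z \<in> upper_half_plane" "\<bar>Re z\<bar> = 1/2"
  shows "f z \<in> \<real>"
proof -
  have "f (- cnj z) = f z"
  proof (cases "Re z = 1/2")
    case True
    then have "- cnj z + 1 = z" by (simp add: complex_eq_iff)
    moreover have "- cnj z \<in> upper_half_plane" using assms by (simp add: upper_half_plane_def)
    ultimately show ?thesis using real_formD(2)[OF assms(1), of "- cnj z"] by metis
  next
    case False
    then have "- cnj z = z + 1" using assms by (simp add: complex_eq_iff abs_if split: if_splits)
    then show ?thesis using real_formD(2)[OF assms(1,2)] by metis
  qed
  then show ?thesis using real_formD(4)[OF assms(1,2)] by (simp add: Reals_cnj_iff)
qed

section \<open>Size of Eisenstein series on the arc\<close>

text \<open>The contribution of the pairs \<open>\<plusminus>(1,1)\<close> and \<open>\<plusminus>(1,-1)\<close> to \<open>z^h E_(2h)(z)\<close> on the unit circle, as a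
  function of \<open>x = Re z\<close>. It is real because \<open>(z \<plusminus> 1)^2 = z (2x \<plusminus> 2)\<close> for \<open>\<bar>z\<bar> = 1\<close>.\<close>
definition nearest_terms :: "nat \<Rightarrow> real \<Rightarrow> real" where
  "nearest_terms h x = (1 / (2 + 2 * x)) ^ h + (1 / (2 * x - 2)) ^ h"

lemma eisenstein_on_circle:
  assumes h: "h \<ge> 2" and z: "Im z > 0" "cmod z = 1" "\<bar>Re z\<bar> \<le> 1/2"
  shows "cmod (z ^ h * eisenstein (2 * h) z - of_real (2 * Re (z ^ h) + nearest_terms h (Re z)))
           \<le> lattice_error h"
proof -
  define x where "x = Re z"
  have z0: "z \<noteq> 0" using z by auto
  have inv: "1 / z = cnj z" using cnj_unit[OF z(2)] by simp
  have sum: "z + 1 / z = of_real (2 * x)" unfolding inv by (simp add: complex_add_cnj x_def)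
  have p: "(z + 1)\<^sup>2 = z * of_real (2 + 2 * x)" 
  proof -
    have "(z + 1)\<^sup>2 = z * (2 + (z + 1 / z))" using z0 by (simp add: power2_eq_square field_simps)
    then show ?thesis by (simp add: sum)
  qed
  have m: "(z - 1)\<^sup>2 = z * of_real (2 * x - 2)" 
  proof -
    have "(z - 1)\<^sup>2 = z * ((z + 1 / z) - 2)" using z0 by (simp add: power2_eq_square field_simps)
    then show ?thesis by (simp add: sum)
  qed
  have 1: "z ^ h * (1 / z ^ (2 * h)) = cnj (z ^ h)"
    unfolding complex_cnj_power inv [symmetric] using z0
    by (simp add: mult_2 power_add power_divide)
  have 2: "z ^ h * (1 / (z + 1) ^ (2 * h)) = of_real ((1 / (2 + 2 * x)) ^ h)"
    using z0 by (simp add: power_mult p power_mult_distrib power_divide)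
  have 3: "z ^ h * (1 / (z - 1) ^ (2 * h)) = of_real ((1 / (2 * x - 2)) ^ h)"
    using z0 by (simp add: power_mult m power_mult_distrib power_divide)
  have "z ^ h * (1 + 1 / z ^ (2 * h) + 1 / (z + 1) ^ (2 * h) + 1 / (z - 1) ^ (2 * h))
      = (z ^ h + cnj (z ^ h)) + of_real ((1 / (2 + 2 * x)) ^ h) + of_real ((1 / (2 * x - 2)) ^ h)"
    unfolding 1[symmetric] 2[symmetric] 3[symmetric] by (simp only: distrib_left mult_1_right)
  also have "\<dots> = of_real (2 * Re (z ^ h) + nearest_terms h (Re z))"
    unfolding complex_add_cnj nearest_terms_def x_def by (simp only: of_real_add add.assoc)
  finally have "z ^ h * eisenstein (2 * h) z - of_real (2 * Re (z ^ h) + nearest_terms h (Re z))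
      = z ^ h * (eisenstein (2 * h) z
            - (1 + 1 / z ^ (2 * h) + 1 / (z + 1) ^ (2 * h) + 1 / (z - 1) ^ (2 * h)))"
    by (simp only: right_diff_distrib)
  then show ?thesis
    using eisenstein_main_terms[of h z] h z by (simp only: norm_mult norm_power power_one mult_1)
qed

text \<open>The two bases cannot be large at the same time: near \<open>x = 0\<close> both are close to \<open>1/2\<close>, and for
  \<open>x \<le> - 1/10\<close> the smaller one is at most \<open>5/11\<close>.\<close>
lemma nearest_terms_bounds:
  assumes h: "h \<ge> 2" and x: "- 1/2 \<le> x" "x \<le> 0"
  shows "\<bar>nearest_terms h x\<bar> \<le> 1 + (5/11) ^ h" "nearest_terms h x \<ge> 0"
    "odd h \<Longrightarrow> nearest_terms h x \<le> 1"
proof -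
  define p q where "p = 1 / (2 + 2 * x)" and "q = 1 / (2 - 2 * x)"
  have pq: "0 \<le> p" "p \<le> 1" "0 \<le> q" "q \<le> p" using x by (auto simp: p_def q_def divide_simps)
  have q': "1 / (2 * x - 2) = - q"
    unfolding q_def using x by (simp add: divide_simps)
  have nt: "nearest_terms h x = p ^ h + (- q) ^ h"
    unfolding nearest_terms_def p_def[symmetric] q' ..
  have le: "0 \<le> q ^ h" "q ^ h \<le> p ^ h" "p ^ h \<le> 1"
    using pq by (auto intro: power_mono power_le_one)
  have "\<bar>(- q) ^ h\<bar> = q ^ h" using pq by (simp add: power_abs)
  then have a: "\<bar>nearest_terms h x\<bar> \<le> p ^ h + q ^ h" and "nearest_terms h x \<ge> 0"
    using le unfolding nt by linarith+
  then show "nearest_terms h x \<ge> 0" by simp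
  show "odd h \<Longrightarrow> nearest_terms h x \<le> 1" using le unfolding nt by simp
  have "p ^ h + q ^ h \<le> 1 + (5/11) ^ h"
  proof (cases "x \<le> - 1/10")
    case True
    then have "q \<le> 5 / 11" unfolding q_def by (simp add: divide_simps)
    then have "q ^ h \<le> (5/11) ^ h" using pq by (intro power_mono) auto
    then show ?thesis using le by simp
  next
    case False
    then have "p \<le> 5 / 9" "q \<le> 1 / 2" using x unfolding p_def q_def by (auto simp: divide_simps)
    then have "p ^ h \<le> (5/9) ^ h" "q ^ h \<le> (1/2) ^ h" using pq by (auto intro!: power_mono)
    moreover have "(5/9 :: real) ^ h \<le> (5/9) ^ 2" "(1/2 :: real) ^ h \<le> (1/2) ^ 2"
      using h by (intro power_decreasing; simp)+
    ultimately have "p ^ h + q ^ h \<le> (5/9)\<^sup>2 + (1/2)\<^sup>2" by linarith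
    also have "\<dots> \<le> 1" by (simp add: power2_eq_square)
    finally show ?thesis by (smt (verit) zero_le_power zero_le_divide_iff)
  qed
  then show "\<bar>nearest_terms h x\<bar> \<le> 1 + (5/11) ^ h" using a by simp
qed

lemma lattice_error_bounds:
  "lattice_error 2 \<le> 51 / 50" "lattice_error 3 \<le> 93 / 400"
  "lattice_error 4 \<le> 31 / 500" "lattice_error 5 \<le> 23 / 1250"
  "h \<ge> 6 \<Longrightarrow> lattice_error h \<le> 29 / 5000"
proof -
  assume h: "h \<ge> 6"
  have "(3::real) ^ 6 \<le> 3 ^ h" using h by (intro power_increasing) auto
  then have "4 / (3::real) ^ h \<le> 4 / 3 ^ 6" by (intro divide_left_mono) auto
  moreover have "(4 / 27 :: real) ^ (h - 2) \<le> (4 / 27) ^ 4" using h by (intro power_decreasing) auto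
  ultimately have "lattice_error h \<le> 4 / 3 ^ 6 + 128 / 225 * (4 / 27) ^ 4"
    unfolding lattice_error_def by (intro add_mono mult_left_mono) auto
  also have "\<dots> \<le> 29 / 5000" by (simp add: power_divide)
  finally show "lattice_error h \<le> 29 / 5000" .
qed (simp_all add: lattice_error_def power_divide)

lemma eisenstein_on_arc_large_weight:
  assumes h: "h \<ge> 6" and z: "Im z > 0" "cmod z = 1" "- 1/2 \<le> Re z" "Re z \<le> 0"
  shows "cmod (z ^ h * eisenstein (2 * h) z - of_real (2 * Re (z ^ h))) < 511 / 500"
proof -
  have 1: "cmod (z ^ h * eisenstein (2 * h) z - of_real (2 * Re (z ^ h) + nearest_terms h (Re z)))
           \<le> lattice_error h"
    by (rule eisenstein_on_circle) (use h z in auto)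
  have 2: "\<bar>nearest_terms h (Re z)\<bar> \<le> 1 + (5/11) ^ h"
    by (rule nearest_terms_bounds(1)) (use h z in auto)
  have "(5 / 11 :: real) ^ h \<le> (5/11) ^ 6" using h by (intro power_decreasing) auto
  also have "(5 / 11 :: real) ^ 6 \<le> 0.009" by (simp add: power_divide)
  finally have "\<bar>nearest_terms h (Re z)\<bar> \<le> 1.009" using 2 by simp
  then have 3: "cmod (of_real (nearest_terms h (Re z))) \<le> 1.009" by simp
  have "z ^ h * eisenstein (2 * h) z - of_real (2 * Re (z ^ h))
     = (z ^ h * eisenstein (2 * h) z - of_real (2 * Re (z ^ h) + nearest_terms h (Re z)))
        + of_real (nearest_terms h (Re z))" by simp
  then have "cmod (z ^ h * eisenstein (2 * h) z - of_real (2 * Re (z ^ h)))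
     \<le> lattice_error h + 1.009"
    using 1 3 norm_triangle_ineq by (smt (verit, best))
  then show ?thesis using lattice_error_bounds(5)[OF h] by simp
qed

lemma Re_power2_circle: "cmod z = 1 \<Longrightarrow> Re (z\<^sup>2) = 2 * (Re z)\<^sup>2 - 1"
  using cmod_power2[of z] by (simp add: power2_eq_square)

lemma Re_power3_circle: "cmod z = 1 \<Longrightarrow> Re (z ^ 3) = 4 * (Re z) ^ 3 - 3 * Re z"
proof -
  assume "cmod z = 1"
  then have "(Im z)\<^sup>2 = 1 - (Re z)\<^sup>2" using cmod_power2[of z] by simp
  moreover have "Re (z ^ 3) = (Re z) ^ 3 - 3 * Re z * (Im z)\<^sup>2"
    by (simp add: power3_eq_cube power2_eq_square algebra_simps)
  ultimately have "Re (z ^ 3) = (Re z) ^ 3 - 3 * Re z * (1 - (Re z)\<^sup>2)" by (simp only:)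
  then show ?thesis by (simp add: power3_eq_cube power2_eq_square algebra_simps)
qed

text \<open>For \<open>l \<ge> 8\<close> the triangle inequality suffices. For \<open>l = 4\<close> and \<open>l = 6\<close> the remainder is too large for that and signs are used: for \<open>l = 4\<close> the main
  term \<open>2 cos 2\<theta>\<close> lies in \<open>[-2,-1]\<close> while the nearest terms are positive, and for \<open>l = 6\<close> the two
  nearest terms have opposite signs.\<close>
lemma cmod_eisenstein_on_arc_le:
  assumes k: "even k" "k = 0 \<or> k \<ge> 4" and z: "Im z > 0" "cmod z = 1" "- 1/2 \<le> Re z" "Re z \<le> 0"
  shows "cmod (eisenstein k z) \<le> 3 + delta_const k"
proof (cases "k = 0")
  case True
  then show ?thesis by (simp add: eisenstein_def delta_const_def)
next
  case False
  define h where "h = k div 2"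
  have kh: "k = 2 * h" "h \<ge> 2" using k False by (auto simp: h_def)
  define N where "N = nearest_terms h (Re z)"
  define W where "W = z ^ h * eisenstein k z"
  have cW: "cmod (eisenstein k z) = cmod W" using z by (simp add: W_def norm_mult norm_power)
  have main: "cmod (W - of_real (2 * Re (z ^ h) + N)) \<le> lattice_error h"
    unfolding W_def N_def kh(1) by (rule eisenstein_on_circle) (use kh z in auto)
  have W_le: "cmod W \<le> \<bar>2 * Re (z ^ h) + N\<bar> + lattice_error h"
    using main norm_triangle_ineq2[of W "of_real (2 * Re (z ^ h) + N)"]
    by (simp only: norm_of_real)
  have N: "\<bar>N\<bar> \<le> 1 + (5/11) ^ h" "N \<ge> 0" "odd h \<Longrightarrow> N \<le> 1"
    unfolding N_def using nearest_terms_bounds[OF kh(2) z(3,4)] by auto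
  have R: "\<bar>Re (z ^ h)\<bar> \<le> 1" using abs_Re_le_cmod[of "z ^ h"] z by (simp add: norm_power)
  have gen: "cmod W \<le> 3 + (5/11) ^ h + lattice_error h" using W_le N(1) R by linarith
  consider "h = 2" | "h = 3" | "h = 4" | "h = 5" | "h \<ge> 6" using kh by linarith
  then show ?thesis
  proof cases
    case 1
    have "(Re z)\<^sup>2 \<le> (1/2)\<^sup>2" using z by (intro power2_le_iff_abs_le[THEN iffD2]) auto
    then have "Re (z ^ h) \<le> - 1/2" unfolding 1 using Re_power2_circle[OF z(2)] by (simp add: power2_eq_square)
    then have "\<bar>2 * Re (z ^ h) + N\<bar> \<le> 2" using R N(1,2) unfolding 1 by (simp add: power2_eq_square)
    then show ?thesis using W_le lattice_error_bounds(1) unfolding cW unfolding kh(1) 1 by (simp add: delta_const_def)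
  next
    case 2
    have "\<bar>2 * Re (z ^ h) + N\<bar> \<le> 3" using N 2 R by simp
    then show ?thesis using W_le lattice_error_bounds(2) unfolding cW unfolding kh(1) 2 by (simp add: delta_const_def)
  next
    case 3
    then show ?thesis using gen lattice_error_bounds(3) unfolding cW unfolding kh(1) 3 by (simp add: delta_const_def power_divide)
  next
    case 4
    then show ?thesis using gen lattice_error_bounds(4) unfolding cW unfolding kh(1) 4 by (simp add: delta_const_def power_divide)
  next
    case 5
    have "cmod (W - of_real (2 * Re (z ^ h))) < 511 / 500"
      unfolding W_def kh(1) by (rule eisenstein_on_arc_large_weight) (use 5 z in auto)
    then have "cmod W \<le> \<bar>2 * Re (z ^ h)\<bar> + 511 / 500"
      using norm_triangle_ineq2[of W "of_real (2 * Re (z ^ h))"] by (simp only: norm_of_real) 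
    then have "cmod W \<le> 1511 / 500" using R by simp
    then show ?thesis unfolding cW unfolding kh(1) using 5 by (simp add: delta_const_def)
  qed
qed

section \<open>A form that is positive on the boundary\<close>

text \<open>On the circular side \<open>z^2 E_4(z)\<close> is negative wherever \<open>z^3 E_6(z)\<close> is close to zero, and on the
  vertical sides \<open>E_6 \<ge> 1/2\<close>; so a large multiple of \<open>E_6^2\<close> beats \<open>E_4^3\<close>. The factor 10000 allows
  very crude estimates of \<open>E_4\<close>.\<close>
definition boundary_form :: "complex \<Rightarrow> complex" where
  "boundary_form z = 10000 * eisenstein 6 z ^ 2 - eisenstein 4 z ^ 3"

lemma real_form_boundary_form: "real_form 12 boundary_form"
proof -
  have 1: "real_form 12 (\<lambda>z. eisenstein 4 z ^ 3)" "real_form 12 (\<lambda>z. eisenstein 6 z ^ 2)"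
    using real_form_power[OF real_form_eisenstein[of 4], of 3]
      real_form_power[OF real_form_eisenstein[of 6], of 2] by simp_all
  have "real_form 12 (\<lambda>z. of_real 10000 * eisenstein 6 z ^ 2 + of_real (- 1) * eisenstein 4 z ^ 3)"
    by (intro real_form_scale real_form_add 1)
  also have "(\<lambda>z. of_real 10000 * eisenstein 6 z ^ 2 + of_real (- 1) * eisenstein 4 z ^ 3) = boundary_form"
    by (auto simp: boundary_form_def fun_eq_iff)
  finally show ?thesis .
qed

lemma boundary_form_tendsto: "(boundary_form \<longlongrightarrow> 9999) at_cusp"
proof -
  have "((\<lambda>z. 10000 * eisenstein 6 z ^ 2 - eisenstein 4 z ^ 3) \<longlongrightarrow> 10000 * 1 ^ 2 - 1 ^ 3) at_cusp"
    by (intro tendsto_intros eisenstein_tendsto_cusp) auto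
  then show ?thesis by (simp add: boundary_form_def [abs_def])
qed

lemma cmod_add_sub_one_ge:
  assumes "cmod z \<ge> 1" "\<bar>Re z\<bar> \<le> 1/2"
  shows "cmod (z + 1) \<ge> 1" "cmod (z - 1) \<ge> 1"
proof -
  have "(cmod z)\<^sup>2 \<ge> 1\<^sup>2" using assms by (intro power_mono) auto
  then have s: "(Re z)\<^sup>2 + (Im z)\<^sup>2 \<ge> 1" by (simp add: cmod_power2)
  have "(Re z + 1)\<^sup>2 = (Re z)\<^sup>2 + 2 * Re z + 1" "(Re z - 1)\<^sup>2 = (Re z)\<^sup>2 - 2 * Re z + 1"
    by (simp_all add: power2_eq_square algebra_simps)
  then have "1\<^sup>2 \<le> (cmod (z + 1))\<^sup>2" "1\<^sup>2 \<le> (cmod (z - 1))\<^sup>2"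
    using s assms(2) by (auto simp: cmod_power2)
  then show "cmod (z + 1) \<ge> 1" "cmod (z - 1) \<ge> 1"
    by (auto intro: power2_le_imp_le)
qed

lemma cmod_eisenstein_4_le:
  assumes "Im z > 0" "cmod z \<ge> 1" "\<bar>Re z\<bar> \<le> 1/2"
  shows "cmod (eisenstein 4 z) \<le> 6"
proof -
  have t: "cmod (1 / w ^ 4) \<le> 1" if "cmod w \<ge> 1" for w :: complex
    using one_le_power[OF that, of 4] by (simp add: norm_divide norm_power divide_simps)
  define M where "M = 1 + 1 / z ^ 4 + 1 / (z + 1) ^ 4 + 1 / (z - 1) ^ 4"
  have "cmod M \<le> cmod (1::complex) + cmod (1 / z ^ 4) + cmod (1 / (z + 1) ^ 4) + cmod (1 / (z - 1) ^ 4)"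
    unfolding M_def by (intro order_trans[OF norm_triangle_ineq] add_mono order.refl)
  then have "cmod M \<le> 4"
    using t[OF assms(2)] t[OF cmod_add_sub_one_ge(1)[OF assms(2,3)]]
      t[OF cmod_add_sub_one_ge(2)[OF assms(2,3)]] by simp
  moreover have "cmod (eisenstein 4 z - M) \<le> lattice_error 2"
    using eisenstein_main_terms[of 2 z] assms by (simp add: M_def)
  ultimately show ?thesis
    using norm_triangle_ineq2[of "eisenstein 4 z" M] lattice_error_bounds(1) by linarith
qed

text \<open>With \<open>s = \<bar>z\<bar>^2 = \<bar>z + 1\<bar>^2\<close> the terms of \<open>z\<close> and \<open>z + 1\<close> are complex conjugates and add up to
  \<open>(1 - 2s)(s^2 - 4s + 1)/s^6\<close>, which is negative only for \<open>s\<close> above \<open>2 + sqrt 3\<close> and is tiny there.\<close>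
lemma Re_eisenstein_6_line:
  assumes z: "Im z > 0" "cmod z \<ge> 1" "Re z = - 1/2"
  shows "Re (eisenstein 6 z) \<ge> 1/2"
proof -
  define s where "s = (cmod z)\<^sup>2"
  have s: "s \<ge> 1" unfolding s_def using one_le_power[OF z(2), of 2] by simp
  have y2: "(Im z)\<^sup>2 = s - 1/4" unfolding s_def cmod_power2 z(3) by (simp add: power2_eq_square)
  define M where "M = 1 + 1 / z ^ 6 + 1 / (z + 1) ^ 6 + 1 / (z - 1) ^ 6"
  have E: "cmod (eisenstein 6 z - M) \<le> lattice_error 3"
    using eisenstein_main_terms[of 3 z] z by (simp add: M_def)
  have z1: "z + 1 = - cnj z" using z(3) by (simp add: complex_eq_iff)
  have "1 / (z + 1) ^ 6 = cnj (1 / z ^ 6)" unfolding z1 by simp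
  then have "Re (1 / (z + 1) ^ 6) = Re (1 / z ^ 6)" by (simp only: cnj.simps)
  then have ReM: "Re M = 1 + 2 * Re (1 / z ^ 6) + Re (1 / (z - 1) ^ 6)"
    unfolding M_def by (simp only: plus_complex.simps one_complex.simps)
  have "Re (1 / z ^ 6) = Re (z ^ 6) / s ^ 6"
  proof -
    have "Re (1 / z ^ 6) = Re (z ^ 6) / (cmod (z ^ 6))\<^sup>2"
      by (simp only: Re_divide cmod_power2) simp
    also have "(cmod (z ^ 6))\<^sup>2 = s ^ 6"
      by (simp add: s_def norm_power flip: power_mult)
    finally show ?thesis .
  qed
  also have "Re (z ^ 6) = (1/2 - s) * (s\<^sup>2 - 4 * s + 1)"
  proof -
    define y where "y = Im z"
    have "z\<^sup>2 = Complex (1/2 - s) (- y)"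
      using y2 by (simp add: complex_eq_iff z(3) power2_eq_square y_def)
    then have "z ^ 6 = (Complex (1/2 - s) (- y)) ^ 3" using power_mult[of z 2 3] by simp
    then have "Re (z ^ 6) = (1/2 - s) ^ 3 - 3 * (1/2 - s) * y\<^sup>2"
      by (simp add: power3_eq_cube power2_eq_square algebra_simps)
    then have "Re (z ^ 6) = (1/2 - s) ^ 3 - 3 * (1/2 - s) * (s - 1/4)"
      unfolding y2[folded y_def] .
    then show ?thesis by (simp add: power3_eq_cube power2_eq_square field_simps)
  qed
  finally have Re6: "Re (1 / z ^ 6) = (1/2 - s) * (s\<^sup>2 - 4 * s + 1) / s ^ 6" .
  have "2 * ((1/2 - s) * (s\<^sup>2 - 4 * s + 1)) = (1 - 2 * s) * (s\<^sup>2 - 4 * s + 1)"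
    by (simp add: algebra_simps)
  then have "2 * Re (1 / z ^ 6) = (1 - 2 * s) * (s\<^sup>2 - 4 * s + 1) / s ^ 6"
    unfolding Re6 times_divide_eq_right by (simp only:)
  also have "\<dots> \<ge> - (1/10)"
  proof -
    have "(2 * s - 1) * (s\<^sup>2 - 4 * s + 1) \<le> s ^ 6 / 10"
    proof (cases "s\<^sup>2 - 4 * s + 1 \<le> 0")
      case True
      then have "(2 * s - 1) * (s\<^sup>2 - 4 * s + 1) \<le> 0" using s by (intro mult_nonneg_nonpos) auto
      also have "0 \<le> s ^ 6 / 10" using s by simp
      finally show ?thesis .
    next
      case False
      have s3: "s \<ge> 3"
      proof (rule ccontr)
        assume "\<not> s \<ge> 3"
        then have "(s - 1) * (s - 3) \<le> 0" using s by (intro mult_nonneg_nonpos) auto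
        then show False using False s by (simp add: power2_eq_square algebra_simps)
      qed
      have "(2 * s - 1) * (s\<^sup>2 - 4 * s + 1) \<le> (2 * s) * s\<^sup>2" using False s by (intro mult_mono) auto
      also have "\<dots> = 2 * s ^ 3" by (simp add: power2_eq_square power3_eq_cube)
      also have "2 * s ^ 3 \<le> s ^ 3 / 10 * s ^ 3"
      proof -
        have "3 ^ 3 \<le> s ^ 3" using s3 by (intro power_mono) auto
        then have "2 \<le> s ^ 3 / 10" by simp
        then show ?thesis using s by (intro mult_right_mono) auto
      qed
      finally show ?thesis by (simp flip: power_add)
    qed
    moreover have "s ^ 6 > 0" using s by simp
    ultimately show ?thesis by (simp add: divide_simps algebra_simps)
  qed
  finally have a: "2 * Re (1 / z ^ 6) \<ge> - (1/10)" .
  have b: "Re (1 / (z - 1) ^ 6) \<ge> - (1/27)"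
  proof -
    have "(cmod (z - 1))\<^sup>2 = s + 2"
      using y2 by (simp add: cmod_power2 z(3)) (simp add: power2_eq_square)
    then have "3 \<le> (cmod (z - 1))\<^sup>2" using s by simp
    then have "3 ^ 3 \<le> ((cmod (z - 1))\<^sup>2) ^ 3" by (intro power_mono) auto
    also have "\<dots> = cmod ((z - 1) ^ 6)" by (simp add: norm_power flip: power_mult)
    finally have "cmod (1 / (z - 1) ^ 6) \<le> 1 / 27"
      unfolding norm_divide by (intro frac_le) auto
    then show ?thesis using abs_Re_le_cmod[of "1 / (z - 1) ^ 6"] by linarith
  qed
  have "\<bar>Re (eisenstein 6 z - M)\<bar> \<le> 93 / 400"
    using E lattice_error_bounds(2) abs_Re_le_cmod[of "eisenstein 6 z - M"] by linarith
  then have "Re (eisenstein 6 z) \<ge> Re M - 93 / 400"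
    using abs_le_D2[of "Re (eisenstein 6 z - M)"] by fastforce
  then show ?thesis using a b ReM by simp
qed

lemma boundary_form_pos_line:
  assumes z: "Im z > 0" "cmod z \<ge> 1" "\<bar>Re z\<bar> = 1/2"
  shows "Re (boundary_form z) > 0"
proof -
  have left: "Re (boundary_form z) > 0" if z: "Im z > 0" "cmod z \<ge> 1" "Re z = - 1/2" for z
  proof -
    have zH: "z \<in> upper_half_plane" using z by (simp add: upper_half_plane_def)
    obtain u where u: "eisenstein 4 z = of_real u"
      using real_form_line[OF real_form_eisenstein[of 4] zH] z by (auto elim: Reals_cases)
    obtain v where v: "eisenstein 6 z = of_real v"
      using real_form_line[OF real_form_eisenstein[of 6] zH] z by (auto elim: Reals_cases)
    have "v \<ge> 1/2" using Re_eisenstein_6_line[OF z] v by simp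
    then have "v\<^sup>2 \<ge> (1/2)\<^sup>2" by (intro power_mono) auto
    moreover have "\<bar>u\<bar> \<le> 6" using cmod_eisenstein_4_le[of z] z u by simp
    then have "\<bar>u\<bar> ^ 3 \<le> 6 ^ 3" by (intro power_mono) auto
    then have "u ^ 3 \<le> 216" using abs_le_D1[of "u ^ 3" 216] by (simp add: power_abs)
    ultimately have "10000 * v\<^sup>2 - u ^ 3 > 0" by (simp add: power2_eq_square)
    moreover have "boundary_form z = of_real (10000 * v\<^sup>2 - u ^ 3)"
      by (simp add: boundary_form_def u v)
    ultimately show ?thesis by simp
  qed
  show ?thesis
  proof (cases "Re z = - 1/2")
    case True
    then show ?thesis using left z by blast
  next
    case False
    then have r: "Re z = 1/2" using z by (auto simp: abs_if split: if_splits)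
    have zH: "z \<in> upper_half_plane" using z by (simp add: upper_half_plane_def)
    have "Re (boundary_form (- cnj z)) > 0" by (rule left) (use z r in auto)
    then show ?thesis using real_formD(4)[OF real_form_boundary_form zH] by simp
  qed
qed

text \<open>Write \<open>u = z^2 E_4(z)\<close>, \<open>v = z^3 E_6(z)\<close> (both real) and \<open>x = Re z\<close>. On the left half of the
  side either \<open>x \<ge> - 1/10\<close>, where \<open>u < 0\<close>, or \<open>x \<le> - 1/10\<close>, where \<open>v\<close> is bounded below. The right
  half follows by reflection.\<close>
lemma boundary_form_pos_circle:
  assumes z: "Im z > 0" "cmod z = 1" "\<bar>Re z\<bar> \<le> 1/2"
  shows "Re (z ^ 6 * boundary_form z) > 0"
proof -
  have left: "Re (z ^ 6 * boundary_form z) > 0"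
    if z: "Im z > 0" "cmod z = 1" "- 1/2 \<le> Re z" "Re z \<le> 0" for z
  proof -
    have zH: "z \<in> upper_half_plane" using z by (simp add: upper_half_plane_def)
    define x where "x = Re z"
    have x: "- 1/2 \<le> x" "x \<le> 0" using z by (auto simp: x_def)
    obtain u where u: "z ^ 2 * eisenstein 4 z = of_real u"
      using real_form_circle[of 2 "eisenstein 4", OF _ zH z(2)] real_form_eisenstein[of 4]
      by (auto elim: Reals_cases)
    obtain v where v: "z ^ 3 * eisenstein 6 z = of_real v"
      using real_form_circle[of 3 "eisenstein 6", OF _ zH z(2)] real_form_eisenstein[of 6]
      by (auto elim: Reals_cases)
    have eq: "z ^ 6 * boundary_form z = of_real (10000 * v\<^sup>2 - u ^ 3)"
    proof -
      have "z ^ 6 * boundary_form z = 10000 * (z ^ 3 * eisenstein 6 z)\<^sup>2 - (z ^ 2 * eisenstein 4 z) ^ 3"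
        by (simp add: boundary_form_def power_mult_distrib algebra_simps flip: power_mult)
      then show ?thesis unfolding u v by simp
    qed
    have ud: "\<bar>u - (2 * (2 * x\<^sup>2 - 1) + nearest_terms 2 x)\<bar> \<le> 51 / 50"
    proof -
      have "cmod (of_real u - of_real (2 * Re (z\<^sup>2) + nearest_terms 2 (Re z))) \<le> lattice_error 2"
        using eisenstein_on_circle[of 2 z] z by (simp add: u[symmetric])
      then show ?thesis using lattice_error_bounds(1) 
        unfolding Re_power2_circle[OF z(2)] x_def[symmetric] of_real_diff[symmetric] norm_of_real by linarith
    qed
    have vd: "\<bar>v - (2 * (4 * x ^ 3 - 3 * x) + nearest_terms 3 x)\<bar> \<le> 93 / 400"
    proof -
      have "cmod (of_real v - of_real (2 * Re (z ^ 3) + nearest_terms 3 (Re z))) \<le> lattice_error 3"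
        using eisenstein_on_circle[of 3 z] z by (simp add: v[symmetric])
      then show ?thesis using lattice_error_bounds(2)
        unfolding Re_power3_circle[OF z(2)] x_def[symmetric] of_real_diff[symmetric] norm_of_real by linarith
    qed
    have "10000 * v\<^sup>2 - u ^ 3 > 0"
    proof (cases "x \<ge> - 1/10")
      case True
      have "x\<^sup>2 \<le> (1/10)\<^sup>2" using True x by (intro power2_le_iff_abs_le[THEN iffD2]) auto
      then have x2: "x\<^sup>2 \<le> 1/100" by (simp add: power2_eq_square)
      have "1 / (2 + 2 * x) \<le> 5/9" "0 \<le> 1 / (2 + 2 * x)" using True by (auto simp: divide_simps)
      then have p: "(1 / (2 + 2 * x))\<^sup>2 \<le> (5/9)\<^sup>2" by (intro power_mono)
      have "1 / (2 - 2 * x) \<le> 1/2" "0 \<le> 1 / (2 - 2 * x)" using x by (auto simp: divide_simps)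
      then have "(1 / (2 - 2 * x))\<^sup>2 \<le> (1/2)\<^sup>2" by (intro power_mono)
      moreover have "(1 / (2 * x - 2))\<^sup>2 = (1 / (2 - 2 * x))\<^sup>2"
        by (simp add: power_divide power2_commute)
      ultimately have "nearest_terms 2 x \<le> (5/9)\<^sup>2 + (1/2)\<^sup>2"
        unfolding nearest_terms_def using p by simp
      also have "(5/9 :: real)\<^sup>2 + (1/2)\<^sup>2 \<le> 3 / 5" by (simp add: power2_eq_square)
      finally have "nearest_terms 2 x \<le> 3 / 5" .
      then have "u < 0" using abs_le_D1[OF ud] x2 by (simp add: algebra_simps)
      then have "u ^ 3 < 0" by simp
      moreover have "10000 * v\<^sup>2 \<ge> 0" by simp
      ultimately show ?thesis by linarith
    next
      case False
      have "x\<^sup>2 \<le> (1/2)\<^sup>2" using x by (intro power2_le_iff_abs_le[THEN iffD2]) auto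
      then have "4 * x\<^sup>2 - 3 \<le> - 2" by (simp add: power2_eq_square)
      then have "x * (4 * x\<^sup>2 - 3) \<ge> x * (- 2)" using x by (intro mult_left_mono_neg) auto
      then have "2 * (4 * x ^ 3 - 3 * x) \<ge> - 4 * x" by (simp add: power2_eq_square power3_eq_cube algebra_simps)
      moreover have "nearest_terms 3 x \<ge> 0" by (rule nearest_terms_bounds(2)) (use x in auto)
      ultimately have "v \<ge> (4 / 25)" using abs_le_D2[OF vd] False by linarith
      then have "v\<^sup>2 \<ge> (4 / 25)\<^sup>2" by (intro power_mono) auto
      moreover have "\<bar>u\<bar> \<le> 6"
      proof -
        have "\<bar>u\<bar> = cmod (z ^ 2 * eisenstein 4 z)" unfolding u by simp
        also have "\<dots> \<le> 6" using cmod_eisenstein_4_le[of z] z by (simp add: norm_mult norm_power)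
        finally show ?thesis .
      qed
      then have "\<bar>u\<bar> ^ 3 \<le> 6 ^ 3" by (intro power_mono) auto
      then have "u ^ 3 \<le> 216" using abs_le_D1[of "u ^ 3" 216] by (simp add: power_abs)
      ultimately show ?thesis by (simp add: power2_eq_square)
    qed
    then show ?thesis unfolding eq by simp
  qed
  show ?thesis
  proof (cases "Re z \<le> 0")
    case True
    then show ?thesis using left[of z] z by auto
  next
    case False
    have zH: "z \<in> upper_half_plane" using z by (simp add: upper_half_plane_def)
    have "Re ((- cnj z) ^ 6 * boundary_form (- cnj z)) > 0" by (rule left) (use z False in auto)
    moreover have "(- cnj z) ^ 6 * boundary_form (- cnj z) = cnj (z ^ 6 * boundary_form z)"
      using real_formD(4)[OF real_form_boundary_form zH] by simp
    ultimately show ?thesis by (simp only: cnj.simps)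
  qed
qed

section \<open>The boundary path of the truncated fundamental domain\<close>

definition fund_interior :: "complex set" where
  "fund_interior = {z. Im z > 0 \<and> cmod z > 1 \<and> \<bar>Re z\<bar> < 1/2}"

definition left_corner :: complex where "left_corner = cis (2 * pi / 3)"
definition right_corner :: complex where "right_corner = cis (pi / 3)"

lemma corner_simps [simp]:
  "Re left_corner = - 1/2" "Im left_corner = sqrt 3 / 2"
  "Re right_corner = 1/2" "Im right_corner = sqrt 3 / 2"
  by (simp_all add: left_corner_def right_corner_def cos_60 sin_60 cos_120 sin_120)

text \<open>The truncated domain \<open>\<bar>z\<bar> \<ge> 1\<close>, \<open>\<bar>Re z\<bar> \<le> 1/2\<close>, \<open>Im z \<le> T\<close> is kept on the left of the path, so the
  circular side is traversed from the left to the right corner.\<close>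
definition arc_path :: "real \<Rightarrow> complex" where
  "arc_path = part_circlepath 0 1 (2 * pi / 3) (pi / 3)"

definition upper_path :: "real \<Rightarrow> real \<Rightarrow> complex" where
  "upper_path T = linepath right_corner (Complex (1/2) T)
     +++ linepath (Complex (1/2) T) (Complex (- 1/2) T) +++ linepath (Complex (- 1/2) T) left_corner"

definition boundary_path :: "real \<Rightarrow> real \<Rightarrow> complex" where
  "boundary_path T = arc_path +++ upper_path T"

lemma arc_path_simps [simp]:
  "pathstart arc_path = left_corner" "pathfinish arc_path = right_corner" "valid_path arc_path"
  by (simp_all add: arc_path_def left_corner_def right_corner_def cis_conv_exp)

lemma upper_path_simps [simp]:
  "pathstart (upper_path T) = right_corner" "pathfinish (upper_path T) = left_corner"
  "valid_path (upper_path T)"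
  by (simp_all add: upper_path_def)

lemma path_image_arc_path:
  assumes "z \<in> path_image arc_path"
  shows "cmod z = 1" "\<bar>Re z\<bar> \<le> 1/2" "Im z \<ge> sqrt 3 / 2"
proof -
  obtain t where t: "t \<in> closed_segment (2 * pi / 3) (pi / 3)" "z = cis t"
    using assms by (auto simp: arc_path_def path_image_part_circlepath')
  have t': "pi / 3 \<le> t" "t \<le> 2 * pi / 3"
    using t(1) pi_gt_zero by (auto simp: closed_segment_eq_real_ivl split: if_splits)
  have "cos t \<le> cos (pi / 3)" "cos (2 * pi / 3) \<le> cos t"
    using t' pi_gt_zero by (intro cos_monotone_0_pi_le; linarith)+
  then have c: "\<bar>cos t\<bar> \<le> 1/2" unfolding cos_60 cos_120 by linarith
  then show "\<bar>Re z\<bar> \<le> 1/2" by (simp add: t)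
  show "cmod z = 1" by (simp add: t)
  have "(cos t)\<^sup>2 \<le> (1/2)\<^sup>2" using c by (intro power2_le_iff_abs_le[THEN iffD2]) auto
  then have "(sqrt 3 / 2)\<^sup>2 \<le> (sin t)\<^sup>2" using sin_cos_squared_add[of t] by (simp add: power_divide power2_eq_square)
  moreover have "sin t \<ge> 0" using t' pi_gt_zero by (intro sin_ge_zero; linarith)
  ultimately have "sqrt 3 / 2 \<le> sin t" by (rule power2_le_imp_le)
  then show "Im z \<ge> sqrt 3 / 2" by (simp add: t)
qed

lemma sqrt3_bounds: "1 < sqrt 3" "sqrt 3 < 2"
  using real_sqrt_less_mono[of 1 3] real_sqrt_less_mono[of 3 4] by auto

lemma path_image_upper_path:
  assumes "T \<ge> 1" 
  shows "path_image (upper_path T) = {z. \<bar>Re z\<bar> = 1/2 \<and> sqrt 3 / 2 \<le> Im z \<and> Im z \<le> T}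
           \<union> {z. \<bar>Re z\<bar> \<le> 1/2 \<and> Im z = T}"
proof -
  have "path_image (upper_path T) = closed_segment right_corner (Complex (1/2) T)
    \<union> closed_segment (Complex (1/2) T) (Complex (- 1/2) T) \<union> closed_segment (Complex (- 1/2) T) left_corner"
    by (simp add: upper_path_def path_image_join Un_assoc)
  also have "closed_segment right_corner (Complex (1/2) T) = {z. Re z = 1/2 \<and> sqrt 3 / 2 \<le> Im z \<and> Im z \<le> T}"
    using assms sqrt3_bounds by (subst closed_segment_same_Re) (auto simp: closed_segment_eq_real_ivl)
  also have "closed_segment (Complex (1/2) T) (Complex (- 1/2) T) = {z. \<bar>Re z\<bar> \<le> 1/2 \<and> Im z = T}"
    by (subst closed_segment_same_Im) (auto simp: closed_segment_eq_real_ivl abs_if split: if_splits)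
  also have "closed_segment (Complex (- 1/2) T) left_corner = {z. Re z = - 1/2 \<and> sqrt 3 / 2 \<le> Im z \<and> Im z \<le> T}"
    using assms sqrt3_bounds by (subst closed_segment_same_Re) (auto simp: closed_segment_eq_real_ivl)
  finally have "path_image (upper_path T) = {z. Re z = 1/2 \<and> sqrt 3 / 2 \<le> Im z \<and> Im z \<le> T}
    \<union> {z. \<bar>Re z\<bar> \<le> 1/2 \<and> Im z = T} \<union> {z. Re z = - 1/2 \<and> sqrt 3 / 2 \<le> Im z \<and> Im z \<le> T}" .
  moreover have "\<bar>Re z\<bar> = 1/2 \<longleftrightarrow> Re z = 1/2 \<or> Re z = - 1/2" for z by linarith
  ultimately show ?thesis by blast
qed

lemma path_image_boundary_path: "path_image (boundary_path T) = path_image arc_path \<union> path_image (upper_path T)"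
  by (simp add: boundary_path_def path_image_join)

lemma boundary_path_simps [simp]:
  "valid_path (boundary_path T)" "pathfinish (boundary_path T) = pathstart (boundary_path T)"
  by (simp_all add: boundary_path_def)

lemma path_image_boundary_path_subset:
  assumes "T \<ge> 1"
  shows "path_image (boundary_path T) \<subseteq> cbox left_corner (Complex (1/2) T)"
    and "path_image (boundary_path T) \<subseteq> {z. cmod z \<ge> 1}"
proof -
  show "path_image (boundary_path T) \<subseteq> cbox left_corner (Complex (1/2) T)"
  proof
    fix z assume "z \<in> path_image (boundary_path T)"
    then consider "z \<in> path_image arc_path"
      | "\<bar>Re z\<bar> = 1/2" "sqrt 3 / 2 \<le> Im z" "Im z \<le> T" | "\<bar>Re z\<bar> \<le> 1/2" "Im z = T"
      unfolding path_image_boundary_path path_image_upper_path[OF assms] by blast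
    then have "\<bar>Re z\<bar> \<le> 1/2 \<and> sqrt 3 / 2 \<le> Im z \<and> Im z \<le> T"
    proof cases
      case 1
      then show ?thesis
        using path_image_arc_path[OF 1] abs_Im_le_cmod[of z] assms by linarith
    next
      case 3
      then show ?thesis using assms sqrt3_bounds by simp
    qed simp
    then show "z \<in> cbox left_corner (Complex (1/2) T)"
      unfolding in_cbox_complex_iff abs_le_iff by simp
  qed
  show "path_image (boundary_path T) \<subseteq> {z. cmod z \<ge> 1}"
  proof safe
    fix z assume "z \<in> path_image (boundary_path T)"
    then consider "z \<in> path_image arc_path" | "\<bar>Re z\<bar> = 1/2" "Im z \<ge> sqrt 3 / 2" | "Im z = T"
      unfolding path_image_boundary_path path_image_upper_path[OF assms] by auto
    then show "cmod z \<ge> 1"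
    proof cases
      case 2
      have "(Re z)\<^sup>2 = (1/2)\<^sup>2" unfolding power2_abs[of "Re z", symmetric] 2(1) ..
      moreover have "(sqrt 3 / 2)\<^sup>2 \<le> (Im z)\<^sup>2" using 2 by (intro power_mono) auto
      ultimately have "1\<^sup>2 \<le> (cmod z)\<^sup>2" by (simp add: cmod_power2 power_divide)
      then show ?thesis by (rule power2_le_imp_le) simp
    next
      case 3
      then show ?thesis using abs_Im_le_cmod[of z] assms by simp
    qed (use path_image_arc_path in auto)
  qed
qed

text \<open>The path lies in a convex rectangle and in \<open>\<bar>z\<bar> \<ge> 1\<close>. Hence its winding number is zero outside
  the rectangle, in particular at 0, and therefore on the whole unit disc.\<close>
lemma winding_number_boundary_path_outside:
  assumes "T \<ge> 1" "cmod p < 1 \<or> p \<notin> cbox left_corner (Complex (1/2) T)"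
  shows "winding_number (boundary_path T) p = 0"
proof -
  have out: "winding_number (boundary_path T) p = 0" if "p \<notin> cbox left_corner (Complex (1/2) T)" for p
    by (rule winding_number_zero_outside[OF _ convex_box(1) _ that])
       (use path_image_boundary_path_subset(1)[OF assms(1)] in \<open>auto simp: valid_path_imp_path\<close>)
  show ?thesis
  proof (cases "cmod p < 1")
    case True
    have "winding_number (boundary_path T) constant_on ball 0 1"
      by (rule winding_number_constant)
         (use path_image_boundary_path_subset(2)[OF assms(1)] in \<open>auto simp: valid_path_imp_path\<close>)
    then obtain c where c: "\<And>x. x \<in> ball 0 1 \<Longrightarrow> winding_number (boundary_path T) x = c"
      unfolding constant_on_def by blast
    have "winding_number (boundary_path T) 0 = 0"
      by (rule out) (simp add: in_cbox_complex_iff)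
    then show ?thesis using c[of 0] c[of p] True by simp
  qed (use assms out in auto)
qed

text \<open>Replacing the arc by the chord between the corners turns the path into the boundary of a
  rectangle around \<open>p\<close>. Arc and chord together bound a region inside the closed unit disc, which
  does not contain \<open>p\<close>.\<close>
lemma winding_number_boundary_path_inside:
  assumes "T \<ge> 1" "p \<in> fund_interior" "Im p < T"
  shows "winding_number (boundary_path T) p = 1"
proof -
  have p: "cmod p > 1" "\<bar>Re p\<bar> < 1/2" "Im p > 0" using assms(2) by (auto simp: fund_interior_def)
  have Imp: "Im p > sqrt 3 / 2"
  proof -
    have "(Re p)\<^sup>2 \<le> (1/2)\<^sup>2" using p by (intro power2_le_iff_abs_le[THEN iffD2]) auto
    moreover have "1\<^sup>2 < (cmod p)\<^sup>2" using p by (intro power_strict_mono) auto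
    ultimately have "(sqrt 3 / 2)\<^sup>2 < (Im p)\<^sup>2" by (simp add: cmod_power2 power_divide)
    then show ?thesis by (rule power_less_imp_less_base) (use p in simp)
  qed
  define bottom where "bottom = linepath left_corner right_corner"
  have corner: "cmod left_corner = 1" "cmod right_corner = 1" by (simp_all add: left_corner_def right_corner_def)
  have segball: "closed_segment left_corner right_corner \<subseteq> cball 0 1"
    by (rule closed_segment_subset) (use corner in auto)
  have pa: "p \<notin> path_image arc_path" using path_image_arc_path(1)[of p] p by auto
  have pb: "p \<notin> path_image bottom" using segball p by (auto simp: bottom_def)
  have pu: "p \<notin> path_image (upper_path T)"
    unfolding path_image_upper_path[OF assms(1)] using p assms by auto
  have "winding_number (arc_path +++ reversepath bottom) p = 0"
  proof (rule winding_number_zero_outside[of _ "cball 0 1"])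
    show "path_image (arc_path +++ reversepath bottom) \<subseteq> cball 0 1"
      using segball path_image_arc_path(1)
      by (subst path_image_join) (auto simp: bottom_def closed_segment_commute[of right_corner])
  qed (use p in \<open>auto simp: bottom_def valid_path_imp_path intro!: path_join_imp\<close>)
  then have "winding_number arc_path p = winding_number bottom p"
    using winding_number_join[of arc_path p "reversepath bottom"] winding_number_reversepath[of bottom p]
      pa pb by (simp add: valid_path_imp_path bottom_def closed_segment_commute[of right_corner])
  then have "winding_number (boundary_path T) p = winding_number (bottom +++ upper_path T) p"
    unfolding boundary_path_def using pa pb pu
    by (simp add: winding_number_join valid_path_imp_path bottom_def)
  also have "bottom +++ upper_path T = rectpath left_corner (Complex (1/2) T)"
  proof -
    have "Complex (1 / 2) (sqrt 3 / 2) = right_corner" by (simp add: complex_eq_iff)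
    then show ?thesis by (simp add: bottom_def upper_path_def rectpath_def Let_def)
  qed
  also have "winding_number (rectpath left_corner (Complex (1/2) T)) p = 1"
    by (rule winding_number_rectpath) (use p Imp assms in \<open>auto simp: in_box_complex_iff\<close>)
  finally show ?thesis .
qed

section \<open>Counting zeros inside the fundamental domain\<close>

lemma Ln_compose_derivative:
  assumes "H holomorphic_on S" "open S" "z \<in> S" "Im (H z) > 0 \<or> Re (H z) > 0"
  shows "((\<lambda>w. Ln (H w)) has_field_derivative deriv H z / H z) (at z within A)"
proof -
  have "H z \<notin> \<real>\<^sub>\<le>\<^sub>0" using assms(4) by (auto simp: complex_nonpos_Reals_iff)
  then have "((\<lambda>w. Ln (H w)) has_field_derivative inverse (H z) * deriv H z) (at z within A)"
    by (intro DERIV_chain2[OF has_field_derivative_Ln holomorphic_derivI[OF assms(1-3)]])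
  then show ?thesis by (simp add: divide_inverse mult.commute)
qed

lemma log_integral:
  assumes "H holomorphic_on S" "open S" "valid_path g" "path_image g \<subseteq> S"
    and "\<And>z. z \<in> path_image g \<Longrightarrow> Im (H z) > 0 \<or> Re (H z) > 0"
  shows "((\<lambda>z. deriv H z / H z) has_contour_integral
            (Ln (H (pathfinish g)) - Ln (H (pathstart g)))) g"
  by (rule contour_integral_primitive[where S = "path_image g"])
     (use assms in \<open>auto intro!: Ln_compose_derivative[where S = S]\<close>)

lemma corner_power:
  assumes "6 dvd N"
  shows "left_corner ^ N = 1" "right_corner ^ N = 1"
proof -
  obtain n where N: "N = 6 * n" using assms by (elim dvdE)
  have r: "right_corner ^ 6 = 1" by (simp add: right_corner_def Complex.DeMoivre)
  have "left_corner = right_corner ^ 2" by (simp add: right_corner_def left_corner_def Complex.DeMoivre)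
  then have "left_corner ^ 6 = (right_corner ^ 6) ^ 2"
    using power_mult[of right_corner 2 6] power_mult[of right_corner 6 2] by simp
  with r have "left_corner ^ 6 = 1" "right_corner ^ 6 = 1" by simp_all
  then show "left_corner ^ N = 1" "right_corner ^ N = 1" by (simp_all add: N power_mult)
qed

text \<open>On the arc \<open>z^N H(z)\<close> has a logarithm, so \<open>Ln (z^N H z) - N Ln z\<close> is a primitive of \<open>H'/H\<close>. At the
  corners, which are sixth roots of unity, \<open>z^N = 1\<close>; the change of \<open>- N Ln z\<close> along the arc of
  angle \<open>\<pi>/3\<close> is what survives in the end.\<close>
lemma log_integral_arc:
  assumes H: "H holomorphic_on upper_half_plane" and "6 dvd N"
    and arc: "\<And>z. Im z > 0 \<Longrightarrow> cmod z = 1 \<Longrightarrow> \<bar>Re z\<bar> \<le> 1/2 \<Longrightarrow> Im (z ^ N * H z) > 0"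
  shows "((\<lambda>z. deriv H z / H z) has_contour_integral
            (Ln (H right_corner) - Ln (H left_corner) + of_nat N * \<i> * pi / 3)) arc_path"
proof -
  define \<Phi> where "\<Phi> = (\<lambda>z. Ln (z ^ N * H z) - of_nat N * Ln z)"
  have hol: "(\<lambda>z. z ^ N * H z) holomorphic_on upper_half_plane"
    by (intro holomorphic_intros H)
  have "((\<lambda>z. deriv H z / H z) has_contour_integral (\<Phi> (pathfinish arc_path) - \<Phi> (pathstart arc_path))) arc_path"
  proof (rule contour_integral_primitive[where S = "path_image arc_path"])
    fix z assume "z \<in> path_image arc_path"
    note z = path_image_arc_path[OF this]
    have Im: "Im z > 0" using z(3) sqrt3_bounds by linarith
    then have zH: "z \<in> upper_half_plane" by (simp add: upper_half_plane_def)
    have im: "Im (z ^ N * H z) > 0" using arc Im z by blast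
    then have nz: "z ^ N * H z \<noteq> 0" by (metis less_irrefl zero_complex.simps(2))
    have nz': "z \<noteq> 0" "H z \<noteq> 0" using Im nz by (metis less_irrefl zero_complex.simps(2), simp)
    have d: "deriv (\<lambda>z. z ^ N * H z) z = z ^ N * deriv H z + of_nat N * z ^ (N - 1) * H z"
      by (rule DERIV_imp_deriv)
         (auto intro!: derivative_eq_intros holomorphic_derivI[OF H open_upper_half_plane zH])
    have 1: "((\<lambda>w. Ln (w ^ N * H w)) has_field_derivative
        (z ^ N * deriv H z + of_nat N * z ^ (N - 1) * H z) / (z ^ N * H z)) (at z within path_image arc_path)"
      unfolding d[symmetric]
      by (rule Ln_compose_derivative[OF hol open_upper_half_plane zH]) (use im in simp)
    have 2: "(Ln has_field_derivative inverse z) (at z within path_image arc_path)"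
      by (rule has_field_derivative_at_within, rule has_field_derivative_Ln)
         (use Im in \<open>auto simp: complex_nonpos_Reals_iff\<close>)
    have "(\<Phi> has_field_derivative ((z ^ N * deriv H z + of_nat N * z ^ (N - 1) * H z) / (z ^ N * H z)
         - of_nat N * inverse z)) (at z within path_image arc_path)"
      unfolding \<Phi>_def by (intro DERIV_diff DERIV_cmult 1 2)
    also have "(z ^ N * deriv H z + of_nat N * z ^ (N - 1) * H z) / (z ^ N * H z) - of_nat N * inverse z
       = deriv H z / H z"
    proof (cases "N = 0")
      case False
      then have "z ^ N = z * z ^ (N - 1)" by (simp add: power_eq_if)
      then show ?thesis using nz' by (simp add: field_simps)
    qed simp
    finally show "(\<Phi> has_field_derivative deriv H z / H z) (at z within path_image arc_path)" .
  qed auto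
  moreover have "Ln left_corner = 2 * pi / 3 * \<i>" "Ln right_corner = pi / 3 * \<i>"
    unfolding left_corner_def right_corner_def by (subst Ln_cis; use pi_gt_zero in simp)+
  ultimately show ?thesis
    unfolding \<Phi>_def by (simp add: corner_power[OF assms(2)] algebra_simps diff_divide_distrib)
qed

lemma finite_zeros_compact:
  assumes H: "H holomorphic_on upper_half_plane" and "\<beta> \<in> upper_half_plane" "H \<beta> \<noteq> 0"
    and K: "compact K" "K \<subseteq> upper_half_plane"
  shows "finite {z \<in> K. H z = 0}"
proof (cases "H constant_on upper_half_plane")
  case True
  then have "{z \<in> K. H z = 0} = {}" using assms unfolding constant_on_def by force
  then show ?thesis by (simp only: finite.emptyI)
next
  case False
  then show ?thesis
    by (rule holomorphic_compact_finite_zeros[OF H open_upper_half_plane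
          convex_connected[OF convex_upper_half_plane] K])
qed

text \<open>The sides are mapped into the upper half plane and the top into the right half plane, and the
  principal logarithm is holomorphic on the union of the two. So the contributions \<open>Ln (H z)\<close>
  cancel at the corners, and the contour integral is \<open>N \<i> \<pi>/3\<close>.\<close>
lemma zero_count_interior:
  assumes H: "H holomorphic_on upper_half_plane" and N: "6 dvd N"
    and arc: "\<And>z. Im z > 0 \<Longrightarrow> cmod z = 1 \<Longrightarrow> \<bar>Re z\<bar> \<le> 1/2 \<Longrightarrow> Im (z ^ N * H z) > 0"
    and line: "\<And>z. Im z > 0 \<Longrightarrow> cmod z \<ge> 1 \<Longrightarrow> \<bar>Re z\<bar> = 1/2 \<Longrightarrow> Im (H z) > 0"
    and cusp: "\<forall>\<^sub>F z in at_cusp. Re (H z) > 0"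
  shows "finite {z \<in> fund_interior. H z = 0}"
    and "(\<Sum>z | z \<in> fund_interior \<and> H z = 0. zorder H z) = int (N div 6)"
proof -
  obtain T0 where T0: "\<And>z. Im z \<ge> T0 \<Longrightarrow> \<bar>Re z\<bar> \<le> 1/2 \<Longrightarrow> Re (H z) > 0"
    using cusp unfolding eventually_at_cusp by blast
  define T where "T = max 1 T0"
  have T: "T \<ge> 1" and top: "\<And>z. Im z \<ge> T \<Longrightarrow> \<bar>Re z\<bar> \<le> 1/2 \<Longrightarrow> Re (H z) > 0"
    using T0 by (auto simp: T_def)
  \<comment> \<open>The zeros in the whole half plane may be infinite in number; the argument principle is applied in a bounded box.\<close>
  define S where "S = box (Complex (-1) (1/2)) (Complex 1 (T + 1))"
  define \<gamma> where "\<gamma> = boundary_path T"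
  have S: "open S" "convex S" "S \<subseteq> upper_half_plane"
    by (auto simp: S_def open_box convex_box in_box_complex_iff upper_half_plane_def)
  have HS: "H holomorphic_on S" using H S(3) by (rule holomorphic_on_subset)
  have finS: "finite {z \<in> S. H z = 0}"
  proof -
    have "Re (H (Complex 0 T)) > 0" by (rule top) auto
    then have "Complex 0 T \<in> upper_half_plane" "H (Complex 0 T) \<noteq> 0"
      using T by (auto simp: upper_half_plane_def)
    then have "finite {z \<in> cbox (Complex (-1) (1/2)) (Complex 1 (T + 1)). H z = 0}"
      by (intro finite_zeros_compact[OF H])
         (auto simp: in_cbox_complex_iff upper_half_plane_def)
    then show ?thesis
      by (rule rev_finite_subset) (auto simp: S_def in_box_complex_iff in_cbox_complex_iff)
  qed
  have inS: "z \<in> S" if "z \<in> path_image \<gamma>" for z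
  proof -
    have "z \<in> cbox left_corner (Complex (1/2) T)"
      using path_image_boundary_path_subset(1)[OF T] that by (auto simp: \<gamma>_def)
    then have "- 1/2 \<le> Re z" "Re z \<le> 1/2" "sqrt 3 / 2 \<le> Im z" "Im z \<le> T"
      by (simp_all add: in_cbox_complex_iff)
    moreover from this have "1/2 < Im z" using sqrt3_bounds by linarith
    ultimately show ?thesis by (simp add: S_def in_box_complex_iff)
  qed
  have upper: "Im (H z) > 0 \<or> Re (H z) > 0" if z: "z \<in> path_image (upper_path T)" for z
  proof -
    have "cmod z \<ge> 1" "z \<in> S"
      using path_image_boundary_path_subset(2)[OF T] inS z
      by (auto simp: \<gamma>_def path_image_boundary_path)
    then show ?thesis using z top[of z] line[of z]
      unfolding path_image_upper_path[OF T] by (auto simp: S_def in_box_complex_iff)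
  qed
  have onpath: "H z \<noteq> 0" if "z \<in> path_image \<gamma>" for z
  proof (cases "z \<in> path_image arc_path")
    case True
    have "Im z > 0" using path_image_arc_path(3)[OF True] sqrt3_bounds by linarith
    then have "Im (z ^ N * H z) > 0"
      by (rule arc) (use path_image_arc_path[OF True] in auto)
    then show ?thesis by auto
  next
    case False
    then show ?thesis using upper[of z] that by (auto simp: \<gamma>_def path_image_boundary_path)
  qed
  have "((\<lambda>z. deriv H z / H z) has_contour_integral
          ((Ln (H right_corner) - Ln (H left_corner) + of_nat N * \<i> * pi / 3)
            + (Ln (H (pathfinish (upper_path T))) - Ln (H (pathstart (upper_path T)))))) \<gamma>"
    unfolding \<gamma>_def boundary_path_def
  proof (rule has_contour_integral_join)
    show "((\<lambda>z. deriv H z / H z) has_contour_integral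
         (Ln (H right_corner) - Ln (H left_corner) + of_nat N * \<i> * pi / 3)) arc_path"
      by (rule log_integral_arc[OF H N arc])
    show "((\<lambda>z. deriv H z / H z) has_contour_integral
         (Ln (H (pathfinish (upper_path T))) - Ln (H (pathstart (upper_path T))))) (upper_path T)"
      by (rule log_integral[OF HS S(1)])
         (use upper inS in \<open>auto simp: \<gamma>_def path_image_boundary_path\<close>)
  qed auto
  then have I1: "contour_integral \<gamma> (\<lambda>z. deriv H z / H z) = of_nat N * \<i> * pi / 3"
    by (subst contour_integral_unique) auto
  have "contour_integral \<gamma> (\<lambda>x. deriv H x * 1 / H x) = 2 * pi * \<i> *
          (\<Sum>p\<in>{w \<in> S. H w = 0 \<or> w \<in> {}}. winding_number \<gamma> p * 1 * zorder H p)"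
  proof (rule argument_principle)
    show "\<forall>z. z \<notin> S \<longrightarrow> winding_number \<gamma> z = 0"
    proof (intro allI impI)
      fix z assume zS: "z \<notin> S"
      have "z \<notin> cbox left_corner (Complex (1/2) T)"
      proof
        assume "z \<in> cbox left_corner (Complex (1/2) T)"
        then have "- 1/2 \<le> Re z" "Re z \<le> 1/2" "sqrt 3 / 2 \<le> Im z" "Im z \<le> T"
          by (simp_all add: in_cbox_complex_iff)
        moreover from this have "1/2 < Im z" using sqrt3_bounds by linarith
        ultimately show False using zS by (simp add: S_def in_box_complex_iff)
      qed
      then show "winding_number \<gamma> z = 0"
        unfolding \<gamma>_def by (intro winding_number_boundary_path_outside T) simp
    qed
    show "path_image \<gamma> \<subseteq> S - {w \<in> S. H w = 0 \<or> w \<in> {}}" using inS onpath by auto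
  qed (use S HS finS in \<open>auto simp: convex_connected \<gamma>_def\<close>)
  then have "of_nat N * \<i> * pi / 3 = 2 * pi * \<i> * (\<Sum>p | p \<in> S \<and> H p = 0. winding_number \<gamma> p * zorder H p)"
    using I1 by simp
  then have "(\<Sum>p | p \<in> S \<and> H p = 0. winding_number \<gamma> p * of_int (zorder H p)) = of_nat N / 6"
    by (simp add: field_simps)
  moreover have "of_nat N / 6 = (of_nat (N div 6) :: complex)"
    using N by (auto elim!: dvdE)
  ultimately have total: "(\<Sum>p | p \<in> S \<and> H p = 0. winding_number \<gamma> p * of_int (zorder H p))
      = (of_nat (N div 6) :: complex)" by simp
  define Z where "Z = {z \<in> fund_interior. H z = 0}"
  have ImZ: "Im z < T" if "z \<in> Z" for z
    using top[of z] that by (force simp: Z_def fund_interior_def)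
  have Im_half: "Im z > 1/2" if "z \<in> fund_interior" for z
  proof (rule ccontr)
    assume "\<not> Im z > 1/2"
    then have "(Im z)\<^sup>2 \<le> (1/2)\<^sup>2" "(Re z)\<^sup>2 \<le> (1/2)\<^sup>2" using that
      by (intro power2_le_iff_abs_le[THEN iffD2]; simp add: fund_interior_def)+
    then have "(cmod z)\<^sup>2 < 1" unfolding cmod_power2 by (simp add: power2_eq_square)
    then show False using that by (simp add: fund_interior_def power_less_one_iff abs_square_less_1)
  qed
  have Zsub: "Z \<subseteq> {z \<in> S. H z = 0}"
  proof
    fix z assume z: "z \<in> Z"
    then have "z \<in> fund_interior" "H z = 0" by (auto simp: Z_def)
    moreover have "z \<in> S" using ImZ[OF z] Im_half[OF \<open>z \<in> fund_interior\<close>] \<open>z \<in> fund_interior\<close>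
      by (auto simp: S_def in_box_complex_iff fund_interior_def abs_less_iff)
    ultimately show "z \<in> {z \<in> S. H z = 0}" by simp
  qed
  have "(\<Sum>p | p \<in> S \<and> H p = 0. winding_number \<gamma> p * of_int (zorder H p))
      = (\<Sum>p\<in>Z. winding_number \<gamma> p * of_int (zorder H p))"
  proof (rule sum.mono_neutral_right[OF finS Zsub], rule ballI)
    fix p assume p: "p \<in> {z \<in> S. H z = 0} - Z"
    then have pi: "p \<notin> fund_interior" "H p = 0" "p \<in> S" by (auto simp: Z_def)
    have off: "p \<notin> path_image \<gamma>" using onpath pi by auto
    have "cmod p < 1 \<or> p \<notin> cbox left_corner (Complex (1/2) T)"
    proof (rule disjCI)
      assume "\<not> p \<notin> cbox left_corner (Complex (1/2) T)"
      then have c: "\<bar>Re p\<bar> \<le> 1/2" "sqrt 3 / 2 \<le> Im p" "Im p \<le> T"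
        by (auto simp: in_cbox_complex_iff abs_le_iff)
      have pos: "Im p > 0" using c sqrt3_bounds by linarith
      have "\<bar>Re p\<bar> \<noteq> 1/2"
        using off c unfolding \<gamma>_def path_image_boundary_path path_image_upper_path[OF T] by blast
      then have "\<bar>Re p\<bar> < 1/2" using c by simp
      then have "cmod p \<le> 1" using pi pos by (auto simp: fund_interior_def)
      moreover have "cmod p \<noteq> 1" using arc[of p] pos c pi by auto
      ultimately show "cmod p < 1" by simp
    qed
    then show "winding_number \<gamma> p * of_int (zorder H p) = 0"
      unfolding \<gamma>_def by (simp add: winding_number_boundary_path_outside[OF T])
  qed
  also have "\<dots> = (\<Sum>p\<in>Z. of_int (zorder H p))"
    by (rule sum.cong) (use ImZ in \<open>auto simp: \<gamma>_def Z_def winding_number_boundary_path_inside[OF T]\<close>)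
  finally have "of_int (\<Sum>p\<in>Z. zorder H p) = (of_int (int (N div 6)) :: complex)"
    unfolding total by simp
  then have "(\<Sum>p\<in>Z. zorder H p) = int (N div 6)" by (simp only: of_int_eq_iff)
  then show "(\<Sum>z | z \<in> fund_interior \<and> H z = 0. zorder H z) = int (N div 6)" by (simp add: Z_def)
  show "finite {z \<in> fund_interior. H z = 0}"
    using finite_subset[OF Zsub finS] by (simp add: Z_def)
qed

section \<open>Orders of zeros under translation, inversion and perturbation\<close>

lemma eventually_nonzero:
  assumes "H holomorphic_on upper_half_plane" "\<beta> \<in> upper_half_plane" "H \<beta> \<noteq> 0" "z \<in> upper_half_plane"
  shows "\<forall>\<^sub>F w in at z. H w \<noteq> 0 \<and> w \<in> upper_half_plane"
  by (rule non_zero_neighbour_alt[OF assms(1) open_upper_half_plane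
        convex_connected[OF convex_upper_half_plane] assms(4,2,3)])

lemma zorder_pos:
  assumes "H holomorphic_on upper_half_plane" "\<beta> \<in> upper_half_plane" "H \<beta> \<noteq> 0"
    "z \<in> upper_half_plane" "H z = 0"
  shows "zorder H z > 0"
proof -
  have "\<forall>\<^sub>F w in at z. H w \<noteq> 0"
    using eventually_nonzero[OF assms(1-4)] by (rule eventually_mono) simp
  then have "\<exists>\<^sub>F w in at z. H w \<noteq> 0" by (rule eventually_frequently[rotated]) simp
  then show ?thesis using zorder_pos_iff[OF assms(1) open_upper_half_plane assms(4)] assms(5) by simp
qed

lemma zorder_translate:
  assumes "z \<in> upper_half_plane" "\<And>z. z \<in> upper_half_plane \<Longrightarrow> H (z + 1) = H z"
  shows "zorder H (z + 1) = zorder H z"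
proof -
  have "zorder H (z + 1) = zorder (\<lambda>u. H (u + z + 1)) 0"
    by (subst zorder_shift) (simp add: add.assoc)
  also have "\<dots> = zorder (\<lambda>u. H (u + z)) 0"
  proof (rule zorder_cong)
    have "\<forall>\<^sub>F u in nhds 0. u + z \<in> upper_half_plane"
      by (rule eventually_compose_filterlim[of _ "nhds z"])
         (use assms(1) open_upper_half_plane in \<open>auto intro!: eventually_nhds_in_open tendsto_eq_intros filterlim_ident\<close>)
    then have "\<forall>\<^sub>F u in at 0. u + z \<in> upper_half_plane" by (simp add: eventually_nhds_conv_at)
    then show "\<forall>\<^sub>F u in at 0. H (u + z + 1) = H (u + z)"
      by (rule eventually_mono) (rule assms(2))
  qed simp
  also have "\<dots> = zorder H z" by (rule zorder_shift[symmetric])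
  finally show ?thesis .
qed

lemma zorder_inversion:
  assumes H: "H holomorphic_on upper_half_plane" "\<beta> \<in> upper_half_plane" "H \<beta> \<noteq> 0"
    and z: "z \<in> upper_half_plane"
    and inv: "\<And>z. z \<in> upper_half_plane \<Longrightarrow> H (- 1 / z) = z ^ K * H z"
  shows "zorder H (- 1 / z) = zorder H z"
proof -
  define u where "u = - 1 / z"
  have u: "u \<in> upper_half_plane" unfolding u_def by (rule Im_neg_inverse_pos[OF z])
  have z0: "z \<noteq> 0" using z by (auto simp: upper_half_plane_def)
  have "\<exists>w\<in>upper_half_plane. H w \<noteq> 0" using H by blast
  note ex = zorder_exist_zero[OF H(1) open_upper_half_plane
      convex_connected[OF convex_upper_half_plane] u this]
  have n: "zorder H u \<ge> 0" using conjunct1[OF ex] by (simp split: if_splits)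
  obtain r where r: "r > 0" "cball u r \<subseteq> upper_half_plane" "zor_poly H u holomorphic_on cball u r"
    "\<And>w. w \<in> cball u r \<Longrightarrow> H w = zor_poly H u w * (w - u) ^ nat (zorder H u) \<and> zor_poly H u w \<noteq> 0"
    using conjunct2[OF ex] by blast
  define g where "g = zor_poly H u"
  define n where "n = nat (zorder H u)"
  define S where "S = upper_half_plane \<inter> (\<lambda>w. - 1 / w) -` ball u r"
  have cont: "continuous_on upper_half_plane (\<lambda>w. - 1 / w)"
    by (intro continuous_intros) (auto simp: upper_half_plane_def)
  have S: "open S" unfolding S_def
    by (rule continuous_open_preimage[OF cont open_upper_half_plane open_ball])
  show "zorder H u = zorder H z"
  proof (rule sym, rule zorder_eqI[OF S])
    show "z \<in> S" using z r by (simp add: S_def u_def)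
    have nz: "w \<noteq> 0" if "w \<in> S" for w using that by (auto simp: S_def upper_half_plane_def)
    \<comment> \<open>From \<open>- 1/w - u = (w - z)/(wz)\<close>: the local factor of \<open>H\<close> at \<open>u\<close> yields that at \<open>z\<close>.\<close>
    show "(\<lambda>w. g (- 1 / w) / (w ^ K * (w * z) ^ n)) holomorphic_on S"
    proof (intro holomorphic_intros)
      show "(\<lambda>w. g (- 1 / w)) holomorphic_on S"
      proof (rule holomorphic_on_compose_gen[of "\<lambda>w. - 1 / w" S g "cball u r", unfolded o_def])
        show "(\<lambda>w. - 1 / w) holomorphic_on S" using nz by (intro holomorphic_intros) auto
      qed (use r in \<open>auto simp: g_def S_def\<close>)
    qed (use nz z0 in auto)
    show "g (- 1 / z) / (z ^ K * (z * z) ^ n) \<noteq> 0"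
      using r(4)[of u] r(1) z0 by (auto simp: g_def u_def)
    fix w assume w: "w \<in> S" "w \<noteq> z"
    have wH: "w \<in> upper_half_plane" and wb: "- 1 / w \<in> cball u r" using w by (auto simp: S_def)
    have "w ^ K * H w = g (- 1 / w) * (- 1 / w - u) ^ n"
      using r(4)[OF wb] inv[OF wH] by (simp add: g_def n_def)
    also have "- 1 / w - u = (w - z) / (w * z)"
      using nz[OF w(1)] z0 by (simp add: u_def field_simps)
    finally have "H w = (g (- 1 / w) * ((w - z) / (w * z)) ^ n) / w ^ K"
      using nz[OF w(1)] by (simp only: eq_divide_eq power_not_zero) (simp add: mult.commute)
    then have "H w = g (- 1 / w) / (w ^ K * (w * z) ^ n) * (w - z) ^ n"
      by (simp add: power_divide mult_ac)
    then show "H w = g (- 1 / w) / (w ^ K * (w * z) ^ n) * (w - z) powi zorder H u"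
      using n by (simp add: n_def power_int_def)
  qed
qed

definition zcount :: "(complex \<Rightarrow> complex) \<Rightarrow> complex set \<Rightarrow> int" where
  "zcount H A = (\<Sum>w | w \<in> A \<and> H w = 0. zorder H w)"

text \<open>Rouche's theorem on a circle around \<open>z0\<close> that encloses no other zero of \<open>f\<close>; on it
  \<open>\<bar>f\<bar>\<close> has a positive minimum and \<open>\<bar>g\<bar>\<close> a maximum.\<close>
lemma zeros_of_perturbation:
  assumes f: "f holomorphic_on upper_half_plane" "\<beta> \<in> upper_half_plane" "f \<beta> \<noteq> 0"
    and g: "g holomorphic_on upper_half_plane"
    and z0: "z0 \<in> upper_half_plane" "f z0 = 0" and \<delta>: "\<delta> > 0"
  shows "\<exists>r. 0 < r \<and> r < \<delta> \<and> ball z0 r \<subseteq> upper_half_plane \<and>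
     (\<forall>\<^sub>F \<epsilon> in at_right (0::real).
        finite {w \<in> ball z0 r. f w + \<i> * of_real \<epsilon> * g w = 0} \<and>
        zcount (\<lambda>w. f w + \<i> * of_real \<epsilon> * g w) (ball z0 r) = zorder f z0)"
proof -
  obtain r1 where r1: "r1 > 0" "\<And>w. w \<noteq> z0 \<Longrightarrow> dist w z0 < r1 \<Longrightarrow> f w \<noteq> 0 \<and> w \<in> upper_half_plane"
    using eventually_nonzero[OF f z0(1)] unfolding eventually_at by auto
  define r where "r = min r1 \<delta> / 2"
  have r: "0 < r" "r < \<delta>" "2 * r \<le> r1" using r1 \<delta> by (auto simp: r_def)
  define s where "s = ball z0 (3/2 * r)"
  have s_sub: "cball z0 (3/2 * r) \<subseteq> upper_half_plane"
  proof
    fix w assume "w \<in> cball z0 (3/2 * r)"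
    then have "dist w z0 < r1" using r by (simp add: dist_commute)
    then show "w \<in> upper_half_plane" using r1(2)[of w] z0 by (cases "w = z0") auto
  qed
  have ball_sub: "ball z0 r \<subseteq> upper_half_plane" using s_sub r by (auto simp: subset_iff)
  have ssub: "s \<subseteq> upper_half_plane" using s_sub by (auto simp: s_def)
  have fnz: "f w \<noteq> 0" if "w \<in> cball z0 (3/2 * r)" "w \<noteq> z0" for w
    using that r1(2)[of w] r by (simp add: dist_commute)
  have sph: "sphere z0 r \<subseteq> cball z0 (3/2 * r)" "z0 \<notin> sphere z0 r" using r by auto
  have contf: "continuous_on (sphere z0 r) (\<lambda>w. cmod (f w))" and contg: "continuous_on (sphere z0 r) (\<lambda>w. cmod (g w))"
    using sph s_sub by (auto intro!: continuous_on_norm holomorphic_on_imp_continuous_on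
        holomorphic_on_subset[OF f(1)] holomorphic_on_subset[OF g])
  have ne: "sphere z0 r \<noteq> {}" using r by simp
  obtain x where x: "x \<in> sphere z0 r" "\<And>w. w \<in> sphere z0 r \<Longrightarrow> cmod (f x) \<le> cmod (f w)"
    using continuous_attains_inf[OF compact_sphere ne contf] by blast
  obtain y where y: "y \<in> sphere z0 r" "\<And>w. w \<in> sphere z0 r \<Longrightarrow> cmod (g w) \<le> cmod (g y)"
    using continuous_attains_sup[OF compact_sphere ne contg] by blast
  have fx: "cmod (f x) > 0" using fnz[of x] x sph by auto
  \<comment> \<open>The summand 1 covers the case that \<open>g\<close> vanishes on the circle.\<close>
  define e0 where "e0 = cmod (f x) / (cmod (g y) + 1)"
  have e0: "e0 > 0" using fx by (auto simp: e0_def intro!: divide_pos_pos add_nonneg_pos)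
  have main: "finite {w \<in> ball z0 r. f w + \<i> * of_real \<epsilon> * g w = 0} \<and>
        zcount (\<lambda>w. f w + \<i> * of_real \<epsilon> * g w) (ball z0 r) = zorder f z0"
    if \<epsilon>: "0 < \<epsilon>" "\<epsilon> < e0" for \<epsilon>
  proof -
    define G where "G = (\<lambda>w. \<i> * of_real \<epsilon> * g w)"
    define F where "F = (\<lambda>w. f w + G w)"
    have G: "G holomorphic_on upper_half_plane" unfolding G_def by (intro holomorphic_intros g)
    have F: "F holomorphic_on upper_half_plane" unfolding F_def by (intro holomorphic_intros f G)
    have less: "cmod (G w) < cmod (f w)" if "w \<in> sphere z0 r" for w
    proof -
      have "cmod (G w) = \<epsilon> * cmod (g w)" using \<epsilon> by (simp add: G_def norm_mult)
      also have "\<dots> \<le> \<epsilon> * (cmod (g y) + 1)" using y(2)[OF that] \<epsilon> by (intro mult_left_mono) auto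
      also have "\<dots> < e0 * (cmod (g y) + 1)" using \<epsilon> by (intro mult_strict_right_mono) (auto intro: add_nonneg_pos)
      also have "\<dots> = cmod (f x)" by (simp add: e0_def add_nonneg_eq_0_iff)
      also have "\<dots> \<le> cmod (f w)" by (rule x(2)[OF that])
      finally show ?thesis .
    qed
    have Fsph: "F w \<noteq> 0" if "w \<in> sphere z0 r" for w
      using less[OF that] norm_minus_cancel[of "G w"] by (auto simp: F_def add_eq_0_iff2)
    have "finite {w \<in> cball z0 (3/2 * r). F w = 0}"
      by (rule finite_zeros_compact[OF F _ Fsph[OF x(1)]]) (use x sph s_sub in auto)
    then have finF: "finite {w \<in> s. F w = 0}" by (rule rev_finite_subset) (auto simp: s_def)
    have zf: "{w \<in> s. f w = 0} = {z0}"
    proof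
      show "{w \<in> s. f w = 0} \<subseteq> {z0}"
      proof
        fix w assume "w \<in> {w \<in> s. f w = 0}"
        then have "w \<in> cball z0 (3/2 * r)" "f w = 0" by (auto simp: s_def)
        then show "w \<in> {z0}" using fnz by blast
      qed
      show "{z0} \<subseteq> {w \<in> s. f w = 0}" using z0 r by (simp add: s_def)
    qed
    have w1: "winding_number (circlepath z0 r) p = 1" if "p \<in> ball z0 r" for p
      using that by (intro winding_number_circlepath) (simp add: dist_norm norm_minus_commute)
    have w0: "winding_number (circlepath z0 r) p = 0" if "p \<notin> cball z0 r" for p
      by (rule winding_number_zero_outside[OF _ convex_cball _ that]) (use r in auto)
    have R: "(\<Sum>p\<in>{p \<in> s. f p + G p = 0}. winding_number (circlepath z0 r) p * of_int (zorder (\<lambda>p. f p + G p) p))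
        = (\<Sum>p\<in>{p \<in> s. f p = 0}. winding_number (circlepath z0 r) p * of_int (zorder f p))"
    proof (rule Rouche_theorem)
      show "f holomorphic_on s" "G holomorphic_on s"
        using f(1) G ssub holomorphic_on_subset by blast+
      show "finite {p \<in> s. f p + G p = 0}" using finF by (simp add: F_def)
      show "finite {p \<in> s. f p = 0}" by (simp add: zf)
      show "path_image (circlepath z0 r) \<subseteq> s" using r by (auto simp: s_def)
      show "\<forall>z\<in>path_image (circlepath z0 r). cmod (G z) < cmod (f z)" using less r by auto
      show "\<forall>z. z \<notin> s \<longrightarrow> winding_number (circlepath z0 r) z = 0"
        using w0 r by (auto simp: s_def)
    qed (auto simp: s_def)
    have "of_int (zorder f z0) = (\<Sum>p\<in>{p \<in> s. f p = 0}. winding_number (circlepath z0 r) p * of_int (zorder f p))"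
      using w1[of z0] r by (simp add: zf)
    also have "\<dots> = (\<Sum>p\<in>{p \<in> s. F p = 0}. winding_number (circlepath z0 r) p * of_int (zorder F p))"
      using R unfolding F_def by (rule sym)
    also have "\<dots> = (\<Sum>p | p \<in> ball z0 r \<and> F p = 0. winding_number (circlepath z0 r) p * of_int (zorder F p))"
    proof (rule sum.mono_neutral_right[OF finF])
      show "{p. p \<in> ball z0 r \<and> F p = 0} \<subseteq> {w \<in> s. F w = 0}" using r by (auto simp: s_def)
      show "\<forall>p\<in>{w \<in> s. F w = 0} - {p. p \<in> ball z0 r \<and> F p = 0}.
          winding_number (circlepath z0 r) p * of_int (zorder F p) = 0"
      proof
        fix p assume "p \<in> {w \<in> s. F w = 0} - {p. p \<in> ball z0 r \<and> F p = 0}"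
        then have "p \<notin> ball z0 r" "p \<notin> sphere z0 r" using Fsph by auto
        then show "winding_number (circlepath z0 r) p * of_int (zorder F p) = 0"
          using w0[of p] by auto
      qed
    qed
    also have "\<dots> = (\<Sum>p | p \<in> ball z0 r \<and> F p = 0. of_int (zorder F p))"
      by (rule sum.cong) (auto simp: w1)
    also have "\<dots> = of_int (zcount F (ball z0 r))" by (simp add: zcount_def)
    finally have "zorder f z0 = zcount F (ball z0 r)" by (simp only: of_int_eq_iff)
    moreover have "finite {w \<in> ball z0 r. F w = 0}"
      by (rule rev_finite_subset[OF finF]) (use r in \<open>auto simp: s_def\<close>)
    ultimately show ?thesis by (simp add: F_def G_def)
  qed
  then have "\<forall>\<^sub>F \<epsilon> in at_right 0. finite {w \<in> ball z0 r. f w + \<i> * of_real \<epsilon> * g w = 0} \<and>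
        zcount (\<lambda>w. f w + \<i> * of_real \<epsilon> * g w) (ball z0 r) = zorder f z0"
    unfolding eventually_at_right_field using e0 by (intro exI[of _ e0]) auto
  then show ?thesis using r ball_sub by blast
qed

text \<open>Each zero in \<open>D\<close> is either counted in \<open>A\<close> or moved into \<open>B\<close> by an injective map that preserves
  orders.\<close>
lemma zcount_le_transfer:
  assumes fin: "finite {w \<in> D. H w = 0}" "finite {w \<in> A. H w = 0}" "finite {w \<in> B. H w = 0}"
    and nn: "\<And>w. w \<in> A \<union> B \<Longrightarrow> H w = 0 \<Longrightarrow> zorder H w \<ge> 0"
    and inj: "inj_on \<phi> D"
    and D: "\<And>w. w \<in> D \<Longrightarrow> H w = 0 \<Longrightarrow> w \<in> A \<or> \<phi> w \<in> B \<and> H (\<phi> w) = 0 \<and> zorder H (\<phi> w) = zorder H w"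
  shows "zcount H D \<le> zcount H A + zcount H B"
proof -
  define X where "X = {w \<in> D. H w = 0}"
  have "zcount H D = sum (zorder H) (X \<inter> A) + sum (zorder H) (X - A)"
    unfolding zcount_def X_def[symmetric] Collect_conj_eq
    by (subst sum.Int_Diff[of X _ A]) (use fin in \<open>auto simp: X_def\<close>)
  also have "sum (zorder H) (X \<inter> A) \<le> zcount H A"
    unfolding zcount_def by (rule sum_mono2) (use fin nn in \<open>auto simp: X_def\<close>)
  also have "sum (zorder H) (X - A) = sum (\<lambda>w. zorder H (\<phi> w)) (X - A)"
  proof (rule sum.cong)
    fix w assume "w \<in> X - A"
    then show "zorder H w = zorder H (\<phi> w)" using D[of w] unfolding X_def by auto
  qed simp
  also have "\<dots> = sum (zorder H) (\<phi> ` (X - A))"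
    by (rule sum.reindex[symmetric, unfolded o_def]) (use inj in \<open>auto simp: X_def inj_on_def\<close>)
  also have "\<dots> \<le> zcount H B"
    unfolding zcount_def by (rule sum_mono2) (use fin nn D in \<open>auto simp: X_def\<close>)
  finally show ?thesis by simp
qed

section \<open>Perturbing the sixth power of a form\<close>

text \<open>The sixth power serves two purposes: \<open>f^6 \<ge> 0\<close> where \<open>f\<close> is real, and the weight becomes a
  multiple of 12, so that a power of \<open>boundary_form\<close> has the same weight \<open>12n\<close>.\<close>
definition perturbed :: "(complex \<Rightarrow> complex) \<Rightarrow> nat \<Rightarrow> real \<Rightarrow> complex \<Rightarrow> complex" where
  "perturbed f n \<epsilon> = (\<lambda>z. f z ^ 6 + \<i> * of_real \<epsilon> * boundary_form z ^ n)"

lemma Im_real_add_i_pos: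
  assumes "x \<in> \<real>" "y \<in> \<real>" "Re y > 0" "\<epsilon> > 0"
  shows "Im (x ^ 6 + \<i> * of_real \<epsilon> * y ^ n) > 0"
proof -
  obtain a b where "x = of_real a" "y = of_real b" using assms(1,2) by (auto elim!: Reals_cases)
  then have "Im (x ^ 6 + \<i> * of_real \<epsilon> * y ^ n) = \<epsilon> * b ^ n" "b > 0"
    using assms(3) by (simp_all flip: of_real_power)
  then show ?thesis using assms(4) by simp
qed

lemma perturbed_on_arc:
  assumes f: "real_form (2 * n) f" and "\<epsilon> > 0" and z: "Im z > 0" "cmod z = 1" "\<bar>Re z\<bar> \<le> 1/2"
  shows "Im (z ^ (6 * n) * perturbed f n \<epsilon> z) > 0"
proof -
  have zH: "z \<in> upper_half_plane" using z by (simp add: upper_half_plane_def)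
  have "z ^ n * f z \<in> \<real>" by (rule real_form_circle[OF f zH z(2)])
  moreover have "z ^ 6 * boundary_form z \<in> \<real>"
    using real_form_circle[of 6 boundary_form z] real_form_boundary_form zH z(2) by simp
  moreover have "Re (z ^ 6 * boundary_form z) > 0" by (rule boundary_form_pos_circle[OF z])
  ultimately have "Im ((z ^ n * f z) ^ 6 + \<i> * of_real \<epsilon> * (z ^ 6 * boundary_form z) ^ n) > 0"
    by (rule Im_real_add_i_pos) (rule \<open>\<epsilon> > 0\<close>)
  also have "(z ^ n * f z) ^ 6 + \<i> * of_real \<epsilon> * (z ^ 6 * boundary_form z) ^ n
      = z ^ (6 * n) * perturbed f n \<epsilon> z"
  proof -
    have "z ^ (6 * n) = (z ^ n) ^ 6" "z ^ (6 * n) = (z ^ 6) ^ n"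
      by (simp_all add: mult.commute flip: power_mult)
    then show ?thesis
      by (simp only: perturbed_def distrib_left power_mult_distrib) (simp add: mult_ac)
  qed
  finally show ?thesis .
qed

lemma perturbed_on_line:
  assumes f: "real_form (2 * n) f" and "\<epsilon> > 0" and z: "Im z > 0" "cmod z \<ge> 1" "\<bar>Re z\<bar> = 1/2"
  shows "Im (perturbed f n \<epsilon> z) > 0"
proof -
  have zH: "z \<in> upper_half_plane" using z by (simp add: upper_half_plane_def)
  show ?thesis unfolding perturbed_def
    by (intro Im_real_add_i_pos real_form_line[OF f zH z(3)] boundary_form_pos_line[OF z] \<open>\<epsilon> > 0\<close>
          real_form_line[OF real_form_boundary_form zH z(3)])
qed

lemma perturbed_holomorphic:
  "real_form (2 * n) f \<Longrightarrow> perturbed f n \<epsilon> holomorphic_on upper_half_plane"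
  unfolding perturbed_def
  by (intro holomorphic_intros real_formD(1)[OF real_form_boundary_form]) (rule real_formD(1))

lemma perturbed_nonzero_i:
  assumes "real_form (2 * n) f" "\<epsilon> > 0"
  shows "\<i> \<in> upper_half_plane" "perturbed f n \<epsilon> \<i> \<noteq> 0"
proof -
  show "\<i> \<in> upper_half_plane" by (simp add: upper_half_plane_def)
  have "Im (\<i> ^ (6 * n) * perturbed f n \<epsilon> \<i>) > 0" by (rule perturbed_on_arc[OF assms]) auto
  then show "perturbed f n \<epsilon> \<i> \<noteq> 0" by (metis less_irrefl mult_zero_right zero_complex.simps(2))
qed

lemma perturbed_symmetries:
  assumes f: "real_form (2 * n) f" and z: "z \<in> upper_half_plane"
  shows "perturbed f n \<epsilon> (z + 1) = perturbed f n \<epsilon> z"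
    and "perturbed f n \<epsilon> (- 1 / z) = z ^ (12 * n) * perturbed f n \<epsilon> z"
proof -
  show "perturbed f n \<epsilon> (z + 1) = perturbed f n \<epsilon> z"
    using real_formD(2)[OF f z] real_formD(2)[OF real_form_boundary_form z] by (simp add: perturbed_def)
  have "perturbed f n \<epsilon> (- 1 / z) = (z ^ (2 * n) * f z) ^ 6 + \<i> * of_real \<epsilon> * (z ^ 12 * boundary_form z) ^ n"
    unfolding perturbed_def real_formD(3)[OF f z] real_formD(3)[OF real_form_boundary_form z] ..
  also have "\<dots> = z ^ (12 * n) * perturbed f n \<epsilon> z"
  proof -
    have "z ^ (12 * n) = (z ^ (2 * n)) ^ 6" "z ^ (12 * n) = (z ^ 12) ^ n"
      by (simp_all add: mult.commute flip: power_mult)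
    then show ?thesis
      by (simp only: perturbed_def distrib_left power_mult_distrib) (simp add: mult_ac)
  qed
  finally show "perturbed f n \<epsilon> (- 1 / z) = z ^ (12 * n) * perturbed f n \<epsilon> z" .
qed

text \<open>At the cusp \<open>f^6\<close> tends to 1 and the perturbation to an imaginary number, so the real part
  becomes positive.\<close>
lemma perturbed_count:
  assumes f: "real_form (2 * n) f" "(f \<longlongrightarrow> 1) at_cusp" and \<epsilon>: "\<epsilon> > 0"
  shows "finite {z \<in> fund_interior. perturbed f n \<epsilon> z = 0}"
    and "zcount (perturbed f n \<epsilon>) fund_interior = int n"
proof -
  have "((\<lambda>z. Re (f z ^ 6 + \<i> * of_real \<epsilon> * boundary_form z ^ n))
      \<longlongrightarrow> Re (1 ^ 6 + \<i> * of_real \<epsilon> * 9999 ^ n)) at_cusp"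
    by (intro tendsto_intros f boundary_form_tendsto)
  moreover have "Re (1 ^ 6 + \<i> * of_real \<epsilon> * 9999 ^ n) = 1"
  proof -
    have "(9999 :: complex) ^ n = of_real (9999 ^ n)" by simp
    then show ?thesis by (simp only: power_one plus_complex.simps one_complex.simps) simp
  qed
  ultimately have "\<forall>\<^sub>F z in at_cusp. Re (perturbed f n \<epsilon> z) > 0"
    unfolding perturbed_def by (intro order_tendstoD(1)[of _ 1]) auto
  note count = zero_count_interior[OF perturbed_holomorphic[OF f(1)] _ perturbed_on_arc[OF f(1) \<epsilon>]
      perturbed_on_line[OF f(1) \<epsilon>] this]
  show "finite {z \<in> fund_interior. perturbed f n \<epsilon> z = 0}" by (rule count(1)) simp_all
  show "zcount (perturbed f n \<epsilon>) fund_interior = int n"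
    unfolding zcount_def by (subst count(2)) simp_all
qed

lemma zorder_power_6:
  assumes f: "f holomorphic_on upper_half_plane" "\<beta> \<in> upper_half_plane" "f \<beta> \<noteq> 0"
    and z: "z \<in> upper_half_plane"
  shows "zorder (\<lambda>z. f z ^ 6) z = 6 * zorder f z"
proof -
  have "\<forall>\<^sub>F w in at z. f w \<noteq> 0"
    using eventually_nonzero[OF f z] by (rule eventually_mono) simp
  then have fr: "\<exists>\<^sub>F w in at z. f w \<noteq> 0" by (rule eventually_frequently[rotated]) simp
  have "f analytic_on {z}" using f(1) z open_upper_half_plane by (auto simp: analytic_at)
  then have "f meromorphic_on {z}" by (rule analytic_on_imp_meromorphic_on)
  then show ?thesis using zorder_power[of f z 6] fr by simp
qed

lemma form_nonzero_somewhere: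
  assumes "(f \<longlongrightarrow> (1::complex)) at_cusp"
  shows "\<exists>\<beta>\<in>upper_half_plane. f \<beta> \<noteq> 0"
proof -
  have "\<forall>\<^sub>F z in at_cusp. f z \<noteq> 0" using tendsto_imp_eventually_ne[OF assms, of 0] by simp
  then obtain T where T: "\<And>z. Im z \<ge> T \<Longrightarrow> \<bar>Re z\<bar> \<le> 1/2 \<Longrightarrow> f z \<noteq> 0"
    unfolding eventually_at_cusp by blast
  have "f (Complex 0 (max T 1)) \<noteq> 0" by (rule T) auto
  then show ?thesis by (intro bexI[of _ "Complex 0 (max T 1)"]) (auto simp: upper_half_plane_def)
qed

context
  fixes f :: "complex \<Rightarrow> complex" and n :: nat
  assumes f: "real_form (2 * n) f" and f1: "(f \<longlongrightarrow> 1) at_cusp"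
begin

lemma near_zero:
  assumes z0: "z0 \<in> upper_half_plane" "f z0 = 0" and \<delta>: "\<delta> > 0"
  shows "\<exists>r. 0 < r \<and> r < \<delta> \<and> ball z0 r \<subseteq> upper_half_plane \<and>
     (\<forall>\<^sub>F \<epsilon> in at_right 0. finite {w \<in> ball z0 r. perturbed f n \<epsilon> w = 0} \<and>
        zcount (perturbed f n \<epsilon>) (ball z0 r) = 6 * zorder f z0)"
proof -
  obtain \<beta> where \<beta>: "\<beta> \<in> upper_half_plane" "f \<beta> \<noteq> 0" using form_nonzero_somewhere[OF f1] by blast
  have h: "(\<lambda>z. f z ^ 6) holomorphic_on upper_half_plane"
      "(\<lambda>z. boundary_form z ^ n) holomorphic_on upper_half_plane"
    by (intro holomorphic_intros real_formD(1)[OF f] real_formD(1)[OF real_form_boundary_form])+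
  show ?thesis
    using zeros_of_perturbation[OF h(1) \<beta>(1) _ h(2) z0(1) _ \<delta>] \<beta>(2) z0(2)
    unfolding perturbed_def zorder_power_6[OF real_formD(1)[OF f] \<beta> z0(1)] by simp
qed

lemma interior_zeros_finite_nonneg:
  assumes "\<epsilon> > 0"
  shows "finite {w \<in> fund_interior \<inter> A. perturbed f n \<epsilon> w = 0}"
    and "w \<in> fund_interior \<Longrightarrow> perturbed f n \<epsilon> w = 0 \<Longrightarrow> zorder (perturbed f n \<epsilon>) w \<ge> 0"
proof -
  show "finite {w \<in> fund_interior \<inter> A. perturbed f n \<epsilon> w = 0}"
    by (rule rev_finite_subset[OF perturbed_count(1)[OF f f1 assms]]) auto
  show "zorder (perturbed f n \<epsilon>) w \<ge> 0" if "w \<in> fund_interior" "perturbed f n \<epsilon> w = 0"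
    using zorder_pos[OF perturbed_holomorphic[OF f] perturbed_nonzero_i[OF f assms], of w] that
    by (simp add: fund_interior_def upper_half_plane_def)
qed

lemma local_count_interior:
  assumes z0: "z0 \<in> fund_interior" "f z0 = 0" and \<delta>: "\<delta> > 0"
  shows "\<forall>\<^sub>F \<epsilon> in at_right 0. 6 * zorder f z0 \<le> zcount (perturbed f n \<epsilon>) (fund_interior \<inter> ball z0 \<delta>)"
proof -
  have "fund_interior = {z. Im z > 0} \<inter> {z. cmod z > 1} \<inter> {z. Re z < 1/2} \<inter> {z. Re z > - 1/2}"
    by (auto simp: fund_interior_def abs_less_iff)
  also have "open \<dots>"
    by (intro open_Int open_halfspace_Im_gt open_halfspace_Re_lt open_halfspace_Re_gt
          open_Collect_less continuous_intros)
  finally obtain e where e: "e > 0" "ball z0 e \<subseteq> fund_interior"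
    using z0(1) open_contains_ball by blast
  have "z0 \<in> upper_half_plane" using z0 by (simp add: fund_interior_def upper_half_plane_def)
  then obtain r where r: "0 < r" "r < min e \<delta>"
    and ev: "\<forall>\<^sub>F \<epsilon> in at_right 0. finite {w \<in> ball z0 r. perturbed f n \<epsilon> w = 0} \<and>
        zcount (perturbed f n \<epsilon>) (ball z0 r) = 6 * zorder f z0"
    using near_zero[of z0 "min e \<delta>"] z0 \<delta> e by auto
  from ev eventually_at_right_less[of "0::real"] show ?thesis
  proof eventually_elim
    case (elim \<epsilon>)
    have "ball z0 r \<subseteq> fund_interior \<inter> ball z0 \<delta>" using r e by auto
    then have "zcount (perturbed f n \<epsilon>) (ball z0 r) \<le> zcount (perturbed f n \<epsilon>) (fund_interior \<inter> ball z0 \<delta>)"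
      unfolding zcount_def
      using interior_zeros_finite_nonneg(1)[of \<epsilon> "ball z0 \<delta>"] interior_zeros_finite_nonneg(2)[of \<epsilon>] elim(2)
      by (intro sum_mono2) auto
    then show ?case using elim by simp
  qed
qed

text \<open>Around a boundary zero \<open>z0\<close>, the zeros of the perturbed form avoid the boundary. Those on the
  inner side are counted near \<open>z0\<close>, those on the outer side are moved by the boundary
  identification \<open>\<phi>\<close> and counted near \<open>\<phi> z0\<close>.\<close>
lemma local_count_folded:
  assumes z0: "z0 \<in> upper_half_plane" "f z0 = 0" and \<delta>: "\<delta> > 0"
    and cont: "isCont \<phi> z0" and inj: "inj_on \<phi> upper_half_plane"
    and sym: "\<And>\<epsilon> w. \<epsilon> > 0 \<Longrightarrow> w \<in> upper_half_plane \<Longrightarrow> perturbed f n \<epsilon> w = 0 \<Longrightarrow>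
        perturbed f n \<epsilon> (\<phi> w) = 0 \<and> zorder (perturbed f n \<epsilon>) (\<phi> w) = zorder (perturbed f n \<epsilon>) w"
    and fold: "\<forall>\<^sub>F w in nhds z0. \<forall>\<epsilon>>0. perturbed f n \<epsilon> w = 0 \<longrightarrow> w \<in> fund_interior \<or> \<phi> w \<in> fund_interior"
  shows "\<forall>\<^sub>F \<epsilon> in at_right 0. 6 * zorder f z0 \<le> zcount (perturbed f n \<epsilon>) (fund_interior \<inter> ball z0 \<delta>)
             + zcount (perturbed f n \<epsilon>) (fund_interior \<inter> ball (\<phi> z0) \<delta>)"
proof -
  have "(\<phi> \<longlongrightarrow> \<phi> z0) (nhds z0)"
    using cont by (simp add: isCont_def tendsto_at_iff_tendsto_nhds)
  moreover have "\<phi> z0 \<in> ball (\<phi> z0) \<delta>" using \<delta> by (simp only: centre_in_ball)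
  ultimately have "\<forall>\<^sub>F w in nhds z0. \<phi> w \<in> ball (\<phi> z0) \<delta>"
    by (rule topological_tendstoD[OF _ open_ball])
  from eventually_conj[OF this fold] obtain e where e: "e > 0"
    "\<And>w. dist w z0 < e \<Longrightarrow> \<phi> w \<in> ball (\<phi> z0) \<delta> \<and>
        (\<forall>\<epsilon>>0. perturbed f n \<epsilon> w = 0 \<longrightarrow> w \<in> fund_interior \<or> \<phi> w \<in> fund_interior)"
    unfolding eventually_nhds_metric by blast
  obtain r where r: "0 < r" "r < min e \<delta>" "ball z0 r \<subseteq> upper_half_plane"
    and ev: "\<forall>\<^sub>F \<epsilon> in at_right 0. finite {w \<in> ball z0 r. perturbed f n \<epsilon> w = 0} \<and>
        zcount (perturbed f n \<epsilon>) (ball z0 r) = 6 * zorder f z0"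
    using near_zero[of z0 "min e \<delta>"] z0 \<delta> e by auto
  from ev eventually_at_right_less[of "0::real"] show ?thesis
  proof eventually_elim
    case (elim \<epsilon>)
    have "zcount (perturbed f n \<epsilon>) (ball z0 r) \<le> zcount (perturbed f n \<epsilon>) (fund_interior \<inter> ball z0 \<delta>)
             + zcount (perturbed f n \<epsilon>) (fund_interior \<inter> ball (\<phi> z0) \<delta>)"
    proof (rule zcount_le_transfer)
      show "inj_on \<phi> (ball z0 r)" using inj r(3) by (rule inj_on_subset)
      fix w assume w: "w \<in> ball z0 r" "perturbed f n \<epsilon> w = 0"
      then have "dist w z0 < e" "w \<in> ball z0 \<delta>" "w \<in> upper_half_plane"
        using r by (auto simp: dist_commute)
      then show "w \<in> fund_interior \<inter> ball z0 \<delta> \<or> \<phi> w \<in> fund_interior \<inter> ball (\<phi> z0) \<delta> \<and>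
          perturbed f n \<epsilon> (\<phi> w) = 0 \<and> zorder (perturbed f n \<epsilon>) (\<phi> w) = zorder (perturbed f n \<epsilon>) w"
        using e(2)[of w] sym[of \<epsilon> w] elim w(2) by auto
    next
      show "zorder (perturbed f n \<epsilon>) w \<ge> 0"
        if "w \<in> fund_interior \<inter> ball z0 \<delta> \<union> fund_interior \<inter> ball (\<phi> z0) \<delta>" "perturbed f n \<epsilon> w = 0" for w
        using interior_zeros_finite_nonneg(2)[of \<epsilon> w] elim(2) that by auto
    next
      show "finite {w \<in> fund_interior \<inter> ball z0 \<delta>. perturbed f n \<epsilon> w = 0}"
        "finite {w \<in> fund_interior \<inter> ball (\<phi> z0) \<delta>. perturbed f n \<epsilon> w = 0}"
        using elim(2) by (rule interior_zeros_finite_nonneg(1))+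
    qed (use elim in auto)
    then show ?case using elim by simp
  qed
qed

lemma local_count_arc:
  assumes z0: "z0 \<in> upper_half_plane" "f z0 = 0" "cmod z0 = 1" "\<bar>Re z0\<bar> < 1/2" and \<delta>: "\<delta> > 0"
  shows "\<forall>\<^sub>F \<epsilon> in at_right 0. 6 * zorder f z0 \<le> zcount (perturbed f n \<epsilon>) (fund_interior \<inter> ball z0 \<delta>)
             + zcount (perturbed f n \<epsilon>) (fund_interior \<inter> ball (- 1 / z0) \<delta>)"
proof (rule local_count_folded[OF z0(1,2) \<delta>])
  have nz: "z0 \<noteq> 0" using z0 by auto
  show cont: "isCont (\<lambda>w. - 1 / w) z0" using nz by (intro continuous_intros) auto
  show "inj_on (\<lambda>w. - 1 / w) upper_half_plane"
    by (auto simp: inj_on_def upper_half_plane_def divide_simps)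
  show "perturbed f n \<epsilon> (- 1 / w) = 0 \<and> zorder (perturbed f n \<epsilon>) (- 1 / w) = zorder (perturbed f n \<epsilon>) w"
    if "\<epsilon> > 0" "w \<in> upper_half_plane" "perturbed f n \<epsilon> w = 0" for \<epsilon> w
    using zorder_inversion[OF perturbed_holomorphic[OF f] perturbed_nonzero_i[OF f that(1)] that(2)
        perturbed_symmetries(2)[OF f]] perturbed_symmetries(2)[OF f that(2)] that(3) by simp
  have Re': "Re (- 1 / z0) = - Re z0" "Im z0 > 0"
    using cnj_unit[OF z0(3), symmetric] z0(1) by (simp_all add: upper_half_plane_def)
  have t: "((\<lambda>w. - 1 / w) \<longlongrightarrow> - 1 / z0) (nhds z0)"
    by (rule tendsto_at_iff_tendsto_nhds[THEN iffD1, OF cont[unfolded isCont_def]])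
  have 1: "\<forall>\<^sub>F w in nhds z0. \<bar>Re (- 1 / w)\<bar> < 1/2"
    by (rule order_tendstoD(2)[OF tendsto_rabs[OF tendsto_Re[OF t]]]) (use Re' z0 in simp)
  have 2: "\<forall>\<^sub>F w in nhds z0. \<bar>Re w\<bar> < 1/2"
    by (rule order_tendstoD(2)[OF tendsto_rabs[OF tendsto_Re[OF filterlim_ident]]]) (use z0 in simp)
  have 3: "\<forall>\<^sub>F w in nhds z0. w \<in> upper_half_plane"
    using z0(1) by (intro eventually_nhds_in_open open_upper_half_plane)
  from 1 2 3 show "\<forall>\<^sub>F w in nhds z0. \<forall>\<epsilon>>0. perturbed f n \<epsilon> w = 0 \<longrightarrow>
      w \<in> fund_interior \<or> - 1 / w \<in> fund_interior"
  proof eventually_elim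
    case (elim w)
    have Im: "Im w > 0" "Im (- 1 / w) > 0"
      using elim(3) Im_neg_inverse_pos[OF elim(3)] by (simp_all add: upper_half_plane_def)
    show ?case
    proof (intro allI impI)
      fix \<epsilon> :: real assume \<epsilon>: "\<epsilon> > 0" "perturbed f n \<epsilon> w = 0"
      have "cmod w \<noteq> 1" using perturbed_on_arc[OF f \<epsilon>(1) Im(1)] elim(2) \<epsilon>(2) by auto
      moreover have "cmod (- 1 / w) > 1" if "cmod w < 1" 
        using that Im by (auto simp: norm_divide divide_simps)
      ultimately show "w \<in> fund_interior \<or> - 1 / w \<in> fund_interior"
        using elim Im unfolding fund_interior_def by (cases "cmod w > 1") auto
    qed
  qed
qed

lemma local_count_line:
  assumes z0: "z0 \<in> upper_half_plane" "f z0 = 0" "cmod z0 > 1" "Re z0 = - 1/2" and \<delta>: "\<delta> > 0"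
  shows "\<forall>\<^sub>F \<epsilon> in at_right 0. 6 * zorder f z0 \<le> zcount (perturbed f n \<epsilon>) (fund_interior \<inter> ball z0 \<delta>)
             + zcount (perturbed f n \<epsilon>) (fund_interior \<inter> ball (z0 + 1) \<delta>)"
proof (rule local_count_folded[OF z0(1,2) \<delta>])
  show cont: "isCont (\<lambda>w. w + 1) z0" by (intro continuous_intros)
  show "inj_on (\<lambda>w. w + 1) upper_half_plane" by (auto simp: inj_on_def)
  show "perturbed f n \<epsilon> (w + 1) = 0 \<and> zorder (perturbed f n \<epsilon>) (w + 1) = zorder (perturbed f n \<epsilon>) w"
    if "\<epsilon> > 0" "w \<in> upper_half_plane" "perturbed f n \<epsilon> w = 0" for \<epsilon> w
    using zorder_translate[OF that(2), of "perturbed f n \<epsilon>", OF perturbed_symmetries(1)[OF f]]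
      perturbed_symmetries(1)[OF f that(2)] that(3) by simp
  have "z0 + 1 = - cnj z0" using z0 by (simp add: complex_eq_iff)
  then have "cmod (z0 + 1) = cmod z0" by simp
  then have "\<forall>\<^sub>F w in nhds z0. cmod (w + 1) > 1"
    using z0 by (intro order_tendstoD(1)[of _ "cmod (z0 + 1)"] tendsto_intros filterlim_ident) auto
  moreover have "\<forall>\<^sub>F w in nhds z0. cmod w > 1"
    using z0 by (intro order_tendstoD(1)[of _ "cmod z0"] tendsto_intros filterlim_ident) auto
  moreover have "\<forall>\<^sub>F w in nhds z0. Re w < 0"
    using z0 by (intro order_tendstoD(2)[of _ "Re z0"] tendsto_intros filterlim_ident) auto
  moreover have "\<forall>\<^sub>F w in nhds z0. Re w > - 1"
    using z0 by (intro order_tendstoD(1)[of _ "Re z0"] tendsto_intros filterlim_ident) auto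
  moreover have "\<forall>\<^sub>F w in nhds z0. w \<in> upper_half_plane"
    using z0(1) by (intro eventually_nhds_in_open open_upper_half_plane)
  ultimately show "\<forall>\<^sub>F w in nhds z0. \<forall>\<epsilon>>0. perturbed f n \<epsilon> w = 0 \<longrightarrow>
      w \<in> fund_interior \<or> w + 1 \<in> fund_interior"
  proof eventually_elim
    case (elim w)
    have Im: "Im w > 0" using elim by (simp add: upper_half_plane_def)
    show ?case
    proof (intro allI impI)
      fix \<epsilon> :: real assume \<epsilon>: "\<epsilon> > 0" "perturbed f n \<epsilon> w = 0"
      have "\<bar>Re w\<bar> \<noteq> 1/2" using perturbed_on_line[OF f \<epsilon>(1) Im] elim \<epsilon>(2) by auto
      then have "Re w \<noteq> - 1/2" by auto
      then have "\<bar>Re w\<bar> < 1/2 \<or> \<bar>Re w + 1\<bar> < 1/2" using elim(3,4) by arith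
      then have "\<bar>Re w\<bar> < 1/2 \<or> \<bar>Re (w + 1)\<bar> < 1/2" by simp
      then show "w \<in> fund_interior \<or> w + 1 \<in> fund_interior"
        using elim Im unfolding fund_interior_def by auto
    qed
  qed
qed

end

section \<open>The valence inequality\<close>

lemma finite_set_separated:
  fixes Q :: "'a::metric_space set"
  assumes "finite Q"
  shows "\<exists>\<delta>>0. \<forall>x\<in>Q. \<forall>y\<in>Q. x \<noteq> y \<longrightarrow> ball x \<delta> \<inter> ball y \<delta> = {}"
proof -
  define D where "D = insert 1 ((\<lambda>(x, y). dist x y) ` {(x, y) \<in> Q \<times> Q. x \<noteq> y})"
  have fin: "finite D" unfolding D_def using assms
    by (intro finite.insertI finite_imageI finite_subset[OF _ finite_cartesian_product[of Q Q]]) auto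
  have "Min D \<in> D" using fin by (intro Min_in) (auto simp: D_def)
  then have pos: "Min D > 0" by (auto simp: D_def)
  have "ball x (Min D / 2) \<inter> ball y (Min D / 2) = {}" if "x \<in> Q" "y \<in> Q" "x \<noteq> y" for x y
  proof -
    have "dist x y \<in> D" using that by (force simp: D_def)
    then have "Min D \<le> dist x y" using fin by simp
    then show ?thesis by (intro disjoint_ballI) simp
  qed
  then show ?thesis using pos by (intro exI[of _ "Min D / 2"]) auto
qed

lemma upper_half_plane_eqI:
  assumes "cmod z = cmod w" "Re z = Re w" "Im z > 0" "Im w > 0"
  shows "z = w"
proof -
  have "(Im z)\<^sup>2 = (Im w)\<^sup>2"
    using cmod_power2[of z] cmod_power2[of w] assms by simp
  then show ?thesis using assms by (auto simp: complex_eq_iff power2_eq_iff)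
qed

lemma rho_eq: "rho = left_corner"
  by (simp add: rho_def left_corner_def cis_conv_exp mult_ac)

text \<open>The points of the boundary that are identified with \<open>z\<close> by \<open>z \<mapsto> - 1 / z\<close> or \<open>z \<mapsto> z + 1\<close>; near
  them lie the zeros that have been moved into the fundamental domain.\<close>
definition twins :: "complex \<Rightarrow> complex set" where
  "twins z = (if cmod z = 1 then {- 1 / z} else if Re z = - 1/2 then {z + 1} else {})"

lemma nontrivial_zero_cases:
  assumes "z \<in> nontrivial_zeros f"
  obtains "z \<in> fund_interior" "twins z = {}"
    | "cmod z = 1" "- 1/2 < Re z" "Re z < 0" "twins z = {- 1 / z}" "Re (- 1 / z) > 0" "cmod (- 1 / z) = 1"
    | "cmod z > 1" "Re z = - 1/2" "twins z = {z + 1}"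
proof -
  have z: "z \<in> fund_domain" "z \<noteq> \<i>" "z \<noteq> rho" using assms by (auto simp: nontrivial_zeros_def)
  then have Im: "Im z > 0" and c: "cmod z \<ge> 1" and Re: "- 1/2 \<le> Re z" "Re z < 1/2"
    by (auto simp: fund_domain_def upper_half_plane_def)
  consider "cmod z = 1" | "cmod z > 1" "Re z = - 1/2" | "cmod z > 1" "Re z > - 1/2" using c Re by force
  then show thesis
  proof cases
    case 1
    then have "Re z \<le> 0" using z(1) by (auto simp: fund_domain_def)
    moreover have "Re z \<noteq> 0" using upper_half_plane_eqI[of z \<i>] 1 Im z(2) by auto
    moreover have "Re z \<noteq> - 1/2"
      using upper_half_plane_eqI[of z left_corner] 1 Im z(3) by (auto simp: rho_eq) (simp add: left_corner_def)
    ultimately have "- 1/2 < Re z" "Re z < 0" using Re by auto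
    moreover have "- 1 / z = - cnj z" using cnj_unit[OF 1] by simp
    ultimately show thesis using that(2) 1 by (simp add: twins_def)
  next
    case 2
    then show thesis using that(3) by (simp add: twins_def)
  next
    case 3
    then show thesis using that(1) Im Re by (auto simp: fund_interior_def twins_def abs_less_iff)
  qed
qed

lemma twins_outside:
  assumes "z \<in> nontrivial_zeros f" "x \<in> twins z"
  shows "x \<notin> fund_domain"
  using assms(1)
proof (cases rule: nontrivial_zero_cases)
  case 2
  then show ?thesis using assms(2) by (auto simp: fund_domain_def)
next
  case 3
  then show ?thesis using assms(2) by (auto simp: fund_domain_def)
qed (use assms in auto)

lemma twins_inject:
  assumes "z \<in> nontrivial_zeros f" "z' \<in> nontrivial_zeros f" "x \<in> twins z" "x \<in> twins z'"
  shows "z = z'"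
  using assms(1)
proof (cases rule: nontrivial_zero_cases)
  case 1
  then show ?thesis using assms by simp
next
  case 2
  note z = 2
  have nz: "z \<noteq> 0" and re: "Re (- 1 / z) < 1/2"
    using z cnj_unit[OF z(1), symmetric] by auto
  show ?thesis using assms(2)
  proof (cases rule: nontrivial_zero_cases)
    case 2
    then have "- 1 / z = - 1 / z'" using z assms by simp
    then show ?thesis using nz by (auto simp: field_simps)
  next
    case 3
    then have "Re (- 1 / z) = 1/2" using z assms by simp
    then show ?thesis using re by simp
  qed (use assms in auto)
next
  case 3
  note z = 3
  show ?thesis using assms(2)
  proof (cases rule: nontrivial_zero_cases)
    case 2
    have "Re (- 1 / z') < 1/2" using 2 cnj_unit[of z', symmetric] by simp
    moreover have "- 1 / z' = z + 1" using z 2 assms by simp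
    ultimately have "Re (z + 1) < 1/2" by metis
    then show ?thesis using z by simp
  next
    case 3
    then show ?thesis using z assms by simp
  qed (use assms in auto)
qed

text \<open>Balls of a common radius around all zeros and their twins are disjoint, and the numbers of zeros of
  the perturbed form in them add up to at most \<open>n\<close>. The point \<open>\<i>\<close> is its own twin: its ball is
  counted twice against \<open>6p\<close> and so contains at least \<open>3p\<close> zeros.\<close>
theorem valence_inequality:
  assumes f: "real_form (2 * n) f" "(f \<longlongrightarrow> 1) at_cusp"
    and Z: "finite Z" "Z \<subseteq> nontrivial_zeros f"
  shows "6 * (\<Sum>z\<in>Z. zorder f z) + (if f \<i> = 0 then 3 else 0) \<le> int n"
proof -
  define Q where "Q = (\<Union>z\<in>Z. insert z (twins z)) \<union> {\<i>}"
  have fintw: "finite (insert z (twins z))" for z by (simp add: twins_def)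
  then have finQ: "finite Q" using Z by (auto simp: Q_def)
  obtain \<delta> where \<delta>: "\<delta> > 0" "\<And>x y. x \<in> Q \<Longrightarrow> y \<in> Q \<Longrightarrow> x \<noteq> y \<Longrightarrow> ball x \<delta> \<inter> ball y \<delta> = {}"
    using finite_set_separated[OF finQ] by blast
  define N where "N = (\<lambda>\<epsilon> x. zcount (perturbed f n \<epsilon>) (fund_interior \<inter> ball x \<delta>))"
  have iH: "\<i> \<in> upper_half_plane" by (simp add: upper_half_plane_def)
  have ev1: "\<forall>\<^sub>F \<epsilon> in at_right 0. 6 * zorder f z \<le> sum (N \<epsilon>) (insert z (twins z))" if "z \<in> Z" for z
  proof -
    have zn: "z \<in> nontrivial_zeros f" using that Z by blast
    then have z: "z \<in> upper_half_plane" "f z = 0"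
      by (auto simp: nontrivial_zeros_def fund_domain_def)
    from zn show ?thesis
    proof (cases rule: nontrivial_zero_cases)
      case 1
      then show ?thesis using local_count_interior[OF f 1(1) z(2) \<delta>(1)] by (simp add: N_def)
    next
      case 2
      then have "z \<noteq> - 1 / z" by (metis less_asym)
      then show ?thesis using local_count_arc[OF f z _ _ \<delta>(1)] 2 by (simp add: N_def)
    next
      case 3
      then show ?thesis using local_count_line[OF f z _ _ \<delta>(1)] by (simp add: N_def)
    qed
  qed
  have ev2: "\<forall>\<^sub>F \<epsilon> in at_right 0. f \<i> = 0 \<longrightarrow> 6 * zorder f \<i> \<le> 2 * N \<epsilon> \<i>"
  proof (cases "f \<i> = 0")
    case True
    show ?thesis using local_count_arc[OF f iH True _ _ \<delta>(1)]
      by (simp add: N_def)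
  qed simp
  have "\<forall>\<^sub>F \<epsilon> in at_right 0. \<forall>z\<in>Z. 6 * zorder f z \<le> sum (N \<epsilon>) (insert z (twins z))"
    using ev1 Z(1) by (intro eventually_ball_finite) auto
  from eventually_happens'[OF trivial_limit_at_right_real
      eventually_conj[OF eventually_conj[OF this ev2] eventually_at_right_less[of "0::real"]]]
  obtain \<epsilon> where conj: "((\<forall>z\<in>Z. 6 * zorder f z \<le> sum (N \<epsilon>) (insert z (twins z))) \<and>
      (f \<i> = 0 \<longrightarrow> 6 * zorder f \<i> \<le> 2 * N \<epsilon> \<i>)) \<and> 0 < \<epsilon>" ..
  have \<epsilon>: "\<epsilon> > 0" "\<And>z. z \<in> Z \<Longrightarrow> 6 * zorder f z \<le> sum (N \<epsilon>) (insert z (twins z))"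
    "f \<i> = 0 \<Longrightarrow> 6 * zorder f \<i> \<le> 2 * N \<epsilon> \<i>"
    by (rule conjunct2[OF conj], rule bspec[OF conjunct1[OF conjunct1[OF conj]]], assumption,
        rule mp[OF conjunct2[OF conjunct1[OF conj]]])
  have Nnn: "N \<epsilon> x \<ge> 0" for x
    unfolding N_def zcount_def
    by (intro sum_nonneg) (use interior_zeros_finite_nonneg(2)[OF f \<epsilon>(1)] in auto)
  have i_part: "(if f \<i> = 0 then 3 else 0) \<le> N \<epsilon> \<i>"
  proof (cases "f \<i> = 0")
    case True
    obtain \<beta> where "\<beta> \<in> upper_half_plane" "f \<beta> \<noteq> 0" using form_nonzero_somewhere[OF f(2)] by blast
    then have "zorder f \<i> > 0" using zorder_pos[OF real_formD(1)[OF f(1)] _ _ iH True] by blast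
    then show ?thesis using \<epsilon>(3) True by simp
  qed (simp add: Nnn)
  have "6 * (\<Sum>z\<in>Z. zorder f z) \<le> (\<Sum>z\<in>Z. sum (N \<epsilon>) (insert z (twins z)))"
    unfolding sum_distrib_left by (rule sum_mono) (rule \<epsilon>(2))
  also have "\<dots> = sum (N \<epsilon>) (\<Union>z\<in>Z. insert z (twins z))"
  proof (rule sum.UNION_disjoint[symmetric])
    have "insert z (twins z) \<inter> insert z' (twins z') = {}" if "z \<in> Z" "z' \<in> Z" "z \<noteq> z'" for z z'
    proof -
      have "z \<in> nontrivial_zeros f" "z' \<in> nontrivial_zeros f" "z \<in> fund_domain" "z' \<in> fund_domain"
        using that Z by (auto simp: nontrivial_zeros_def)
      then have "z \<notin> twins z'" "z' \<notin> twins z" "twins z \<inter> twins z' = {}"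
        using twins_outside[of z f] twins_outside[of z' f] twins_inject[of z f z'] that(3) by auto
      then show ?thesis using that(3) by simp
    qed
    then show "\<forall>i\<in>Z. \<forall>j\<in>Z. i \<noteq> j \<longrightarrow> insert i (twins i) \<inter> insert j (twins j) = {}" by blast
  qed (use Z fintw in auto)
  finally have "6 * (\<Sum>z\<in>Z. zorder f z) + N \<epsilon> \<i> \<le> sum (N \<epsilon>) (\<Union>z\<in>Z. insert z (twins z)) + N \<epsilon> \<i>"
    by simp
  also have "\<dots> = sum (N \<epsilon>) Q"
  proof -
    have "\<i> \<in> fund_domain" by (simp add: fund_domain_def upper_half_plane_def)
    then have "\<i> \<notin> (\<Union>z\<in>Z. insert z (twins z))"
      using Z(2) twins_outside[of _ f \<i>] by (auto simp: nontrivial_zeros_def)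
    then show ?thesis unfolding Q_def using Z(1) fintw by (subst sum.union_disjoint) auto
  qed
  also have "sum (N \<epsilon>) Q = zcount (perturbed f n \<epsilon>) (\<Union>x\<in>Q. fund_interior \<inter> ball x \<delta>)"
  proof -
    define W where "W = (\<lambda>x. {w. w \<in> fund_interior \<inter> ball x \<delta> \<and> perturbed f n \<epsilon> w = 0})"
    have "zcount (perturbed f n \<epsilon>) (\<Union>x\<in>Q. fund_interior \<inter> ball x \<delta>)
        = sum (zorder (perturbed f n \<epsilon>)) (\<Union>x\<in>Q. W x)"
      unfolding zcount_def by (rule sum.cong) (auto simp: W_def)
    also have "\<dots> = (\<Sum>x\<in>Q. sum (zorder (perturbed f n \<epsilon>)) (W x))"
    proof (rule sum.UNION_disjoint[OF finQ])
      show "\<forall>x\<in>Q. finite (W x)"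
        unfolding W_def by (intro ballI interior_zeros_finite_nonneg(1)[OF f \<epsilon>(1)])
      show "\<forall>x\<in>Q. \<forall>y\<in>Q. x \<noteq> y \<longrightarrow> W x \<inter> W y = {}"
      proof (intro ballI impI)
        fix x y assume "x \<in> Q" "y \<in> Q" "x \<noteq> y"
        then have "ball x \<delta> \<inter> ball y \<delta> = {}" by (rule \<delta>(2))
        moreover have "W x \<subseteq> ball x \<delta>" "W y \<subseteq> ball y \<delta>" by (auto simp: W_def)
        ultimately show "W x \<inter> W y = {}" by blast
      qed
    qed
    finally show ?thesis by (simp add: N_def zcount_def W_def)
  qed
  also have "\<dots> \<le> zcount (perturbed f n \<epsilon>) fund_interior"
    unfolding zcount_def
    by (rule sum_mono2) (use perturbed_count(1)[OF f \<epsilon>(1)] interior_zeros_finite_nonneg(2)[OF f \<epsilon>(1)] in auto)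
  also have "\<dots> = int n" by (rule perturbed_count(2)[OF f \<epsilon>(1)])
  finally show ?thesis using i_part by linarith
qed

section \<open>Zeros on the arc\<close>

lemma arc_A_memD:
  assumes "z \<in> arc_A"
  shows "cmod z = 1" "- 1/2 \<le> Re z" "Re z \<le> 0" "Im z > 0" "z \<in> upper_half_plane"
proof -
  obtain t where t: "pi / 2 \<le> t" "t \<le> 2 * pi / 3" "z = cis t"
    using assms by (auto simp: arc_A_def cis_conv_exp)
  show "cmod z = 1" using t by simp
  have "cos (2 * pi / 3) \<le> cos t" "cos t \<le> cos (pi / 2)"
    using t pi_gt_zero by (intro cos_monotone_0_pi_le; linarith)+
  then show "- 1/2 \<le> Re z" "Re z \<le> 0" using t(3) by (simp_all add: cos_120)
  have "sin t > 0" using t(1,2) pi_gt_zero by (intro sin_gt_zero; linarith)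
  then show "Im z > 0" using t by simp
  then show "z \<in> upper_half_plane" by (simp add: upper_half_plane_def)
qed

lemma cmod_Delta_le_sup:
  assumes "z \<in> arc_A"
  shows "cmod (cusp_Delta z) \<le> sup_Delta"
  unfolding sup_Delta_def
proof (rule cSUP_upper[OF assms])
  have eq: "arc_A = (\<lambda>t. exp (\<i> * of_real t)) ` {pi / 2..2 * pi / 3}"
    by (auto simp: arc_A_def)
  have "compact arc_A"
    unfolding eq by (intro compact_continuous_image continuous_intros compact_Icc)
  moreover have "continuous_on arc_A (\<lambda>z. cmod (cusp_Delta z))"
    by (intro continuous_on_norm holomorphic_on_imp_continuous_on
          holomorphic_on_subset[OF real_formD(1)[OF real_form_Delta]]) (auto dest: arc_A_memD)
  ultimately show "bdd_above ((\<lambda>z. cmod (cusp_Delta z)) ` arc_A)"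
    by (intro bounded_imp_bdd_above compact_imp_bounded compact_continuous_image)
qed

lemma weight_cases:
  assumes "even k" "k \<ge> 12"
  shows "k = 12 * weight_m k + weight_s k" "weight_s k \<in> {0, 4, 6, 8, 10, 14}" "even (weight_s k)"
proof -
  show "k = 12 * weight_m k + weight_s k" "weight_s k \<in> {0, 4, 6, 8, 10, 14}"
    using weight_decomp[of k] assms by (auto simp: weight_residues_def)
  then show "even (weight_s k)" by auto
qed

lemma residual_weight:
  assumes "even k" "k \<ge> 12" "j \<le> weight_m k"
  shows "even (k - 12 * j)" "k - 12 * j = 0 \<or> k - 12 * j \<ge> 4" "k - 12 * j + 12 * j = k"
    "j < weight_m k \<Longrightarrow> k - 12 * j \<ge> 12" "j = weight_m k \<Longrightarrow> k - 12 * j = weight_s k"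
proof -
  note w = weight_cases[OF assms(1,2)]
  have e: "k - 12 * j = 12 * (weight_m k - j) + weight_s k" using w(1) assms(3) by linarith
  show "even (k - 12 * j)" using e w(3) by simp
  show "k - 12 * j = 0 \<or> k - 12 * j \<ge> 4"
    unfolding e using w(2) by (cases "weight_m k - j") auto
  show "k - 12 * j + 12 * j = k" using w(1) assms(3) by linarith
  show "k - 12 * j \<ge> 12" if "j < weight_m k" unfolding e using that by simp
  show "k - 12 * j = weight_s k" if "j = weight_m k" unfolding e using that by simp
qed

text \<open>For \<open>j < m(k)\<close> the weight \<open>k - 12j\<close> is at least 12, so that \<open>3 + \<delta>_12\<close> bounds the Eisenstein series;
  for \<open>j = m(k)\<close> the weight is \<open>s\<close>.\<close>
lemma coeff_sum_le:
  assumes k: "even k" "k \<ge> 12" and z: "z \<in> arc_A"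
  shows "(\<Sum>j = 1..weight_m k. \<bar>a j\<bar> * cmod (eisenstein (k - 12 * j) z) * cmod (cusp_Delta z) ^ j)
           \<le> coeff_bound k a"
proof (cases "weight_m k = 0")
  case True
  then show ?thesis by (simp add: coeff_bound_def)
next
  case False
  define m where "m = weight_m k"
  have E: "cmod (eisenstein (k - 12 * j) z) \<le> 3 + delta_const (k - 12 * j)" if "j \<le> m" for j
    using cmod_eisenstein_on_arc_le residual_weight(1,2)[OF k] that arc_A_memD[OF z] by (simp add: m_def)
  have D: "cmod (cusp_Delta z) ^ j \<le> sup_Delta ^ j" for j
    by (intro power_mono cmod_Delta_le_sup z) simp
  have term_le: "\<bar>a j\<bar> * cmod (eisenstein (k - 12 * j) z) * cmod (cusp_Delta z) ^ j
      \<le> (3 + delta_const (k - 12 * j)) * (\<bar>a j\<bar> * sup_Delta ^ j)" if "j \<le> m" for j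
  proof -
    have "\<bar>a j\<bar> * cmod (eisenstein (k - 12 * j) z) * cmod (cusp_Delta z) ^ j
        = cmod (eisenstein (k - 12 * j) z) * (\<bar>a j\<bar> * cmod (cusp_Delta z) ^ j)" by simp
    also have "\<dots> \<le> (3 + delta_const (k - 12 * j)) * (\<bar>a j\<bar> * sup_Delta ^ j)"
      using E[OF that] order_trans[OF norm_ge_zero E[OF that]]
      by (intro mult_mono mult_left_mono D) auto
    finally show ?thesis .
  qed
  have "{1..m} = insert m {1..m - 1}" using False by (auto simp: m_def)
  then have "(\<Sum>j = 1..m. \<bar>a j\<bar> * cmod (eisenstein (k - 12 * j) z) * cmod (cusp_Delta z) ^ j)
     = \<bar>a m\<bar> * cmod (eisenstein (k - 12 * m) z) * cmod (cusp_Delta z) ^ m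
       + (\<Sum>j = 1..m - 1. \<bar>a j\<bar> * cmod (eisenstein (k - 12 * j) z) * cmod (cusp_Delta z) ^ j)"
    using False by (simp add: m_def)
  also have "\<dots> \<le> (3 + delta_const (k - 12 * m)) * (\<bar>a m\<bar> * sup_Delta ^ m)
       + (\<Sum>j = 1..m - 1. (3 + delta_const 12) * (\<bar>a j\<bar> * sup_Delta ^ j))"
  proof (intro add_mono term_le sum_mono)
    fix j assume "j \<in> {1..m - 1}"
    then have j: "j < m" by auto
    have "delta_const (k - 12 * j) = delta_const 12"
      using residual_weight(4)[OF k, of j] j by (simp add: m_def delta_const_def)
    then show "\<bar>a j\<bar> * cmod (eisenstein (k - 12 * j) z) * cmod (cusp_Delta z) ^ j
        \<le> (3 + delta_const 12) * (\<bar>a j\<bar> * sup_Delta ^ j)" using term_le[of j] j by simp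
  qed simp
  also have "\<dots> = coeff_bound k a"
    using False residual_weight(5)[OF k, of m]
    by (simp add: coeff_bound_def Let_def m_def sum_distrib_left mult.assoc)
  finally show ?thesis by (simp add: m_def)
qed

definition form_of :: "nat \<Rightarrow> (nat \<Rightarrow> real) \<Rightarrow> complex \<Rightarrow> complex" where
  "form_of k a z = eisenstein k z
     + (\<Sum>j = 1..weight_m k. complex_of_real (a j) * eisenstein (k - 12 * j) z * cusp_Delta z ^ j)"

lemma real_form_form_of:
  assumes k: "even k" "k \<ge> 12"
  shows "real_form k (form_of k a)"
proof -
  have "real_form k (\<lambda>z. eisenstein k z + (\<Sum>j = 1..weight_m k. of_real (a j) * (eisenstein (k - 12 * j) z * cusp_Delta z ^ j)))"
  proof (intro real_form_add real_form_sum real_form_scale)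
    show "real_form k (eisenstein k)" using k by (intro real_form_eisenstein) auto
    fix j assume "j \<in> {1..weight_m k}"
    then have j: "j \<le> weight_m k" by simp
    have "real_form (k - 12 * j + 12 * j) (\<lambda>z. eisenstein (k - 12 * j) z * cusp_Delta z ^ j)"
      by (intro real_form_mult real_form_power real_form_Delta real_form_eisenstein residual_weight(1,2)[OF k j])
    then show "real_form k (\<lambda>z. eisenstein (k - 12 * j) z * cusp_Delta z ^ j)"
      using residual_weight(3)[OF k j] by simp
  qed
  then show ?thesis by (simp add: form_of_def[abs_def] mult.assoc)
qed

lemma form_of_tendsto:
  assumes k: "even k" "k \<ge> 12"
  shows "(form_of k a \<longlongrightarrow> 1) at_cusp"
proof -
  have E: "(eisenstein l \<longlongrightarrow> 1) at_cusp" if "even l" "l = 0 \<or> l \<ge> 4" for l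
  proof (cases "l = 0")
    case True
    then have "eisenstein l = (\<lambda>_. 1)" by (auto simp: eisenstein_def)
    then show ?thesis by simp
  qed (use that eisenstein_tendsto_cusp in auto)
  have "((\<lambda>z. eisenstein k z
     + (\<Sum>j = 1..weight_m k. complex_of_real (a j) * eisenstein (k - 12 * j) z * cusp_Delta z ^ j))
     \<longlongrightarrow> 1 + (\<Sum>j = 1..weight_m k. complex_of_real (a j) * 1 * 0 ^ j)) at_cusp"
    by (intro tendsto_intros E cusp_Delta_tendsto residual_weight(1,2)[OF k]) (use k in auto)
  moreover have "(\<Sum>j = 1..weight_m k. complex_of_real (a j) * 1 * 0 ^ j) = 0"
    by (intro sum.neutral) auto
  ultimately show ?thesis by (simp add: form_of_def[abs_def])
qed

lemma form_of_near_cosine: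
  assumes k: "k = 2 * n" "k \<ge> 12" and bound: "coeff_bound k a \<le> 1 - delta_const 12" and z: "z \<in> arc_A"
  shows "\<bar>Re (z ^ n * form_of k a z) - 2 * Re (z ^ n)\<bar> < 2"
proof -
  have ev: "even k" using k by simp
  note zA = arc_A_memD[OF z]
  have 1: "cmod (z ^ n * eisenstein k z - of_real (2 * Re (z ^ n))) < 511 / 500"
    unfolding k(1) by (rule eisenstein_on_arc_large_weight) (use k zA in auto)
  have "cmod (form_of k a z - eisenstein k z)
     \<le> (\<Sum>j = 1..weight_m k. cmod (complex_of_real (a j) * eisenstein (k - 12 * j) z * cusp_Delta z ^ j))"
    unfolding form_of_def by (simp add: sum_norm_le norm_sum)
  also have "\<dots> \<le> coeff_bound k a"
    using coeff_sum_le[OF ev k(2) z, of a] by (simp add: norm_mult norm_power)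
  finally have "cmod (z ^ n * (form_of k a z - eisenstein k z)) \<le> 1 - delta_const 12"
    using bound zA(1) by (simp add: norm_mult norm_power)
  moreover have "z ^ n * form_of k a z - of_real (2 * Re (z ^ n))
     = (z ^ n * eisenstein k z - of_real (2 * Re (z ^ n))) + z ^ n * (form_of k a z - eisenstein k z)"
    by (simp add: algebra_simps)
  ultimately have "cmod (z ^ n * form_of k a z - of_real (2 * Re (z ^ n))) < 511 / 500 + (1 - delta_const 12)"
    using 1 norm_triangle_ineq[of "z ^ n * eisenstein k z - of_real (2 * Re (z ^ n))"
        "z ^ n * (form_of k a z - eisenstein k z)"] by (simp only:)
  also have "\<dots> = 2" by (simp add: delta_const_def)
  finally show ?thesis
    using abs_Re_le_cmod[of "z ^ n * form_of k a z - of_real (2 * Re (z ^ n))"] by simp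
qed

text \<open>The angles \<open>\<theta> l = 2\<pi>l/k\<close> lie in \<open>[\<pi>/2, 2\<pi>/3]\<close> exactly if \<open>k/4 \<le> l \<le> k/3\<close>. The first such \<open>l\<close> is
  \<open>l0 = \<lceil>k/4\<rceil>\<close>, and for each of the six residues \<open>s\<close> one has \<open>l0 + m(k) \<le> k/3\<close>.\<close>
lemma form_of_zeros_on_arc:
  assumes k: "even k" "k \<ge> 12" and bound: "coeff_bound k a \<le> 1 - delta_const 12"
  shows "\<exists>X. X \<subseteq> nontrivial_zeros (form_of k a) \<and> X \<subseteq> arc_A \<and> finite X \<and> card X = weight_m k"
proof -
  define m n l0 where "m = weight_m k" and "n = k div 2" and "l0 = (k + 3) div 4"
  have kn: "k = 2 * n" "n \<ge> 6" using k by (auto simp: n_def)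
  have l0: "2 * l0 \<ge> n" "3 * (l0 + m) \<le> 2 * n"
  proof -
    show "2 * l0 \<ge> n" using k by (auto simp: l0_def n_def)
    have "3 * (l0 + m) \<le> k"
    proof -
      have "3 * ((12 * M + s + 3) div 4 + M) \<le> 12 * M + s" if "s \<in> {0, 4, 6, 8, 10, 14}" for M s :: nat
        using that by auto presburger
      from this[OF weight_cases(2)[OF k], of "weight_m k"] show ?thesis
        using weight_cases(1)[OF k] by (simp add: l0_def m_def)
    qed
    then show "3 * (l0 + m) \<le> 2 * n" using kn by simp
  qed
  define \<theta> where "\<theta> = (\<lambda>l. pi * real l / real n)"
  have \<theta>_mono: "\<theta> l < \<theta> l' \<longleftrightarrow> l < l'" "\<theta> l \<le> \<theta> l' \<longleftrightarrow> l \<le> l'" for l l'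
    using kn pi_gt_zero by (simp_all add: \<theta>_def divide_less_cancel divide_le_cancel)
  have \<theta>_range: "pi / 2 \<le> \<theta> l" "\<theta> l \<le> 2 * pi / 3" if "l \<in> {l0..l0 + m}" for l
  proof -
    have "n \<le> 2 * l" "3 * l \<le> 2 * n" using that l0 by auto
    then have "real n \<le> 2 * real l" "3 * real l \<le> 2 * real n" by linarith+
    then have "pi * real n \<le> pi * (2 * real l)" "pi * (3 * real l) \<le> pi * (2 * real n)"
      by (intro mult_left_mono; simp)+
    then show "pi / 2 \<le> \<theta> l" "\<theta> l \<le> 2 * pi / 3"
      using kn by (simp_all add: \<theta>_def field_simps)
  qed
  define g where "g = (\<lambda>t. Re (cis t ^ n * form_of k a (cis t)))"
  have arc: "cis t \<in> arc_A" if "pi / 2 \<le> t" "t \<le> 2 * pi / 3" for t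
    using that by (auto simp: arc_A_def cis_conv_exp)
  have cont: "continuous_on {pi / 2..2 * pi / 3} g"
  proof -
    have "continuous_on arc_A (form_of k a)"
      by (intro holomorphic_on_imp_continuous_on
          holomorphic_on_subset[OF real_formD(1)[OF real_form_form_of[OF k]]]) (auto dest: arc_A_memD)
    then have "continuous_on {pi / 2..2 * pi / 3} (\<lambda>t. form_of k a (cis t))"
      by (rule continuous_on_compose2) (use arc in \<open>auto intro!: continuous_intros\<close>)
    then show ?thesis unfolding g_def by (intro continuous_intros)
  qed
  have sign: "(- 1) ^ l * g (\<theta> l) > 0" if "l \<in> {l0..l0 + m}" for l
  proof -
    have "Re (cis (\<theta> l) ^ n) = (- 1) ^ l"
      using kn by (simp add: Complex.DeMoivre \<theta>_def cos_npi mult.commute)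
    then have "\<bar>g (\<theta> l) - 2 * (- 1) ^ l\<bar> < 2"
      using form_of_near_cosine[OF kn(1) k(2) bound arc[OF \<theta>_range[OF that]]] by (simp add: g_def)
    then show ?thesis by (cases "even l") (auto simp: abs_less_iff)
  qed
  have "\<exists>t. \<theta> l < t \<and> t < \<theta> (Suc l) \<and> g t = 0" if "l \<in> {l0..<l0 + m}" for l
  proof -
    have l: "l \<in> {l0..l0 + m}" "Suc l \<in> {l0..l0 + m}" using that by auto
    have "continuous_on {\<theta> l..\<theta> (Suc l)} (\<lambda>t. (- 1) ^ l * g t)"
      by (intro continuous_intros continuous_on_subset[OF cont])
         (use \<theta>_range[OF l(1)] \<theta>_range[OF l(2)] in auto)
    moreover have "(- 1) ^ l * g (\<theta> (Suc l)) < 0" using sign[OF l(2)] by simp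
    ultimately obtain t where t: "\<theta> l \<le> t" "t \<le> \<theta> (Suc l)" "(- 1) ^ l * g t = 0"
      using IVT2'[of "\<lambda>t. (- 1) ^ l * g t" "\<theta> (Suc l)" 0 "\<theta> l"] sign[OF l(1)] \<theta>_mono(2)[of l "Suc l"] by auto
    have "g t = 0" using t(3) by simp
    moreover have "t \<noteq> \<theta> l" "t \<noteq> \<theta> (Suc l)" using \<open>g t = 0\<close> sign[OF l(1)] sign[OF l(2)] by auto
    ultimately show ?thesis using t by (intro exI[of _ t]) auto
  qed
  then obtain t where t: "\<And>l. l \<in> {l0..<l0 + m} \<Longrightarrow> \<theta> l < t l \<and> t l < \<theta> (Suc l) \<and> g (t l) = 0"
    by metis
  have trange: "pi / 2 < t l" "t l < 2 * pi / 3" if "l \<in> {l0..<l0 + m}" for l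
    using t[OF that] \<theta>_range(1)[of l] \<theta>_range(2)[of "Suc l"] that by auto
  define X where "X = (\<lambda>l. cis (t l)) ` {l0..<l0 + m}"
  have "inj_on (\<lambda>l. cis (t l)) {l0..<l0 + m}"
  proof (rule linorder_inj_onI)
    fix l l' assume l: "l < l'" "l \<in> {l0..<l0 + m}" "l' \<in> {l0..<l0 + m}"
    have "t l < \<theta> (Suc l)" "\<theta> (Suc l) \<le> \<theta> l'" "\<theta> l' < t l'"
      using t[OF l(2)] t[OF l(3)] \<theta>_mono(2) l(1) by auto
    then have "cos (t l') < cos (t l)"
      using trange[OF l(2)] trange[OF l(3)] pi_gt_zero by (intro cos_monotone_0_pi) linarith+
    then show "cis (t l) \<noteq> cis (t l')" by (metis cis.simps(1) less_irrefl)
  next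
    show "x \<le> y \<or> y \<le> x" for x y :: nat by (rule linear)
  qed
  then have "card X = m" by (simp add: X_def card_image)
  moreover have "X \<subseteq> arc_A" using arc trange by (fastforce simp: X_def)
  moreover have "X \<subseteq> nontrivial_zeros (form_of k a)"
  proof
    fix z assume "z \<in> X"
    then obtain l where l: "l \<in> {l0..<l0 + m}" "z = cis (t l)" by (auto simp: X_def)
    have zA: "z \<in> arc_A" using arc trange[OF l(1)] l(2) by simp
    note z = arc_A_memD[OF zA]
    have "z ^ n * form_of k a z \<in> \<real>"
      by (rule real_form_circle[OF _ z(5,1)]) (use real_form_form_of[OF k] kn(1) in simp)
    moreover have "Re (z ^ n * form_of k a z) = 0" using t[OF l(1)] l(2) by (simp add: g_def)
    ultimately have "z ^ n * form_of k a z = 0"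
      by (intro complex_eqI) (simp_all only: complex_is_Real_iff zero_complex.simps)
    then have f0: "form_of k a z = 0" using z(1) by auto
    have "cos (2 * pi / 3) < cos (t l)" "cos (t l) < cos (pi / 2)"
      using trange[OF l(1)] pi_gt_zero by (intro cos_monotone_0_pi; linarith)+
    then have "- 1/2 < Re z" "Re z < 0" using l(2) by (simp_all add: cos_120)
    then have "z \<noteq> \<i>" "z \<noteq> rho" by (auto simp: rho_eq)
    then show "z \<in> nontrivial_zeros (form_of k a)"
      using f0 z by (simp add: nontrivial_zeros_def fund_domain_def)
  qed
  ultimately show ?thesis by (intro exI[of _ X]) (simp add: X_def m_def)
qed

text \<open>Here \<open>n = k/2 = 6 m(k) + s/2\<close>. If \<open>s \<le> 10\<close>, the valence inequality alone is enough. If \<open>s = 14\<close>, then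
  \<open>\<i>^k = -1\<close> forces a zero at \<open>\<i>\<close>, whose share of 3 leaves \<open>6 m(k) + 4\<close>.\<close>
lemma form_of_zeros_bound:
  assumes k: "even k" "k \<ge> 12" and Z: "finite Z" "Z \<subseteq> nontrivial_zeros (form_of k a)"
  shows "(\<Sum>z\<in>Z. zorder (form_of k a) z) \<le> int (weight_m k)"
proof -
  define n where "n = k div 2"
  have kn: "k = 2 * n" using k by (auto simp: n_def)
  define f where "f = form_of k a"
  have rf: "real_form (2 * n) f" using real_form_form_of[OF k] kn by (simp add: f_def)
  have v: "6 * (\<Sum>z\<in>Z. zorder f z) + (if f \<i> = 0 then 3 else 0) \<le> int n"
    by (rule valence_inequality[OF rf _ Z(1)])
       (use form_of_tendsto[OF k] Z(2) in \<open>simp_all add: f_def\<close>)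
  note w = weight_cases[OF k]
  show ?thesis
  proof (cases "weight_s k = 14")
    case True
    then have n: "n = 6 * weight_m k + 7" using w kn by simp
    have "f \<i> = \<i> ^ (2 * n) * f \<i>"
      using real_formD(3)[OF rf, of \<i>] by (simp add: upper_half_plane_def)
    moreover have "\<i> ^ (2 * n) = - 1" unfolding n by (simp add: power_mult)
    ultimately have "f \<i> = 0" by simp
    then show ?thesis using v n by (simp add: f_def)
  next
    case False
    then have "n \<le> 6 * weight_m k + 5" using w kn by auto
    then show ?thesis using v by (simp add: f_def split: if_splits)
  qed
qed

theorem theorem1:
  fixes k :: nat and a :: "nat \<Rightarrow> real" and f :: "complex \<Rightarrow> complex"
  assumes "even k" and "k \<ge> 12"
    and "\<And>z. z \<in> upper_half_plane \<Longrightarrow>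
           f z = eisenstein k z
                 + (\<Sum>j = 1..weight_m k.
                      complex_of_real (a j) * eisenstein (k - 12 * j) z * cusp_Delta z ^ j)"
    and "coeff_bound k a \<le> 1 - delta_const 12"
  shows "finite (nontrivial_zeros f)
       \<and> card (nontrivial_zeros f) = weight_m k
       \<and> (\<Sum>z\<in>nontrivial_zeros f. zorder f z) = int (weight_m k)
       \<and> nontrivial_zeros f \<subseteq> arc_A"
proof -
  define F where "F = form_of k a"
  define m where "m = weight_m k"
  have fF: "f z = F z" if "z \<in> upper_half_plane" for z
    using assms(3)[OF that] by (simp add: F_def form_of_def)
  have dom: "z \<in> upper_half_plane" if "z \<in> nontrivial_zeros F" for z
    using that by (auto simp: nontrivial_zeros_def fund_domain_def)
  have same: "nontrivial_zeros f = nontrivial_zeros F"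
    using fF by (auto simp: nontrivial_zeros_def fund_domain_def)
  have ord: "zorder f z = zorder F z" if "z \<in> upper_half_plane" for z
  proof (rule zorder_cong)
    have "\<forall>\<^sub>F w in nhds z. w \<in> upper_half_plane"
      using that by (intro eventually_nhds_in_open open_upper_half_plane)
    then have "\<forall>\<^sub>F w in at z. w \<in> upper_half_plane" by (simp add: eventually_nhds_conv_at)
    then show "\<forall>\<^sub>F w in at z. f w = F w" by (rule eventually_mono) (rule fF)
  qed simp
  obtain \<beta> where \<beta>: "\<beta> \<in> upper_half_plane" "F \<beta> \<noteq> 0"
    using form_nonzero_somewhere[OF form_of_tendsto[OF assms(1,2)]] by (auto simp: F_def)
  have pos: "zorder F z \<ge> 1" if "z \<in> nontrivial_zeros F" for z
    using zorder_pos[OF real_formD(1)[OF real_form_form_of[OF assms(1,2)]], of \<beta> a z] \<beta> dom[OF that] that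
    by (simp add: F_def nontrivial_zeros_def)
  have bound: "(\<Sum>z\<in>Z. zorder F z) \<le> int m" "int (card Z) \<le> (\<Sum>z\<in>Z. zorder F z)"
    if "finite Z" "Z \<subseteq> nontrivial_zeros F" for Z
  proof -
    show "(\<Sum>z\<in>Z. zorder F z) \<le> int m"
      using form_of_zeros_bound[OF assms(1,2)] that by (simp add: F_def m_def)
    have "(\<Sum>z\<in>Z. 1) \<le> (\<Sum>z\<in>Z. zorder F z)" by (rule sum_mono) (use pos that in auto)
    then show "int (card Z) \<le> (\<Sum>z\<in>Z. zorder F z)" by simp
  qed
  have fin: "finite (nontrivial_zeros F)"
  proof (rule ccontr)
    assume "infinite (nontrivial_zeros F)"
    then obtain Z where "finite Z" "card Z = Suc m" "Z \<subseteq> nontrivial_zeros F"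
      using infinite_arbitrarily_large by blast
    then show False using bound[of Z] by simp
  qed
  obtain X where X: "X \<subseteq> nontrivial_zeros F" "X \<subseteq> arc_A" "card X = m"
    using form_of_zeros_on_arc[OF assms(1,2,4)] by (auto simp: F_def m_def)
  have b: "(\<Sum>z\<in>nontrivial_zeros F. zorder F z) \<le> int m"
    "int (card (nontrivial_zeros F)) \<le> (\<Sum>z\<in>nontrivial_zeros F. zorder F z)"
    using bound[OF fin] by auto
  have eq: "X = nontrivial_zeros F" by (rule card_seteq[OF fin X(1)]) (use b X(3) in linarith)
  have "(\<Sum>z\<in>nontrivial_zeros f. zorder f z) = (\<Sum>z\<in>nontrivial_zeros F. zorder F z)"
    unfolding same by (rule sum.cong) (use ord dom in auto)
  then show ?thesis using fin eq X b unfolding same m_def[symmetric] by auto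
qed

end
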